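(* (i) $q_B(C_4)=4$ and $q_B(K_4-e)=5$. If $G$ is a $2$-connected outerplanar graph with maximum degree at most $\Delta$ that is not isomorphic to $C_4$ or to $K_4-e$, then $q_B(G)\le \Delta+1$. This is sharp for $\Delta=2$ and $\Delta=4$, i.e. for each $\Delta\in\{2,4\}$ there is a $2$-connected outerplanar graph $G$ with maximum degree at most $\Delta$, not isomorphic to $C_4$ or $K_4-e$, such that $q_B(G)=\Delta+1$. (ii) If $\Delta\ge 5$ and $G$ is a $2$-connected outerplanar graph with maximum degree at most $\Delta$, then $\omega(L^+(G))\le \Delta$. This is sharp, i.e. for every $\Delta\ge 5$ there is a $2$-connected outerplanar graph $G$ with maximum degree at most $\Delta$ and $\omega(L^+(G))=\Delta$.
   Context: All graphs are finite and simple. A graph is outerplanar if it admits a plane embedding such that all of its vertices lie on the boundary of the same face. (A $2$-connected graph has at least three vertices; a $2$-connected outerplanar graph is a Hamiltonian cycle with some, possibly zero, chords.) $K_4-e$ is the complete graph on four vertices with one edge removed, and $C_4$ is the cycle on four vertices. $\omega(\cdot)$ denotes the clique number (the size of the largest clique). A proper edge coloring of $G$ (incident edges get different colors) is a B-coloring if every 4-cycle of $G$ (as a subgraph, not necessarily induced) is colored with four different colors. $q_B(G)$ is the smallest number of colors needed for a B-coloring of $G$. The extended line graph $L^+(G)$ has the edges of $G$ as its vertices; two distinct edges of $G$ are adjacent in $L^+(G)$ if and only if either they share an endpoint, or they are independent (vertex-disjoint) and there is a 4-cycle of $G$ containing both. *)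

theory Defs
  imports "HOL-Analysis.Analysis"
begin

datatype 'a sgraph = SGraph (verts: "'a set") (edges: "'a set set")

definition simple_graph :: "'a sgraph \<Rightarrow> bool" where
  "simple_graph G \<longleftrightarrow>
     finite (verts G) \<and> (\<forall>e\<in>edges G. e \<subseteq> verts G \<and> card e = 2)"

definition graph_iso :: "'a sgraph \<Rightarrow> 'b sgraph \<Rightarrow> bool" where
  "graph_iso G H \<longleftrightarrow>
     (\<exists>f. bij_betw f (verts G) (verts H) \<and>
          (\<forall>u\<in>verts G. \<forall>v\<in>verts G. {u, v} \<in> edges G \<longleftrightarrow> {f u, f v} \<in> edges H))"

definition degree :: "'a sgraph \<Rightarrow> 'a \<Rightarrow> nat" where
  "degree G v = card {e \<in> edges G. v \<in> e}"

text \<open>Meaningful only for finite graphs with at least one vertex.\<close>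

definition max_degree :: "'a sgraph \<Rightarrow> nat" where
  "max_degree G = Max (degree G ` verts G)"

definition graph_connected :: "'a sgraph \<Rightarrow> bool" where
  "graph_connected G \<longleftrightarrow>
     verts G \<noteq> {} \<and>
     (\<forall>u\<in>verts G. \<forall>v\<in>verts G. (u, v) \<in> {(x, y). {x, y} \<in> edges G}\<^sup>*)"

definition delete_vertex :: "'a sgraph \<Rightarrow> 'a \<Rightarrow> 'a sgraph" where
  "delete_vertex G v = SGraph (verts G - {v}) {e \<in> edges G. v \<notin> e}"

definition two_connected :: "'a sgraph \<Rightarrow> bool" where
  "two_connected G \<longleftrightarrow>
     3 \<le> card (verts G) \<and> graph_connected G \<and>
     (\<forall>v\<in>verts G. graph_connected (delete_vertex G v))"

definition is_clique :: "'a sgraph \<Rightarrow> 'a set \<Rightarrow> bool" where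
  "is_clique G K \<longleftrightarrow> K \<subseteq> verts G \<and> (\<forall>u\<in>K. \<forall>v\<in>K. u \<noteq> v \<longrightarrow> {u, v} \<in> edges G)"

definition clique_number :: "'a sgraph \<Rightarrow> nat" where
  "clique_number G = Max {card K | K. is_clique G K}"

definition cycle4 :: "nat sgraph" where
  "cycle4 = SGraph {0, 1, 2, 3} {{0, 1}, {1, 2}, {2, 3}, {3, 0}}"

definition K4_minus_edge :: "nat sgraph" where
  "K4_minus_edge =
     SGraph {0, 1, 2, 3} ({e. e \<subseteq> {0, 1, 2, 3} \<and> card e = 2} - {{1, 3}})"

text \<open>Edges may be drawn as arbitrary topological arcs, not only polygonal ones.\<close>

definition plane_embedding ::
    "'a sgraph \<Rightarrow> ('a \<Rightarrow> complex) \<Rightarrow> ('a set \<Rightarrow> real \<Rightarrow> complex) \<Rightarrow> bool" where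
  "plane_embedding G p \<gamma> \<longleftrightarrow>
     inj_on p (verts G) \<and>
     (\<forall>e\<in>edges G. arc (\<gamma> e) \<and>
        {pathstart (\<gamma> e), pathfinish (\<gamma> e)} = p ` e \<and>
        path_image (\<gamma> e) \<inter> p ` verts G = p ` e) \<and>
     (\<forall>e\<in>edges G. \<forall>f\<in>edges G. e \<noteq> f \<longrightarrow>
        path_image (\<gamma> e) \<inter> path_image (\<gamma> f) = p ` (e \<inter> f))"

definition faces ::
    "'a sgraph \<Rightarrow> ('a \<Rightarrow> complex) \<Rightarrow> ('a set \<Rightarrow> real \<Rightarrow> complex) \<Rightarrow> complex set set" where
  "faces G p \<gamma> = components (- (p ` verts G \<union> (\<Union>e\<in>edges G. path_image (\<gamma> e))))"

definition outerplanar :: "'a sgraph \<Rightarrow> bool" where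
  "outerplanar G \<longleftrightarrow>
     (\<exists>p \<gamma>. plane_embedding G p \<gamma> \<and> (\<exists>F\<in>faces G p \<gamma>. p ` verts G \<subseteq> frontier F))"

text \<open>The edge sets of the 4-cycles contained in \<open>G\<close> as (not necessarily induced) subgraphs.\<close>

definition four_cycles :: "'a sgraph \<Rightarrow> 'a set set set" where
  "four_cycles G =
     {{{a, b}, {b, c}, {c, d}, {d, a}} | a b c d.
        distinct [a, b, c, d] \<and> {{a, b}, {b, c}, {c, d}, {d, a}} \<subseteq> edges G}"

definition proper_edge_coloring :: "'a sgraph \<Rightarrow> ('a set \<Rightarrow> nat) \<Rightarrow> bool" where
  "proper_edge_coloring G col \<longleftrightarrow>
     (\<forall>e\<in>edges G. \<forall>f\<in>edges G. e \<noteq> f \<and> e \<inter> f \<noteq> {} \<longrightarrow> col e \<noteq> col f)"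

definition B_coloring :: "'a sgraph \<Rightarrow> ('a set \<Rightarrow> nat) \<Rightarrow> bool" where
  "B_coloring G col \<longleftrightarrow>
     proper_edge_coloring G col \<and> (\<forall>C\<in>four_cycles G. card (col ` C) = 4)"

definition q_B :: "'a sgraph \<Rightarrow> nat" where
  "q_B G = (LEAST k. \<exists>col. B_coloring G col \<and> col ` edges G \<subseteq> {..<k})"

definition ext_line_graph :: "'a sgraph \<Rightarrow> 'a set sgraph" where
  "ext_line_graph G =
     SGraph (edges G)
       {{e, f} | e f. e \<in> edges G \<and> f \<in> edges G \<and> e \<noteq> f \<and>
          (e \<inter> f \<noteq> {} \<or> (e \<inter> f = {} \<and> (\<exists>C\<in>four_cycles G. e \<in> C \<and> f \<in> C)))}"

end

theory Submission
  imports Defs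
begin

text \<open>
  The proof reduces the topological hypothesis to a combinatorial one and then peels off faces.

  A 2-connected graph drawn in the plane with all vertices on one face is a Hamiltonian cycle with
  pairwise noncrossing chords. Both halves of this follow from one fact about theta curves, that is, three
  arcs with common ends and otherwise disjoint: a connected set \<open>X\<close> off the curve that accumulates at inner
  points of two of the arcs lies on the other side of the closed curve formed by them than the third arc
  (\<open>theta_opposite_sides\<close>). Hence no face touches the interiors of all three arcs, which forbids three internally
  disjoint paths of length at least two; a longest cycle missing a vertex would produce such paths. And if two chords of the
  Hamiltonian cycle crossed, then the outer face and the two chords would be pairwise on opposite sides of
  the cycle, although it has two sides only.

  Numbering the vertices along the cycle gives a symmetric relation \<open>E\<close> on natural numbers
  without \<open>a < b < c < d\<close>, \<open>E a c\<close>, \<open>E b d\<close>. Two edges are in conflict if they are adjacent in the extended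
  line graph. Conflicts do not depend on the vertex set in which the edges are considered, because a 4-cycle
  through two disjoint edges has no further vertex. This makes induction possible: an edge \<open>(a, b)\<close> of
  minimal span with a vertex strictly between \<open>a\<close> and \<open>b\<close> cuts off a leaf face of the weak dual tree, the
  inner vertices of that face have degree two, and deleting them leaves a smaller polygon.

  For the bound \<open>\<Delta> + 1\<close>, a colouring of the smaller polygon always extends over a leaf face with at least
  five sides, and over a quadrilateral if \<open>\<Delta> \<ge> 3\<close>. Over a triangle it extends
  unless its base edge \<open>ij\<close> lies on a second triangle and both \<open>i\<close> and \<open>j\<close> have degree \<open>\<Delta>\<close>
  (\<open>leaf_extend_or_blocked\<close>). For \<open>\<Delta> = 2\<close> the graph is a cycle, and only a
  quadrilateral is a problem. For \<open>\<Delta> = 3\<close> the whole graph is \<open>K\<^sub>4 - e\<close>. For \<open>\<Delta> \<ge> 4\<close> one looks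
  at a face all of whose neighbours but one are leaves: if nothing there can be removed directly, it is a
  triangle with two triangular leaves, the vertex between them has degree four, so \<open>\<Delta> = 4\<close>, and the three
  vertices are removed at once. The colouring of the rest extends if the edges leaving the two ends of the
  remaining base have different colours; otherwise one of them and then the base can be recoloured
  (\<open>gadget_colourable\<close>).

  For the clique bound, a clique of conflicting edges either avoids the new edges of a leaf face, and
  induction applies, or it contains one of them. In the latter case it lies in the star of a vertex or has
  at most five elements, since two vertices have at most two common neighbours.

  Sharpness is witnessed by fans, drawn with straight lines.
\<close>

section \<open>Theta curves in the plane\<close>

definition arc_between :: "complex \<Rightarrow> complex \<Rightarrow> complex set \<Rightarrow> bool" where
  "arc_between a b P \<longleftrightarrow> (\<exists>c. arc c \<and> pathstart c = a \<and> pathfinish c = b \<and> path_image c = P)"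

definition theta :: "complex \<Rightarrow> complex \<Rightarrow> complex set \<Rightarrow> complex set \<Rightarrow> complex set \<Rightarrow> bool" where
  "theta a b P Q R \<longleftrightarrow> arc_between a b P \<and> arc_between a b Q \<and> arc_between a b R \<and>
     P \<inter> Q = {a, b} \<and> P \<inter> R = {a, b} \<and> Q \<inter> R = {a, b}"

lemma theta_perms:
  assumes "theta a b P Q R"
  shows "theta a b Q P R" "theta a b P R Q" "theta a b R Q P"
  using assms unfolding theta_def by auto

lemma arc_between_distinct: "arc_between a b P \<Longrightarrow> a \<noteq> b"
  unfolding arc_between_def using arc_distinct_ends by blast

lemma arc_between_sym:
  assumes "arc_between a b P" shows "arc_between b a P"
  using assms unfolding arc_between_def
  by (metis arc_reversepath path_image_reversepath pathfinish_reversepath pathstart_reversepath)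

lemma arc_between_open_part:
  assumes "arc_between a b P"
  shows "compact P" "connected P" "connected (P - {a, b})" "P - {a, b} \<noteq> {}"
        "P \<subseteq> closure (P - {a, b})" "a \<in> P" "b \<in> P"
proof -
  obtain c where c: "arc c" "pathstart c = a" "pathfinish c = b" "path_image c = P"
    using assms unfolding arc_between_def by blast
  then have sc: "simple_path c" by (simp add: arc_imp_simple_path)
  show "compact P" "connected P" "a \<in> P" "b \<in> P"
    using c compact_arc_image connected_arc_image by (auto simp: pathstart_in_path_image pathfinish_in_path_image)
  show "connected (P - {a, b})" "P - {a, b} \<noteq> {}"
    using connected_simple_path_endless[OF sc] nonempty_simple_path_endless[OF sc] c by auto
  have "c ` closure {0<..<1} \<subseteq> closure (c ` {0<..<1})"
  proof (rule image_closure_subset)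
    show "continuous_on (closure {0<..<1}) c"
      using c(1) by (simp add: arc_def path_def)
  qed (auto simp: closure_subset)
  then have "P \<subseteq> closure (c ` {0<..<1})"
    using c(4) by (simp add: path_image_def)
  then show "P \<subseteq> closure (P - {a, b})"
    using simple_path_endless[OF sc] c by simp
qed

lemma closed_curve_of_arcs:
  assumes "arc_between a b P" "arc_between a b Q" "P \<inter> Q = {a, b}"
  shows "inside (P \<union> Q) \<noteq> {}" "open (inside (P \<union> Q))" "connected (inside (P \<union> Q))"
    "outside (P \<union> Q) \<noteq> {}" "open (outside (P \<union> Q))" "connected (outside (P \<union> Q))"
    "bounded (inside (P \<union> Q))" "\<not> bounded (outside (P \<union> Q))"
    "frontier (inside (P \<union> Q)) = P \<union> Q" "frontier (outside (P \<union> Q)) = P \<union> Q"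
proof -
  obtain c where c: "arc c" "pathstart c = a" "pathfinish c = b" "path_image c = P"
    using assms unfolding arc_between_def by blast
  obtain d where d: "arc d" "pathstart d = a" "pathfinish d = b" "path_image d = Q"
    using assms unfolding arc_between_def by blast
  have sp: "simple_path (c +++ reversepath d)"
    by (subst simple_path_join_loop_eq) (use c d assms(3) in \<open>auto simp: arc_reversepath\<close>)
  have "path_image (c +++ reversepath d) = P \<union> Q"
    using c d by (simp add: path_image_join)
  with Jordan_inside_outside[OF sp] c d
  show "inside (P \<union> Q) \<noteq> {}" "open (inside (P \<union> Q))" "connected (inside (P \<union> Q))"
    "outside (P \<union> Q) \<noteq> {}" "open (outside (P \<union> Q))" "connected (outside (P \<union> Q))"
    "bounded (inside (P \<union> Q))" "\<not> bounded (outside (P \<union> Q))"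
    "frontier (inside (P \<union> Q)) = P \<union> Q" "frontier (outside (P \<union> Q)) = P \<union> Q"
    by simp_all
qed

lemma connected_subset_inside_or_outside:
  assumes "arc_between a b P" "arc_between a b Q" "P \<inter> Q = {a, b}"
    and "connected F" "F \<inter> (P \<union> Q) = {}"
  shows "F \<subseteq> inside (P \<union> Q) \<or> F \<subseteq> outside (P \<union> Q)"
proof -
  note closed_curve_of_arcs(2,5)[OF assms(1-3)]
  moreover have "F \<subseteq> inside (P \<union> Q) \<union> outside (P \<union> Q)"
    using assms(5) by auto
  moreover have "inside (P \<union> Q) \<inter> outside (P \<union> Q) \<inter> F = {}" by simp
  ultimately have "inside (P \<union> Q) \<inter> F = {} \<or> outside (P \<union> Q) \<inter> F = {}"
    using connectedD[OF assms(4)] by blast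
  with \<open>F \<subseteq> inside (P \<union> Q) \<union> outside (P \<union> Q)\<close> show ?thesis by blast
qed

text \<open>This restates \<open>split_inside_simple_closed_curve\<close> for unparametrised arcs, so that the three arcs can be permuted freely.\<close>

lemma theta_split_inside:
  assumes "theta a b P Q R" "R \<inter> inside (P \<union> Q) \<noteq> {}"
  shows "inside (P \<union> R) \<inter> inside (Q \<union> R) = {}"
    "inside (P \<union> R) \<union> inside (Q \<union> R) \<union> (R - {a, b}) = inside (P \<union> Q)"
proof -
  obtain c where c: "arc c" "pathstart c = a" "pathfinish c = b" "path_image c = P"
    using assms unfolding theta_def arc_between_def by blast
  obtain d where d: "arc d" "pathstart d = a" "pathfinish d = b" "path_image d = Q"
    using assms unfolding theta_def arc_between_def by blast
  obtain e where e: "arc e" "pathstart e = a" "pathfinish e = b" "path_image e = R"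
    using assms unfolding theta_def arc_between_def by blast
  have "a \<noteq> b" using assms arc_between_distinct unfolding theta_def by blast
  have "inside (P \<union> R) \<inter> inside (Q \<union> R) = {} \<and>
    inside (P \<union> R) \<union> inside (Q \<union> R) \<union> (R - {a, b}) = inside (P \<union> Q)"
    by (rule split_inside_simple_closed_curve[of c a b d e])
       (use \<open>a \<noteq> b\<close> c d e assms in \<open>simp_all add: theta_def arc_imp_simple_path\<close>)
  then show "inside (P \<union> R) \<inter> inside (Q \<union> R) = {}"
    "inside (P \<union> R) \<union> inside (Q \<union> R) \<union> (R - {a, b}) = inside (P \<union> Q)"
    by blast+
qed

text \<open>The inside of \<open>P \<union> Q\<close> is connected and off \<open>R\<close>. If it were inside \<open>P \<union> R\<close>, then so would be the interior of \<open>Q\<close>, which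
  is on its boundary.\<close>

lemma theta_inside_avoids:
  assumes th: "theta a b P Q R"
    and Q: "Q - {a, b} \<subseteq> outside (P \<union> R)" and R: "R - {a, b} \<subseteq> outside (P \<union> Q)"
  shows "inside (P \<union> Q) \<subseteq> outside (P \<union> R)"
proof (rule ccontr)
  assume no: "\<not> ?thesis"
  have arcs: "arc_between a b P" "arc_between a b Q" "arc_between a b R"
    and int: "P \<inter> Q = {a, b}" "P \<inter> R = {a, b}" "Q \<inter> R = {a, b}"
    using th unfolding theta_def by auto
  note PQ = closed_curve_of_arcs(3,9)[OF arcs(1,2) int(1)] and PR = closed_curve_of_arcs(9)[OF arcs(1,3) int(2)]
  have "inside (P \<union> Q) \<inter> (P \<union> Q \<union> R) = {}"
    using R inside_no_overlap[of "P \<union> Q"] inside_Int_outside[of "P \<union> Q"]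
      int arc_between_open_part(6,7)[OF arcs(1)] by blast
  then have "inside (P \<union> Q) \<subseteq> inside (P \<union> R)"
    using no connected_subset_inside_or_outside[OF arcs(1,3) int(2) PQ(1)] by blast
  then have "closure (inside (P \<union> Q)) \<subseteq> inside (P \<union> R) \<union> (P \<union> R)"
    using PR closure_Un_frontier[of "inside (P \<union> R)"] closure_mono by blast
  moreover have "closure (inside (P \<union> Q)) = inside (P \<union> Q) \<union> P \<union> Q"
    using PQ(2) closure_Un_frontier[of "inside (P \<union> Q)"] by auto
  ultimately have "Q - {a, b} \<subseteq> inside (P \<union> R)" using int by blast
  then show False
    using Q arc_between_open_part(4)[OF arcs(2)] inside_Int_outside[of "P \<union> R"] by blast
qed

text \<open>One of the three arcs of a theta curve lies inside the closed curve of the other two. Otherwise the inside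
  of \<open>P \<union> Q\<close> would be outside both \<open>P \<union> R\<close> and \<open>Q \<union> R\<close>, so a point \<open>u\<close> in it could be joined to a far
  away point \<open>v\<close> off either of these curves. Their intersection is the arc \<open>R\<close>, which is connected, so by
  Janiszewski's theorem \<open>u\<close> could be joined to \<open>v\<close> off the whole theta curve, and in particular off \<open>P \<union> Q\<close>.\<close>

lemma theta_not_all_outside:
  assumes th: "theta a b P Q R"
    and P: "P - {a, b} \<subseteq> outside (Q \<union> R)"
    and Q: "Q - {a, b} \<subseteq> outside (P \<union> R)"
    and R: "R - {a, b} \<subseteq> outside (P \<union> Q)"
  shows False
proof -
  have arcs: "arc_between a b P" "arc_between a b Q" "arc_between a b R"
    and int: "P \<inter> Q = {a, b}" "P \<inter> R = {a, b}" "Q \<inter> R = {a, b}"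
    using th unfolding theta_def by auto
  note PQ = closed_curve_of_arcs(1,8,7)[OF arcs(1,2) int(1)]
  note PR = closed_curve_of_arcs(6,7)[OF arcs(1,3) int(2)] and QR = closed_curve_of_arcs(6,7)[OF arcs(2,3) int(3)]
  have out1: "inside (P \<union> Q) \<subseteq> outside (P \<union> R)" by (rule theta_inside_avoids[OF th Q R])
  have out2: "inside (P \<union> Q) \<subseteq> outside (Q \<union> R)"
    using theta_inside_avoids[OF theta_perms(1)[OF th] P] R unfolding Un_commute[of Q P] by blast
  obtain u where u: "u \<in> inside (P \<union> Q)" using PQ(1) by blast
  have comp: "compact P" "compact Q" "compact R"
    using arcs arc_between_open_part(1) by blast+
  then have "bounded (P \<union> R \<union> inside (P \<union> R) \<union> (Q \<union> R \<union> inside (Q \<union> R)) \<union> inside (P \<union> Q))"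
    using PR(2) QR(2) PQ(3) by (simp add: compact_imp_bounded)
  then obtain v where v: "v \<in> outside (P \<union> Q)"
    "v \<notin> P \<union> R \<union> inside (P \<union> R) \<union> (Q \<union> R \<union> inside (Q \<union> R)) \<union> inside (P \<union> Q)"
    using PQ(2) bounded_subset[of _ "outside (P \<union> Q)"] by (meson subsetI)
  have "v \<in> outside (P \<union> R)" "v \<in> outside (Q \<union> R)"
    using v(2) by (auto simp: outside_inside)
  then have "connected_component (- (P \<union> R)) u v" "connected_component (- (Q \<union> R)) u v"
    using out1 out2 u PR(1) QR(1) outside_no_overlap unfolding connected_component_def
    by (meson disjoint_eq_subset_Compl subsetD)+
  moreover have "(P \<union> R) \<inter> (Q \<union> R) = R"
    using int arc_between_open_part(6,7)[OF arcs(3)] by blast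
  ultimately have "connected_component (- ((P \<union> R) \<union> (Q \<union> R))) u v"
    using Janiszewski[of "P \<union> R" "Q \<union> R" u v] comp arc_between_open_part(2)[OF arcs(3)]
    by (simp add: compact_Un compact_imp_closed closed_Un)
  then obtain T where T: "connected T" "T \<subseteq> - ((P \<union> R) \<union> (Q \<union> R))" "u \<in> T" "v \<in> T"
    unfolding connected_component_def by blast
  then have "T \<subseteq> inside (P \<union> Q) \<or> T \<subseteq> outside (P \<union> Q)"
    using connected_subset_inside_or_outside[OF arcs(1,2) int(1) T(1)] by blast
  then show False
    using T u v(1) inside_Int_outside[of "P \<union> Q"] by blast
qed

text \<open>Accumulating at \<open>Q\<close>, the set \<open>F\<close> is inside \<open>P \<union> R\<close>, and \<open>Q\<close> cuts this region into the insides of \<open>P \<union> Q\<close> and \<open>Q \<union> R\<close>.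
  The former is excluded, and the closure of the latter misses the interior of \<open>P\<close>.\<close>

lemma theta_enclosed_arc:
  assumes th: "theta a b P Q R"
    and F: "connected F" "F \<inter> (P \<union> Q \<union> R) = {}" and FO: "F \<subseteq> outside (P \<union> Q)"
    and Q: "Q - {a, b} \<subseteq> inside (P \<union> R)"
    and x: "x \<in> P - {a, b}" "x \<in> closure F" and y: "y \<in> Q - {a, b}" "y \<in> closure F"
  shows False
proof -
  have arcs: "arc_between a b P" "arc_between a b Q" "arc_between a b R"
    and int: "P \<inter> Q = {a, b}" "P \<inter> R = {a, b}" "Q \<inter> R = {a, b}"
    using th unfolding theta_def by auto
  have "Q \<inter> inside (P \<union> R) \<noteq> {}" using Q arc_between_open_part(4)[OF arcs(2)] by blast
  note s = theta_split_inside(2)[OF theta_perms(2)[OF th] this]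
  have "inside (P \<union> R) \<inter> F \<noteq> {}"
    using closed_curve_of_arcs(2)[OF arcs(1,3) int(2)] Q y closure_iff_nhds_not_empty[of y F] by blast
  then have "F \<subseteq> inside (P \<union> R)" "F \<noteq> {}"
    using connected_subset_inside_or_outside[OF arcs(1,3) int(2) F(1)] F(2) inside_Int_outside[of "P \<union> R"] by blast+
  moreover have "F \<subseteq> inside (Q \<union> R) \<or> F \<subseteq> outside (Q \<union> R)"
    using connected_subset_inside_or_outside[OF arcs(2,3) int(3) F(1)] F(2) by blast
  ultimately have "F \<subseteq> inside (Q \<union> R)"
    using FO s F(2) inside_Int_outside[of "P \<union> Q"] inside_Int_outside[of "Q \<union> R"]
    unfolding Un_commute[of R Q] by blast
  then have "closure F \<subseteq> inside (Q \<union> R) \<union> (Q \<union> R)"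
    using closed_curve_of_arcs(9)[OF arcs(2,3) int(3)] closure_Un_frontier[of "inside (Q \<union> R)"] closure_mono by blast
  then have "x \<in> inside (Q \<union> R)" using x int by blast
  then have "x \<in> inside (P \<union> R)" using s by (auto simp: Un_commute)
  then show False using x inside_no_overlap[of "P \<union> R"] by blast
qed

text \<open>If \<open>F\<close> and \<open>R\<close> are both inside \<open>P \<union> Q\<close>, then \<open>R\<close> splits the inside into two regions whose closures each
  miss the interior of \<open>P\<close> or of \<open>Q\<close>, and \<open>F\<close> lies in one of them. If both are outside, then \<open>P\<close> or \<open>Q\<close> is the
  arc enclosed by the other two, and it splits the region that contains \<open>F\<close> in the same way.
  The set \<open>F\<close> is later a face, but also a chord.\<close>

lemma theta_opposite_sides:
  assumes th: "theta a b P Q R"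
    and F: "connected F" "F \<inter> (P \<union> Q \<union> R) = {}"
    and xP: "x \<in> P - {a, b}" "x \<in> closure F" and xQ: "y \<in> Q - {a, b}" "y \<in> closure F"
  shows "F \<subseteq> inside (P \<union> Q) \<and> R - {a, b} \<subseteq> outside (P \<union> Q) \<or>
         F \<subseteq> outside (P \<union> Q) \<and> R - {a, b} \<subseteq> inside (P \<union> Q)"
proof -
  have arcs: "arc_between a b P" "arc_between a b Q" "arc_between a b R"
    and int: "P \<inter> Q = {a, b}" "P \<inter> R = {a, b}" "Q \<inter> R = {a, b}"
    using th unfolding theta_def by auto
  have ab: "a \<in> P" "a \<in> Q" "a \<in> R" "b \<in> P" "b \<in> Q" "b \<in> R" using int by auto
  have FPQ: "F \<subseteq> inside (P \<union> Q) \<or> F \<subseteq> outside (P \<union> Q)"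
    using connected_subset_inside_or_outside[OF arcs(1,2) int(1) F(1)] F(2) by blast
  have sideR: "R - {a, b} \<subseteq> inside (P \<union> Q) \<or> R - {a, b} \<subseteq> outside (P \<union> Q)"
    using connected_subset_inside_or_outside[OF arcs(1,2) int(1) arc_between_open_part(3)[OF arcs(3)]]
      int by blast
  have sideQ: "Q - {a, b} \<subseteq> inside (P \<union> R) \<or> Q - {a, b} \<subseteq> outside (P \<union> R)"
    using connected_subset_inside_or_outside[OF arcs(1,3) int(2) arc_between_open_part(3)[OF arcs(2)]]
      int by blast
  have sideP: "P - {a, b} \<subseteq> inside (Q \<union> R) \<or> P - {a, b} \<subseteq> outside (Q \<union> R)"
    using connected_subset_inside_or_outside[OF arcs(2,3) int(3) arc_between_open_part(3)[OF arcs(1)]]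
      int by blast
  have fr: "frontier (inside (P \<union> R)) = P \<union> R" "frontier (inside (Q \<union> R)) = Q \<union> R"
     "open (inside (P \<union> R))" "open (inside (Q \<union> R))"
    "frontier (inside (P \<union> Q)) = P \<union> Q" "open (inside (P \<union> Q))"
    using closed_curve_of_arcs[OF arcs(1,3) int(2)] closed_curve_of_arcs[OF arcs(2,3) int(3)]
      closed_curve_of_arcs[OF arcs(1,2) int(1)] by simp_all
  have clPR: "closure F \<subseteq> inside (P \<union> R) \<union> (P \<union> R)" if "F \<subseteq> inside (P \<union> R)"
    using that fr closure_Un_frontier[of "inside (P \<union> R)"] closure_mono by blast
  have clQR: "closure F \<subseteq> inside (Q \<union> R) \<union> (Q \<union> R)" if "F \<subseteq> inside (Q \<union> R)"
    using that fr closure_Un_frontier[of "inside (Q \<union> R)"] closure_mono by blast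
  have FPR: "F \<subseteq> inside (P \<union> R) \<or> F \<subseteq> outside (P \<union> R)"
    using connected_subset_inside_or_outside[OF arcs(1,3) int(2) F(1)] F(2) by blast
  have FQR: "F \<subseteq> inside (Q \<union> R) \<or> F \<subseteq> outside (Q \<union> R)"
    using connected_subset_inside_or_outside[OF arcs(2,3) int(3) F(1)] F(2) by blast
  have Fne: "F \<noteq> {}" using xP by auto
  have inin: False if FI: "F \<subseteq> inside (P \<union> Q)" and RI: "R - {a, b} \<subseteq> inside (P \<union> Q)"
  proof -
    have "R \<inter> inside (P \<union> Q) \<noteq> {}"
      using RI arc_between_open_part(4)[OF arcs(3)] by blast
    note s = theta_split_inside[OF th this]
    have "F \<subseteq> inside (P \<union> R) \<or> F \<subseteq> inside (Q \<union> R)"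
      using FI FPR FQR F(2) s Fne inside_Int_outside[of "P \<union> R"] inside_Int_outside[of "Q \<union> R"] by blast
    then show False
    proof
      assume "F \<subseteq> inside (P \<union> R)"
      then have "y \<in> inside (P \<union> R)" using clPR xQ int by blast
      then show False using s(2) xQ inside_no_overlap[of "P \<union> Q"] by blast
    next
      assume "F \<subseteq> inside (Q \<union> R)"
      then have "x \<in> inside (Q \<union> R)" using clQR xP int by blast
      then show False using s(2) xP inside_no_overlap[of "P \<union> Q"] by blast
    qed
  qed
  have outout: False if FO: "F \<subseteq> outside (P \<union> Q)" and RO: "R - {a, b} \<subseteq> outside (P \<union> Q)"
  proof -
    consider "Q - {a, b} \<subseteq> inside (P \<union> R)" | "P - {a, b} \<subseteq> inside (Q \<union> R)"
      | "Q - {a, b} \<subseteq> outside (P \<union> R)" "P - {a, b} \<subseteq> outside (Q \<union> R)"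
      using sideQ sideP by blast
    then show False
    proof cases
      case 1
      then show False by (rule theta_enclosed_arc[OF th F FO _ xP xQ])
    next
      case 2
      show False
        by (rule theta_enclosed_arc[OF theta_perms(1)[OF th] F(1) _ _ 2 xQ xP])
           (use F(2) FO in \<open>simp_all add: Un_commute Un_left_commute\<close>)
    next
      case 3
      then show False using theta_not_all_outside[OF th] RO by blast
    qed
  qed
  show ?thesis using FPQ sideR inin outout by blast
qed

lemma theta_closure_misses_arc:
  assumes th: "theta a b P Q R"
    and F: "connected F" "F \<inter> (P \<union> Q \<union> R) = {}"
    and x: "x \<in> P - {a, b}" "x \<in> closure F" and y: "y \<in> Q - {a, b}" "y \<in> closure F"
    and z: "z \<in> R - {a, b}" "z \<in> closure F"
  shows False
proof -
  have arcs: "arc_between a b P" "arc_between a b Q" and int: "P \<inter> Q = {a, b}"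
    using th unfolding theta_def by auto
  note o = closed_curve_of_arcs(2,5)[OF arcs int]
  have meets: "U \<inter> F \<noteq> {}" if "open U" "z \<in> U" for U
    using that z closure_iff_nhds_not_empty[of z F] by blast
  show False
    using theta_opposite_sides[OF th F x y] z(1) meets[OF o(1)] meets[OF o(2)]
      inside_Int_outside[of "P \<union> Q"] by blast
qed

section \<open>Conflicting edges in noncrossing graphs\<close>

text \<open>The vertices are positions along a Hamiltonian cycle, so that crossing of chords is a statement about the
  order of their ends.\<close>

locale noncrossing =
  fixes E :: "nat \<Rightarrow> nat \<Rightarrow> bool"
  assumes adj_sym: "E a b \<Longrightarrow> E b a"
    and adj_irrefl: "\<not> E a a"
    and no_crossing: "a < b \<Longrightarrow> b < c \<Longrightarrow> c < d \<Longrightarrow> E a c \<Longrightarrow> E b d \<Longrightarrow> False"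
begin

definition edges_on :: "nat set \<Rightarrow> nat set set" where
  "edges_on S = {{a, b} | a b. a \<in> S \<and> b \<in> S \<and> E a b}"

definition deg :: "nat set \<Rightarrow> nat \<Rightarrow> nat" where
  "deg S v = card {u \<in> S. E v u}"

text \<open>Adjacency in the extended line graph of the whole graph. In the second case the vertices of the 4-cycle are
  the ends of the two edges, so the restriction of this relation to the edges on a set of vertices is the conflict
  relation of the induced subgraph.\<close>

definition conf :: "nat set \<Rightarrow> nat set \<Rightarrow> bool" where
  "conf e f \<longleftrightarrow> e \<noteq> f \<and> (e \<inter> f \<noteq> {} \<or>
     (\<exists>a b c d. distinct [a, b, c, d] \<and> E a b \<and> E b c \<and> E c d \<and> E d a \<and> e = {a, b} \<and> f = {c, d}))"

definition proper_on :: "nat set \<Rightarrow> nat \<Rightarrow> (nat set \<Rightarrow> nat) \<Rightarrow> bool" where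
  "proper_on S k col \<longleftrightarrow> (\<forall>e\<in>edges_on S. col e < k \<and> (\<forall>f\<in>edges_on S. conf e f \<longrightarrow> col e \<noteq> col f))"

text \<open>The set \<open>S\<close> spans a cycle in its natural order. A single edge is included as a degenerate polygon: it
  is what remains when the last face is removed, and it serves as the base of the inductions.\<close>

definition polygon :: "nat set \<Rightarrow> bool" where
  "polygon S \<longleftrightarrow> finite S \<and> 2 \<le> card S \<and>
     (\<forall>a\<in>S. \<forall>b\<in>S. a < b \<and> S \<inter> {a<..<b} = {} \<longrightarrow> E a b) \<and> E (Min S) (Max S)"

lemma conf_sym: "conf e f \<longleftrightarrow> conf f e"
proof -
  have "conf f e" if ef: "conf e f" for e f
  proof (cases "e \<inter> f = {}")
    case False
    then show ?thesis using ef unfolding conf_def by auto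
  next
    case True
    then obtain a b c d where h: "distinct [a, b, c, d]" "E a b" "E b c" "E c d" "E d a"
      "e = {a, b}" "f = {c, d}"
      using ef unfolding conf_def by auto
    then have "distinct [c, d, a, b]" by auto
    then show ?thesis using h ef unfolding conf_def by blast
  qed
  then show ?thesis by blast
qed

lemma conf_pairD:
  assumes "conf {p, q} f"
  shows "p \<in> f \<or> q \<in> f \<or> (\<exists>c d. f = {c, d} \<and> distinct [p, q, c, d] \<and> E q c \<and> E c d \<and> E d p)"
proof -
  from assms consider "{p, q} \<inter> f \<noteq> {}" | a b c d where "distinct [a, b, c, d]" "E a b" "E b c"
    "E c d" "E d a" "{p, q} = {a, b}" "f = {c, d}"
    unfolding conf_def by blast
  then show ?thesis
  proof cases
    case 2
    from 2(6) consider "p = a" "q = b" | "p = b" "q = a" by (auto simp: doubleton_eq_iff)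
    then show ?thesis
    proof cases
      case 1
      then show ?thesis using 2 by blast
    next
      case c: 2
      have "f = {d, c}" "distinct [p, q, d, c]" "E q d" "E d c" "E c p"
        using 2 c adj_sym by auto
      then show ?thesis by blast
    qed
  qed auto
qed

lemma pair_in_edges_on: "{a, b} \<in> edges_on S \<longleftrightarrow> a \<in> S \<and> b \<in> S \<and> E a b"
  unfolding edges_on_def using adj_sym by (auto simp: doubleton_eq_iff)

lemma edges_onE:
  assumes "e \<in> edges_on S" obtains a b where "e = {a, b}" "a \<in> S" "b \<in> S" "E a b" "a \<noteq> b"
  using assms adj_irrefl unfolding edges_on_def by blast

lemma edges_on_at:
  assumes "e \<in> edges_on S" "a \<in> e" obtains b where "e = {a, b}" "a \<in> S" "b \<in> S" "E a b"
  using assms adj_sym by (elim edges_onE) (auto simp: insert_commute)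

lemma finite_edges_on: "finite S \<Longrightarrow> finite (edges_on S)"
  by (rule finite_subset[of _ "Pow S"]) (auto simp: edges_on_def)

lemma edges_on_mono: "S \<subseteq> T \<Longrightarrow> edges_on S \<subseteq> edges_on T"
  unfolding edges_on_def by blast

lemma card_edges_at_le:
  assumes "finite S" shows "card {f \<in> edges_on S. i \<in> f} \<le> deg S i"
proof -
  have "{f \<in> edges_on S. i \<in> f} \<subseteq> (\<lambda>u. {i, u}) ` {u \<in> S. E i u}"
    by (auto elim!: edges_on_at)
  then have "card {f \<in> edges_on S. i \<in> f} \<le> card ((\<lambda>u. {i, u}) ` {u \<in> S. E i u})"
    using assms by (intro card_mono) auto
  also have "\<dots> \<le> deg S i"
    unfolding deg_def using assms by (intro card_image_le) auto
  finally show ?thesis .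
qed

lemma deg_mono: "finite T \<Longrightarrow> S \<subseteq> T \<Longrightarrow> deg S v \<le> deg T v"
  unfolding deg_def by (intro card_mono) auto

lemma deg_less:
  assumes "finite T" "S \<subseteq> T" "x \<in> T" "x \<notin> S" "E v x" shows "deg S v < deg T v"
  unfolding deg_def using assms by (intro psubset_card_mono) auto

text \<open>The positions \<open>i\<close> and \<open>j\<close> cut the cycle into two parts, and two common neighbours in the same part would
  give crossing edges.\<close>

lemma common_neighbours_at_most_two:
  assumes "E i x" "E j x" "E i y" "E j y" "E i w" "E j w" "i \<noteq> j" "x \<noteq> y" "y \<noteq> w" "x \<noteq> w"
  shows False
proof -
  have main: False if "i < j" "E i x" "E j x" "E i y" "E j y" "x \<noteq> y"
    "(i < x \<and> x < j) = (i < y \<and> y < j)" for i j x y :: nat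
  proof -
    have *: False if h: "x < y" "E i x" "E j x" "E i y" "E j y"
      "(i < x \<and> x < j) = (i < y \<and> y < j)" for x y
    proof -
      have ne: "x \<noteq> i" "x \<noteq> j" "y \<noteq> i" "y \<noteq> j" using h adj_irrefl by auto
      consider "i < x" "y < j" | "y < i" | "j < x" | "x < i" "j < y"
        using ne h \<open>i < j\<close> by linarith
      then show False
      proof cases
        case 1 then show False using no_crossing[of i x y j] h adj_sym by blast
      next
        case 2 then show False using no_crossing[of x y i j] h adj_sym \<open>i < j\<close> by blast
      next
        case 3 then show False using no_crossing[of i j x y] h adj_sym \<open>i < j\<close> by blast
      next
        case 4 then show False using no_crossing[of x i j y] h adj_sym \<open>i < j\<close> by blast
      qed
    qed
    show False using *[of x y] *[of y x] that by (cases "x < y") auto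
  qed
  have main': False if "i < j" "E i x" "E j x" "E i y" "E j y" "E i w" "E j w"
     "x \<noteq> y" "y \<noteq> w" "x \<noteq> w" for i j
    using main[of i j x y] main[of i j x w] main[of i j y w] that by blast
  show False using main'[of i j] main'[of j i] assms by (cases "i < j") auto
qed

text \<open>The set \<open>N\<close> may contain edges that are already coloured, so this covers extending a colouring as well as
  changing it on a few edges.\<close>

lemma proper_on_extend:
  assumes "proper_on S' k col" "edges_on S \<subseteq> edges_on S' \<union> N"
    and "\<And>e. e \<in> edges_on S' \<Longrightarrow> e \<notin> N \<Longrightarrow> col' e = col e"
    and "\<And>e. e \<in> N \<Longrightarrow> col' e < k"
    and "\<And>e f. e \<in> N \<Longrightarrow> f \<in> edges_on S \<Longrightarrow> conf e f \<Longrightarrow> col' e \<noteq> col' f"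
  shows "proper_on S k col'"
  unfolding proper_on_def
proof (intro ballI conjI impI)
  fix e assume e: "e \<in> edges_on S"
  show "col' e < k"
  proof (cases "e \<in> N")
    case False
    then have "e \<in> edges_on S'" using e assms(2) by blast
    then show ?thesis using assms(1,3) False unfolding proper_on_def by simp
  qed (use assms(4) in blast)
  fix f assume f: "f \<in> edges_on S" "conf e f"
  show "col' e \<noteq> col' f"
  proof (cases "e \<in> N \<or> f \<in> N")
    case True
    then show ?thesis using assms(5) e f conf_sym by metis
  next
    case False
    then have "e \<in> edges_on S'" "f \<in> edges_on S'" using e f assms(2) by blast+
    then show ?thesis using False f(2) assms(1,3) unfolding proper_on_def by metis
  qed
qed

lemma obtain_colour:
  assumes "finite A" "card A < k" obtains c :: nat where "c < k" "c \<notin> A"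
proof -
  have "\<not> {..<k} \<subseteq> A" using assms card_mono[of A "{..<k}"] by auto
  then show ?thesis using that by blast
qed


section \<open>Triangular ears\<close>

text \<open>\<open>S\<close> arises from \<open>S'\<close> by attaching the vertex \<open>x\<close> of degree two to both ends of the edge \<open>ij\<close>. The definition,
  like those of the other ears, does not mention the order, so the ends can be exchanged.\<close>

definition triangle_ear where
  "triangle_ear S S' i x j \<longleftrightarrow> finite S' \<and> S = insert x S' \<and> x \<notin> S' \<and> i \<in> S' \<and> j \<in> S' \<and> i \<noteq> j \<and>
     E i j \<and> E x i \<and> E x j \<and> (\<forall>u\<in>S. E x u \<longrightarrow> u = i \<or> u = j)"

lemma triangle_ear_sym: "triangle_ear S S' i x j \<Longrightarrow> triangle_ear S S' j x i"
  unfolding triangle_ear_def using adj_sym by blast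

lemma triangle_ear_edges:
  assumes "triangle_ear S S' i x j"
  shows "edges_on S = edges_on S' \<union> {{i, x}, {j, x}}" (is "?l = ?r")
proof
  show "?l \<subseteq> ?r"
  proof
    fix e assume e: "e \<in> edges_on S"
    show "e \<in> ?r"
    proof (cases "x \<in> e")
      case True
      with e obtain b where "e = {x, b}" "b \<in> S" "E x b" by (metis edges_on_at)
      then show ?thesis using assms unfolding triangle_ear_def by (auto simp: insert_commute)
    next
      case False
      with e show ?thesis using assms by (elim edges_onE) (auto simp: triangle_ear_def pair_in_edges_on)
    qed
  qed
  show "?r \<subseteq> ?l"
    using assms adj_sym edges_on_mono[of S' S] unfolding triangle_ear_def
    by (auto simp: pair_in_edges_on)
qed

lemma triangle_ear_conf:
  assumes t: "triangle_ear S S' i x j" and f: "f \<in> edges_on S" "conf {i, x} f"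
  shows "f = {j, x} \<or> f \<in> edges_on S' \<and> (i \<in> f \<or> (\<exists>y\<in>S'. f = {j, y} \<and> E j y \<and> E i y))"
proof (cases "f \<in> edges_on S'")
  case False
  then show ?thesis using f triangle_ear_edges[OF t] unfolding conf_def by auto
next
  case True
  then have xf: "x \<notin> f" using t unfolding triangle_ear_def by (auto elim!: edges_onE)
  from conf_pairD[OF f(2)] xf consider "i \<in> f"
    | c d where "f = {c, d}" "distinct [i, x, c, d]" "E x c" "E c d" "E d i" by blast
  then show ?thesis
  proof cases
    case 2
    then have "c \<in> S'" "d \<in> S'" using True by (auto simp: pair_in_edges_on)
    then have "c = j" using 2 t unfolding triangle_ear_def by auto
    then show ?thesis using 2 True adj_sym \<open>d \<in> S'\<close> by blast
  qed (use True in auto)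
qed

text \<open>The edges on \<open>S'\<close> that an edge from \<open>i\<close> to the tip of a triangular ear conflicts with: those at \<open>i\<close>, and the
  edges from \<open>j\<close> that complete a 4-cycle through a second triangle on \<open>ij\<close>.\<close>

definition forbidden where
  "forbidden S' i j = {f \<in> edges_on S'. i \<in> f} \<union> {{j, y} | y. y \<in> S' \<and> E j y \<and> E i y}"

text \<open>Attaching the ear raises the degree of \<open>i\<close>, so fewer than \<open>deg S i\<close> old edges are at \<open>i\<close>. The tip \<open>x\<close> is a
  common neighbour of \<open>i\<close> and \<open>j\<close>, so there is at most one further one, which adds at most one edge.\<close>

lemma forbidden_bound:
  assumes t: "triangle_ear S S' i x j"
  shows "finite (forbidden S' i j)" "card (forbidden S' i j) \<le> deg S i"
    "\<not> (\<exists>y\<in>S'. E i y \<and> E j y) \<Longrightarrow> card (forbidden S' i j) < deg S i"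
proof -
  have fin: "finite S'" "finite S" using t unfolding triangle_ear_def by auto
  have "deg S' i < deg S i"
    using t fin adj_sym by (intro deg_less) (auto simp: triangle_ear_def)
  then have c1: "card {f \<in> edges_on S'. i \<in> f} < deg S i"
    using card_edges_at_le[OF fin(1), of i] by simp
  let ?Y = "{{j, y} | y. y \<in> S' \<and> E j y \<and> E i y}"
  have Y: "?Y = (\<lambda>y. {j, y}) ` {y \<in> S'. E j y \<and> E i y}" by auto
  then have finY: "finite ?Y" using fin by auto
  have "y = z" if "y \<in> S'" "E j y" "E i y" "z \<in> S'" "E j z" "E i z" for y z
    using that t common_neighbours_at_most_two[of i x j y z] adj_sym
    unfolding triangle_ear_def by blast
  then have "card {y \<in> S'. E j y \<and> E i y} \<le> 1"
    using fin by (subst card_le_Suc0_iff_eq[unfolded One_nat_def[symmetric]]) auto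
  then have cY: "card ?Y \<le> 1"
    unfolding Y using card_image_le[of "{y \<in> S'. E j y \<and> E i y}" "\<lambda>y. {j, y}"] fin by simp
  show "finite (forbidden S' i j)"
    unfolding forbidden_def using finY finite_edges_on[OF fin(1)] by simp
  show "card (forbidden S' i j) \<le> deg S i"
    unfolding forbidden_def using card_Un_le[of "{f \<in> edges_on S'. i \<in> f}" ?Y] c1 cY by linarith
  assume "\<not> (\<exists>y\<in>S'. E i y \<and> E j y)"
  then have "forbidden S' i j = {f \<in> edges_on S'. i \<in> f}" unfolding forbidden_def by auto
  then show "card (forbidden S' i j) < deg S i" using c1 by simp
qed

text \<open>The edge at \<open>i\<close> is coloured first. The edge at \<open>j\<close> must also avoid that colour, which is why its bound is
  smaller by one.\<close>

lemma triangle_ear_extend: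
  assumes t: "triangle_ear S S' i x j" and col: "proper_on S' k col"
    and "card (forbidden S' i j) < k" "Suc (card (forbidden S' j i)) < k"
  shows "\<exists>col. proper_on S k col"
proof -
  note t' = triangle_ear_sym[OF t]
  note fin = forbidden_bound(1)[OF t] forbidden_bound(1)[OF t']
  obtain p where p: "p < k" "p \<notin> col ` forbidden S' i j"
    using obtain_colour[OF finite_imageI[OF fin(1)] le_less_trans[OF card_image_le[OF fin(1)] assms(3)]]
    by blast
  have "card (insert p (col ` forbidden S' j i)) \<le> Suc (card (forbidden S' j i))"
    using card_image_le[OF fin(2), of col] by (simp add: card_insert_if fin(2))
  then have "card (insert p (col ` forbidden S' j i)) < k" using assms(4) by simp
  then obtain q where q: "q < k" "q \<notin> insert p (col ` forbidden S' j i)"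
    using obtain_colour[of "insert p (col ` forbidden S' j i)" k] fin(2) by blast
  let ?col = "col({i, x} := p, {j, x} := q)"
  have "i \<noteq> x" "j \<noteq> x" "i \<noteq> j" "x \<notin> S'"
    using t unfolding triangle_ear_def by blast+
  then have new: "{j, x} \<noteq> {i, x}" "{i, x} \<noteq> {j, x}" "{i, x} \<notin> edges_on S'" "{j, x} \<notin> edges_on S'"
    by (auto simp: doubleton_eq_iff pair_in_edges_on)
  have c1: "?col {i, x} \<noteq> ?col f" if "f \<in> edges_on S" "conf {i, x} f" for f
  proof -
    from triangle_ear_conf[OF t that] have "f = {j, x} \<or> f \<in> edges_on S' \<and> f \<in> forbidden S' i j"
      unfolding forbidden_def by auto
    then show ?thesis using p q new by (elim disjE) auto
  qed
  have c2: "?col {j, x} \<noteq> ?col f" if "f \<in> edges_on S" "conf {j, x} f" for f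
  proof -
    from triangle_ear_conf[OF t' that] have "f = {i, x} \<or> f \<in> edges_on S' \<and> f \<in> forbidden S' j i"
      unfolding forbidden_def by auto
    then show ?thesis using p q new by auto
  qed
  have "proper_on S k ?col"
  proof (rule proper_on_extend[OF col equalityD1[OF triangle_ear_edges[OF t]]])
    show "?col e = col e" if "e \<in> edges_on S'" for e
      using that new by (metis fun_upd_other)
    show "?col e < k" if "e \<in> {{i, x}, {j, x}}" for e
      using that p q by auto
    show "?col e \<noteq> ?col f" if "e \<in> {{i, x}, {j, x}}" "f \<in> edges_on S" "conf e f" for e f
      using that c1 c2 by blast
  qed
  then show ?thesis by blast
qed


section \<open>Quadrilateral ears\<close>

definition quad_ear where
  "quad_ear S S' i x z j \<longleftrightarrow> finite S' \<and> S = insert x (insert z S') \<and> x \<notin> S' \<and> z \<notin> S' \<and> x \<noteq> z \<and>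
     i \<in> S' \<and> j \<in> S' \<and> i \<noteq> j \<and> E i j \<and> E i x \<and> E x z \<and> E z j \<and>
     (\<forall>u\<in>S. E x u \<longrightarrow> u = i \<or> u = z) \<and> (\<forall>u\<in>S. E z u \<longrightarrow> u = x \<or> u = j)"

lemma quad_ear_sym: "quad_ear S S' i x z j \<Longrightarrow> quad_ear S S' j z x i"
  unfolding quad_ear_def using adj_sym by blast

lemma quad_ear_edges:
  assumes "quad_ear S S' i x z j"
  shows "edges_on S = edges_on S' \<union> {{i, x}, {x, z}, {j, z}}" (is "?l = ?r")
proof
  show "?l \<subseteq> ?r"
  proof
    fix e assume e: "e \<in> edges_on S"
    consider "x \<in> e" | "z \<in> e" | "x \<notin> e" "z \<notin> e" by blast
    then show "e \<in> ?r"
    proof cases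
      case 1
      with e obtain b where "e = {x, b}" "b \<in> S" "E x b" by (metis edges_on_at)
      then show ?thesis using assms unfolding quad_ear_def by (auto simp: insert_commute)
    next
      case 2
      with e obtain b where "e = {z, b}" "b \<in> S" "E z b" by (metis edges_on_at)
      then show ?thesis using assms unfolding quad_ear_def by (auto simp: insert_commute)
    next
      case 3
      with e show ?thesis using assms by (elim edges_onE) (auto simp: quad_ear_def pair_in_edges_on)
    qed
  qed
  show "?r \<subseteq> ?l"
    using assms adj_sym edges_on_mono[of S' S] unfolding quad_ear_def
    by (auto simp: pair_in_edges_on)
qed

lemma quad_ear_conf_end:
  assumes t: "quad_ear S S' i x z j" and f: "f \<in> edges_on S" "conf {i, x} f"
  shows "f = {x, z} \<or> f = {j, z} \<or> f \<in> edges_on S' \<and> i \<in> f"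
proof (cases "f \<in> edges_on S'")
  case False
  then show ?thesis using f quad_ear_edges[OF t] unfolding conf_def by auto
next
  case True
  then have xf: "x \<notin> f" using t unfolding quad_ear_def by (auto elim!: edges_onE)
  from conf_pairD[OF f(2)] xf consider "i \<in> f"
    | c d where "f = {c, d}" "distinct [i, x, c, d]" "E x c" "E c d" "E d i" by blast
  then show ?thesis
  proof cases
    case 2
    then have "c \<in> S'" using True by (auto simp: pair_in_edges_on)
    then have False using 2 t unfolding quad_ear_def by auto
    then show ?thesis ..
  qed (use True in auto)
qed

lemma quad_ear_conf_middle:
  assumes t: "quad_ear S S' i x z j" and f: "f \<in> edges_on S" "conf {x, z} f"
  shows "f = {i, x} \<or> f = {j, z} \<or> f = {i, j}"
proof (cases "f \<in> edges_on S'")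
  case False
  then show ?thesis using f quad_ear_edges[OF t] unfolding conf_def by auto
next
  case True
  then have xf: "x \<notin> f" "z \<notin> f" using t unfolding quad_ear_def by (auto elim!: edges_onE)
  from conf_pairD[OF f(2)] xf obtain c d where
    2: "f = {c, d}" "distinct [x, z, c, d]" "E z c" "E c d" "E d x" by blast
  then have "c \<in> S'" "d \<in> S'" using True by (auto simp: pair_in_edges_on)
  then have "c = j" "d = i" using 2 t adj_sym unfolding quad_ear_def by auto
  then show ?thesis using 2 by auto
qed

text \<open>The two outer edges lie on a common 4-cycle and must differ; the middle edge conflicts
  with these two and the base only, so four colours leave one for it.\<close>

lemma quad_ear_extend:
  assumes t: "quad_ear S S' i x z j" and col: "proper_on S' k col"
    and "deg S i < k" "deg S j < k" "4 \<le> k"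
  shows "\<exists>col. proper_on S k col"
proof -
  have fin: "finite S'" "finite S" using t unfolding quad_ear_def by auto
  let ?I = "{f \<in> edges_on S'. i \<in> f}" and ?J = "{f \<in> edges_on S'. j \<in> f}"
  have finIJ: "finite ?I" "finite ?J" using finite_edges_on[OF fin(1)] by auto
  have "deg S' i < deg S i"
    using t fin adj_sym by (intro deg_less[of S S' x]) (auto simp: quad_ear_def)
  then have I: "card (col ` ?I) < k"
    using card_edges_at_le[OF fin(1), of i] card_image_le[OF finIJ(1), of col] assms by linarith
  have "deg S' j < deg S j"
    using t fin adj_sym by (intro deg_less[of S S' z]) (auto simp: quad_ear_def)
  then have J: "Suc (card (col ` ?J)) < k"
    using card_edges_at_le[OF fin(1), of j] card_image_le[OF finIJ(2), of col] assms by linarith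
  obtain p where p: "p < k" "p \<notin> col ` ?I"
    using obtain_colour[OF _ I] finIJ by blast
  have "card (insert p (col ` ?J)) < k"
    using J by (simp add: card_insert_if finIJ)
  then obtain q where q: "q < k" "q \<notin> insert p (col ` ?J)"
    using obtain_colour[of "insert p (col ` ?J)" k] finIJ by blast
  have "card {p, q, col {i, j}} < k"
    using assms(5) card_length[of "[p, q, col {i, j}]"] by simp
  then obtain r where r: "r < k" "r \<notin> {p, q, col {i, j}}"
    using obtain_colour[of "{p, q, col {i, j}}" k] by blast
  define col' where "col' = col({i, x} := p, {x, z} := r, {j, z} := q)"
  have "i \<noteq> x" "i \<noteq> z" "j \<noteq> x" "j \<noteq> z" "i \<noteq> j" "x \<noteq> z" "x \<notin> S'" "z \<notin> S'"
    using t unfolding quad_ear_def by blast+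
  then have new: "{i, x} \<noteq> {j, z}" "{i, x} \<noteq> {x, z}" "{j, z} \<noteq> {x, z}" "{i, x} \<notin> edges_on S'"
    "{j, z} \<notin> edges_on S'" "{x, z} \<notin> edges_on S'"
    by (auto simp: doubleton_eq_iff pair_in_edges_on)
  have v: "col' {i, x} = p" "col' {x, z} = r" "col' {j, z} = q"
    using new by (simp_all add: col'_def)
  have old: "col' e = col e" if "e \<in> edges_on S'" for e
    using that new unfolding col'_def by (metis fun_upd_other)
  have ij: "{i, j} \<in> edges_on S'" using t unfolding quad_ear_def by (simp add: pair_in_edges_on)
  have c1: "col' {i, x} \<noteq> col' f" if h: "f \<in> edges_on S" "conf {i, x} f" for f
  proof -
    consider "f = {x, z}" | "f = {j, z}" | "f \<in> edges_on S'" "f \<in> ?I"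
      using quad_ear_conf_end[OF t h] h(1) by blast
    then show ?thesis
      by cases (use p q r v old in \<open>blast | force\<close>)+
  qed
  have c2: "col' {j, z} \<noteq> col' f" if h: "f \<in> edges_on S" "conf {j, z} f" for f
  proof -
    consider "f = {x, z}" | "f = {i, x}" | "f \<in> edges_on S'" "f \<in> ?J"
      using quad_ear_conf_end[OF quad_ear_sym[OF t] h] h(1) insert_commute[of z x "{}"] by blast
    then show ?thesis
      by cases (use p q r v old in \<open>blast | force\<close>)+
  qed
  have c3: "col' {x, z} \<noteq> col' f" if h: "f \<in> edges_on S" "conf {x, z} f" for f
  proof -
    consider "f = {i, x}" | "f = {j, z}" | "f = {i, j}"
      using quad_ear_conf_middle[OF t h] by blast
    then show ?thesis
      by cases (use p q r v old ij in \<open>blast | force\<close>)+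
  qed
  have "proper_on S k col'"
  proof (rule proper_on_extend[OF col equalityD1[OF quad_ear_edges[OF t]] old])
    show "col' e < k" if "e \<in> {{i, x}, {x, z}, {j, z}}" for e
      using that p q r v by blast
    show "col' e \<noteq> col' f" if "e \<in> {{i, x}, {x, z}, {j, z}}" "f \<in> edges_on S" "conf e f" for e f
      using that c1 c2 c3 by blast
  qed
  then show ?thesis by blast
qed

section \<open>Long ears\<close>

text \<open>An ear with at least four edges, on the vertices \<open>v 0, \<dots>, v m\<close>. No 4-cycle runs through such an ear, so only incidences matter.\<close>

definition path_ear where
  "path_ear S S' v m \<longleftrightarrow> finite S' \<and> 4 \<le> m \<and> inj_on v {0..m} \<and> v 0 \<in> S' \<and> v m \<in> S' \<and>
     (\<forall>t. 0 < t \<and> t < m \<longrightarrow> v t \<notin> S') \<and> S = S' \<union> v ` {0<..<m} \<and>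
     (\<forall>t<m. E (v t) (v (Suc t))) \<and>
     (\<forall>t u. 0 < t \<and> t < m \<and> u \<in> S \<and> E (v t) u \<longrightarrow> u = v (t - 1) \<or> u = v (Suc t))"

lemma path_earD:
  assumes "path_ear S S' v m"
  shows "finite S'" "4 \<le> m" "v 0 \<in> S'" "v m \<in> S'" "S = S' \<union> v ` {0<..<m}"
    "0 < t \<Longrightarrow> t < m \<Longrightarrow> v t \<notin> S'"
    "s \<le> m \<Longrightarrow> t \<le> m \<Longrightarrow> v s = v t \<longleftrightarrow> s = t"
    "t < m \<Longrightarrow> E (v t) (v (Suc t))"
    "0 < t \<Longrightarrow> t < m \<Longrightarrow> u \<in> S \<Longrightarrow> E (v t) u \<Longrightarrow> u = v (t - 1) \<or> u = v (Suc t)"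
  using assms unfolding path_ear_def by (auto simp: inj_on_eq_iff)

lemma path_ear_edges:
  assumes p: "path_ear S S' v m"
  shows "edges_on S = edges_on S' \<union> (\<lambda>t. {v t, v (Suc t)}) ` {..<m}" (is "?l = ?r")
proof
  show "?l \<subseteq> ?r"
  proof
    fix e assume e: "e \<in> edges_on S"
    show "e \<in> ?r"
    proof (cases "\<exists>t. 0 < t \<and> t < m \<and> v t \<in> e")
      case True
      then obtain t where t: "0 < t" "t < m" "v t \<in> e" by blast
      then obtain u where u: "e = {v t, u}" "u \<in> S" "E (v t) u" using e by (metis edges_on_at)
      from path_earD(9)[OF p t(1,2) u(2,3)] show ?thesis
      proof
        assume "u = v (t - 1)"
        then have "e = {v (t - 1), v (Suc (t - 1))}" "t - 1 < m" using u t by (auto simp: insert_commute)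
        then show ?thesis by blast
      qed (use u t in blast)
    next
      case False
      then have "\<forall>a\<in>e. a \<in> S \<longrightarrow> a \<in> S'" using path_earD(5)[OF p] by auto
      then show ?thesis using e by (auto elim!: edges_onE simp: pair_in_edges_on)
    qed
  qed
  have vS: "v t \<in> S" if "t \<le> m" for t
    using that path_earD(3-5)[OF p] by (cases "t = 0 \<or> t = m") auto
  show "?r \<subseteq> ?l"
    using path_earD(5,8)[OF p] vS edges_on_mono[of S' S] by (auto simp: pair_in_edges_on)
qed

text \<open>In a 4-cycle through an inner vertex \<open>v s\<close>, its neighbours on the cycle are \<open>v (s - 1)\<close> and \<open>v (s + 1)\<close>. As \<open>m \<ge> 4\<close>, one
  of these is an inner vertex too, and its only other neighbour is too far along the ear to be adjacent to
  the remaining one.\<close>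

lemma path_ear_no_square:
  assumes p: "path_ear S S' v m" and s: "0 < s" "s < m"
    and "a \<in> S" "b \<in> S" "r \<in> S" "distinct [a, v s, b, r]"
    and "E (v s) a" "E (v s) b" "E a r" "E b r"
  shows False
proof -
  note D = path_earD[OF p]
  have main: False if "a = v (s - 1)" "b = v (Suc s)" "r \<in> S" "r \<noteq> v s" "E a r" "E b r" for a b
  proof (cases "Suc s < m")
    case True
    then have "r = v (Suc (Suc s))" using D(9)[of "Suc s" r] that by auto
    moreover have "r = v (s - 1 - 1) \<or> r = v s" if "s > 1"
      using D(9)[of "s - 1" r] that s \<open>E a r\<close> \<open>r \<in> S\<close> \<open>a = v (s - 1)\<close> by auto
    moreover have "v (s - 1) = v (Suc s) \<or> v (s - 1) = v (Suc (Suc (Suc s)))" if "s = 1"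
    proof -
      have "E (v (Suc (Suc s))) (v (s - 1))" using calculation(1) \<open>E a r\<close> \<open>a = v (s - 1)\<close> adj_sym by blast
      then show ?thesis using D(9)[of "Suc (Suc s)" "v (s - 1)"] D(2,3,5) that by auto
    qed
    moreover have "v (Suc (Suc s)) \<noteq> v (s - 1 - 1)"
      using D(7)[of "Suc (Suc s)" "s - 1 - 1"] True by linarith
    moreover have "v (Suc (Suc s)) \<noteq> v s"
      using D(7)[of "Suc (Suc s)" s] True by linarith
    moreover have "v (s - 1) \<noteq> v (Suc s)"
      using D(7)[of "s - 1" "Suc s"] True by linarith
    moreover have "v (s - 1) \<noteq> v (Suc (Suc (Suc s)))" if "s = 1"
      using D(7)[of "s - 1" "Suc (Suc (Suc s))"] that D(2) by linarith
    moreover have "s = 1 \<or> s > 1" using s by linarith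
    ultimately show False by metis
  next
    case False
    then have sm: "Suc s = m" using s by simp
    then have "r = v (s - 1 - 1)"
      using D(9)[of "s - 1" r] that s D(2) by auto
    moreover have "E r (v m)" using that sm adj_sym by auto
    ultimately have "v m = v (s - 1 - 1 - 1) \<or> v m = v (Suc (s - 1 - 1))"
      using D(9)[of "s - 1 - 1" "v m"] s sm D(2,4,5) by auto
    then show False using D(7)[of m "s - 1 - 1 - 1"] D(7)[of m "Suc (s - 1 - 1)"] sm D(2) by auto
  qed
  have "a = v (s - 1) \<or> a = v (Suc s)" "b = v (s - 1) \<or> b = v (Suc s)"
    using D(9) s assms by blast+
  then have "a = v (s - 1) \<and> b = v (Suc s) \<or> b = v (s - 1) \<and> a = v (Suc s)" using assms(7) by auto
  then show False using main[of a b] main[of b a] assms by auto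
qed

lemma path_ear_conf:
  assumes p: "path_ear S S' v m" and t: "t < m" and f: "f \<in> edges_on S" "conf {v t, v (Suc t)} f"
  shows "(\<exists>s<m. f = {v s, v (Suc s)} \<and> (s = Suc t \<or> t = Suc s)) \<or>
    f \<in> edges_on S' \<and> (t = 0 \<and> v 0 \<in> f \<or> Suc t = m \<and> v m \<in> f)"
proof -
  note D = path_earD[OF p]
  have vS: "v s \<in> S" if "s \<le> m" for s
    using that D(3-5) by (cases "s = 0 \<or> s = m") auto
  have inc: "v t \<in> f \<or> v (Suc t) \<in> f"
  proof (rule ccontr)
    assume "\<not> ?thesis"
    then obtain c d where cd: "f = {c, d}" "distinct [v t, v (Suc t), c, d]" "E (v (Suc t)) c" "E c d" "E d (v t)"
      using conf_pairD[OF f(2)] by blast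
    then have S: "c \<in> S" "d \<in> S" using f(1) by (auto simp: pair_in_edges_on)
    show False
    proof (cases "Suc t < m")
      case True
      show False
        by (rule path_ear_no_square[OF p _ True, of "v t" c d])
           (use cd S t vS D(8)[of t] adj_sym in \<open>auto\<close>)
    next
      case False
      then have t0: "0 < t" using t D(2) by simp
      show False
        by (rule path_ear_no_square[OF p t0 t, of "v (Suc t)" d c])
           (use cd S t vS D(8)[of t] adj_sym in \<open>auto\<close>)
    qed
  qed
  show ?thesis
  proof (cases "f \<in> edges_on S'")
    case True
    then have "\<forall>w\<in>f. w \<in> S'" by (auto elim!: edges_onE)
    then have "v t \<in> f \<longrightarrow> t = 0" "v (Suc t) \<in> f \<longrightarrow> Suc t = m"
      using D(6)[of t] D(6)[of "Suc t"] t by (metis Suc_lessI gr0I zero_less_Suc)+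
    then show ?thesis using inc True by auto
  next
    case False
    then obtain s where s: "s < m" "f = {v s, v (Suc s)}" using f(1) path_ear_edges[OF p] by auto
    have "s \<noteq> t" using f(2) s unfolding conf_def by auto
    moreover have "v t = v s \<or> v t = v (Suc s) \<or> v (Suc t) = v s \<or> v (Suc t) = v (Suc s)"
      using inc s by auto
    ultimately have "s = Suc t \<or> t = Suc s"
      using D(7)[of t s] D(7)[of t "Suc s"] D(7)[of "Suc t" s] D(7)[of "Suc t" "Suc s"] s(1) t by auto
    then show ?thesis using s by blast
  qed
qed

text \<open>With three colours a path of at least three edges can be properly coloured with arbitrary colours prescribed for
  its first and its last edge, so a long ear only has to respect the colours at its two ends.\<close>

lemma path_colouring:
  assumes "3 \<le> k" "p < k" "q < k" "2 \<le> L"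
  shows "\<exists>c::nat \<Rightarrow> nat. c 0 = p \<and> c L = q \<and> (\<forall>t<L. c t \<noteq> c (Suc t)) \<and> (\<forall>t. c t < k)"
  using assms(4,2)
proof (induction L arbitrary: p rule: dec_induct)
  case base
  have "card {p, q} < k" using assms(1) card_length[of "[p, q]"] by simp
  then obtain r where r: "r < k" "r \<notin> {p, q}" using obtain_colour[of "{p, q}" k] by blast
  let ?c = "\<lambda>t::nat. if t = 0 then p else if t = 1 then r else q"
  have "?c 0 = p \<and> ?c 2 = q \<and> (\<forall>t<2. ?c t \<noteq> ?c (Suc t)) \<and> (\<forall>t. ?c t < k)"
    using r base assms by (auto simp: less_2_cases_iff)
  then show ?case by (rule exI[of _ ?c])
next
  case (step L)
  have "card {p} < k" using assms(1) by simp
  then obtain r where r: "r < k" "r \<notin> {p}" using obtain_colour[of "{p}" k] by blast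
  obtain c where c: "c 0 = r" "c L = q" "\<forall>t<L. c t \<noteq> c (Suc t)" "\<forall>t. c t < k"
    using step.IH[OF r(1)] by blast
  let ?c = "\<lambda>t. case t of 0 \<Rightarrow> p | Suc s \<Rightarrow> c s"
  have "?c 0 = p \<and> ?c (Suc L) = q \<and> (\<forall>t<Suc L. ?c t \<noteq> ?c (Suc t)) \<and> (\<forall>t. ?c t < k)"
    using c r step.prems by (auto split: nat.split)
  then show ?case by (rule exI[of _ ?c])
qed

lemma path_ear_deg:
  assumes p: "path_ear S S' v m"
  shows "deg S' (v 0) < deg S (v 0)" "deg S' (v m) < deg S (v m)" "finite S"
proof -
  note D = path_earD[OF p]
  show fin: "finite S" using D(1,5) by auto
  show "deg S' (v 0) < deg S (v 0)"
    using fin D(2,5,6,8) by (intro deg_less[of S S' "v 1"]) auto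
  have "E (v (m - 1)) (v m)" using D(8)[of "m - 1"] D(2) by simp
  then show "deg S' (v m) < deg S (v m)"
    using fin D(2,5,6) adj_sym by (intro deg_less[of S S' "v (m - 1)"]) auto
qed

lemma path_ear_extend:
  assumes p: "path_ear S S' v m" and col: "proper_on S' k col"
    and dg: "deg S (v 0) \<le> k" "deg S (v m) \<le> k" and k: "3 \<le> k"
  shows "\<exists>col. proper_on S k col"
proof -
  note D = path_earD[OF p]
  let ?I = "{f \<in> edges_on S'. v 0 \<in> f}" and ?J = "{f \<in> edges_on S'. v m \<in> f}"
  have finIJ: "finite ?I" "finite ?J" using finite_edges_on[OF D(1)] by auto
  have I: "card (col ` ?I) < k"
    using card_image_le[OF finIJ(1), of col] card_edges_at_le[OF D(1), of "v 0"] path_ear_deg(1)[OF p] dg(1)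
    by linarith
  have J: "card (col ` ?J) < k"
    using card_image_le[OF finIJ(2), of col] card_edges_at_le[OF D(1), of "v m"] path_ear_deg(2)[OF p] dg(2)
    by linarith
  obtain r where r: "r < k" "r \<notin> col ` ?I"
    using obtain_colour[OF finite_imageI[OF finIJ(1)] I] by blast
  obtain q where q: "q < k" "q \<notin> col ` ?J"
    using obtain_colour[OF finite_imageI[OF finIJ(2)] J] by blast
  have m1: "2 \<le> m - 1" using D(2) by linarith
  obtain c where c: "c 0 = r" "c (m - 1) = q" "\<forall>t<m - 1. c t \<noteq> c (Suc t)" "\<forall>t. c t < k"
    using path_colouring[OF k r(1) q(1) m1] by blast
  let ?e = "\<lambda>t. {v t, v (Suc t)}"
  have inj: "inj_on ?e {..<m}"
  proof (rule inj_onI)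
    fix s t assume "s \<in> {..<m}" "t \<in> {..<m}" "?e s = ?e t"
    then show "s = t" using D(7)[of s t] D(7)[of s "Suc t"] D(7)[of "Suc s" t]
      by (auto simp: doubleton_eq_iff)
  qed
  have new: "?e t \<notin> edges_on S'" if "t < m" for t
  proof (cases "t = 0")
    case True
    then show ?thesis using D(6)[of 1] D(2) by (auto simp: pair_in_edges_on)
  next
    case False
    then show ?thesis using D(6)[of t] that by (auto simp: pair_in_edges_on)
  qed
  define col' where "col' e = (if e \<in> edges_on S' then col e else c (inv_into {..<m} ?e e))" for e
  have v: "col' (?e t) = c t" if "t < m" for t
    using that new[OF that] inv_into_f_f[OF inj, of t] unfolding col'_def by simp
  have "proper_on S k col'"
  proof (rule proper_on_extend[OF col equalityD1[OF path_ear_edges[OF p]]])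
    show "col' e = col e" if "e \<in> edges_on S'" for e
      using that unfolding col'_def by simp
    then have old: "col' e = col e" if "e \<in> edges_on S'" for e using that by blast
    show "col' e < k" if "e \<in> ?e ` {..<m}" for e
      using that v c by auto
    show "col' e \<noteq> col' f" if ef: "e \<in> ?e ` {..<m}" "f \<in> edges_on S" "conf e f" for e f
    proof -
      obtain t where t: "t < m" "e = ?e t" using ef by auto
      from path_ear_conf[OF p t(1) ef(2) ef(3)[unfolded t]]
      consider s where "s < m" "f = ?e s" "s = Suc t \<or> t = Suc s" | "f \<in> ?I" "t = 0" | "f \<in> ?J" "Suc t = m"
        by auto
      then show ?thesis
      proof cases
        case 1
        then have "t < m - 1 \<and> s = Suc t \<or> s < m - 1 \<and> t = Suc s" using t by linarith
        then have "c t \<noteq> c s" using c(3) by metis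
        then show ?thesis using v 1 t by simp
      next
        case 2
        then show ?thesis using v[OF t(1)] c(1) r(2) old t by force
      next
        case 3
        then have "c t = q" using c(2) by auto
        then show ?thesis using v[OF t(1)] q(2) old t 3 by force
      qed
    qed
  qed
  then show ?thesis by blast
qed

section \<open>Polygons and their leaf faces\<close>

lemma polygonD:
  assumes "polygon S"
  shows "finite S" "2 \<le> card S" "S \<noteq> {}" "Min S \<in> S" "Max S \<in> S" "Min S < Max S" "E (Min S) (Max S)"
    "a \<in> S \<Longrightarrow> b \<in> S \<Longrightarrow> a < b \<Longrightarrow> S \<inter> {a<..<b} = {} \<Longrightarrow> E a b"
    "a \<in> S \<Longrightarrow> Min S \<le> a" "a \<in> S \<Longrightarrow> a \<le> Max S"
proof -
  show fin: "finite S" and c: "2 \<le> card S" and e: "E (Min S) (Max S)"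
    using assms unfolding polygon_def by auto
  show ne: "S \<noteq> {}" using c by auto
  show m: "Min S \<in> S" "Max S \<in> S" using fin ne by auto
  have "Min S \<le> Max S" using fin m by auto
  moreover have "Min S \<noteq> Max S" using e adj_irrefl by metis
  ultimately show "Min S < Max S" by simp
  show "a \<in> S \<Longrightarrow> b \<in> S \<Longrightarrow> a < b \<Longrightarrow> S \<inter> {a<..<b} = {} \<Longrightarrow> E a b"
    using assms unfolding polygon_def by blast
  show "a \<in> S \<Longrightarrow> Min S \<le> a" "a \<in> S \<Longrightarrow> a \<le> Max S" using fin by auto
qed

lemma polygon_succ:
  assumes S: "polygon S" and s: "s \<in> S" "u \<in> S" "s < u"
  obtains t where "t \<in> S" "s < t" "t \<le> u" "S \<inter> {s<..<t} = {}" "E s t"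
proof -
  let ?T = "S \<inter> {s<..}"
  have T: "finite ?T" "?T \<noteq> {}" using polygonD(1)[OF S] s by auto
  obtain t where t: "t \<in> ?T" "\<And>w. w \<in> ?T \<Longrightarrow> t \<le> w" using Min_in[OF T] Min_le[OF T(1)] by metis
  then have "S \<inter> {s<..<t} = {}" by fastforce
  then show ?thesis using that[of t] polygonD(8)[OF S s(1)] t(1) t(2)[of u] s by auto
qed

lemma polygon_pred:
  assumes S: "polygon S" and s: "s \<in> S" "u \<in> S" "u < s"
  obtains t where "t \<in> S" "t < s" "u \<le> t" "S \<inter> {t<..<s} = {}" "E s t"
proof -
  let ?T = "S \<inter> {..<s}"
  have T: "finite ?T" "?T \<noteq> {}" using polygonD(1)[OF S] s by auto
  obtain t where t: "t \<in> ?T" "\<And>w. w \<in> ?T \<Longrightarrow> w \<le> t" using Max_in[OF T] Max_ge[OF T(1)] by metis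
  then have "S \<inter> {t<..<s} = {}" by fastforce
  then show ?thesis using that[of t] polygonD(8)[OF S _ s(1)] adj_sym t(1) t(2)[of u] s by auto
qed

lemma two_neighbours_deg:
  assumes "finite S" "u \<in> S" "w \<in> S" "u \<noteq> w" "E v u" "E v w" shows "2 \<le> deg S v"
proof -
  have "card {u, w} \<le> deg S v"
    unfolding deg_def using assms by (intro card_mono) auto
  then show ?thesis using assms(4) by simp
qed

text \<open>Each vertex has a predecessor and a successor in the cyclic order, where the smallest and
  the largest element are neighbours.\<close>

lemma polygon_min_degree:
  assumes S: "polygon S" and c: "3 \<le> card S" and v: "v \<in> S"
  shows "2 \<le> deg S v"
proof -
  note D = polygonD[OF S]
  have "card {Min S, Max S} \<le> 2" by (simp add: card_insert_if)
  then have "\<not> S \<subseteq> {Min S, Max S}" using card_mono[of "{Min S, Max S}" S] c by auto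
  then obtain w where w: "w \<in> S" "w \<noteq> Min S" "w \<noteq> Max S" by blast
  then have w: "w \<in> S" "Min S < w" "w < Max S" using D(9,10)[of w] by simp_all
  consider "v = Min S" | "v = Max S" | "Min S < v" "v < Max S"
    using D(9,10)[OF v] by linarith
  then show ?thesis
  proof cases
    case 1
    obtain t where "t \<in> S" "v < t" "t \<le> w" "E v t" using polygon_succ[OF S v w(1)] w 1 by metis
    then show ?thesis using two_neighbours_deg[of S t "Max S" v] D(1,5,7) w 1 by auto
  next
    case 2
    obtain t where "t \<in> S" "t < v" "w \<le> t" "E v t" using polygon_pred[OF S v w(1)] w 2 by metis
    then show ?thesis using two_neighbours_deg[of S t "Min S" v] D(1,4) adj_sym[OF D(7)] w 2 by auto
  next
    case 3
    obtain t where t: "t \<in> S" "t < v" "E v t" using polygon_pred[OF S v D(4) 3(1)] by metis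
    obtain s where s: "s \<in> S" "v < s" "E v s" using polygon_succ[OF S v D(5) 3(2)] by metis
    show ?thesis using two_neighbours_deg[of S t s v] D(1) t s by auto
  qed
qed

lemma polygon_remove_interior:
  assumes S: "polygon S" and ab: "a \<in> S" "b \<in> S" "a < b" "E a b"
  shows "polygon (S - {a<..<b})"
proof -
  note D = polygonD[OF S]
  let ?S = "S - {a<..<b}"
  have m: "Min S \<in> ?S" "Max S \<in> ?S" using D(4,5,9,10) ab by fastforce+
  have fin: "finite ?S" using D(1) by simp
  have mm: "Min ?S = Min S" "Max ?S = Max S"
    using m fin D(9,10) by (auto intro!: Min_eqI Max_eqI)
  have "card {a, b} \<le> card ?S" using ab fin by (intro card_mono) auto
  moreover have "E c d" if "c \<in> ?S" "d \<in> ?S" "c < d" "?S \<inter> {c<..<d} = {}" for c d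
  proof (cases "S \<inter> {c<..<d} = {}")
    case True
    then show ?thesis using D(8) that by auto
  next
    case False
    then obtain w where w: "w \<in> S" "c < w" "w < d" by auto
    then have "a < w" "w < b" using that by auto
    then have "c \<le> a" "b \<le> d" using that w by auto
    moreover have "a \<notin> {c<..<d}" "b \<notin> {c<..<d}" using that(4) ab by auto
    ultimately have "c = a" "d = b" using w \<open>a < w\<close> \<open>w < b\<close> by auto
    then show ?thesis using ab by simp
  qed
  ultimately show ?thesis
    unfolding polygon_def mm using D(7) fin ab(3) by auto
qed

text \<open>The edge \<open>(a, b)\<close> bounds a leaf of the weak dual tree: no other edge within \<open>{a..b}\<close> has a vertex strictly between its
  ends. The edge from the smallest to the largest vertex counts as well, so a chordless cycle is a
  leaf on that edge.\<close>

definition leaf where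
  "leaf S a b \<longleftrightarrow> a \<in> S \<and> b \<in> S \<and> a < b \<and> E a b \<and> S \<inter> {a<..<b} \<noteq> {} \<and>
    (\<forall>c\<in>S. \<forall>d\<in>S. a \<le> c \<and> c < d \<and> d \<le> b \<and> E c d \<and> S \<inter> {c<..<d} \<noteq> {} \<longrightarrow> c = a \<and> d = b)"

lemma leaf_exists:
  assumes "a \<in> S" "b \<in> S" "a < b" "E a b" "S \<inter> {a<..<b} \<noteq> {}"
  shows "\<exists>c d. leaf S c d \<and> a \<le> c \<and> d \<le> b"
  using assms
proof (induction "b - a" arbitrary: a b rule: less_induct)
  case less
  show ?case
  proof (cases "leaf S a b")
    case False
    then obtain c d where cd: "c \<in> S" "d \<in> S" "a \<le> c" "c < d" "d \<le> b" "E c d"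
      "S \<inter> {c<..<d} \<noteq> {}" "\<not> (c = a \<and> d = b)"
      using less.prems unfolding leaf_def by blast
    then have "d - c < b - a" by linarith
    from less.hyps[OF this cd(1,2,4,6,7)] cd show ?thesis by (meson le_trans)
  qed auto
qed

lemma interval_enumeration:
  assumes "finite S" "a \<in> S" "b \<in> S" "a < (b::nat)"
  obtains v and m :: nat where "v 0 = a" "v m = b" "\<And>s t. s < t \<Longrightarrow> t \<le> m \<Longrightarrow> v s < v t" "v ` {0..m} = S \<inter> {a..b}"
proof -
  let ?T = "S \<inter> {a..b}"
  define xs where "xs = sorted_list_of_set ?T"
  have fin: "finite ?T" using assms by simp
  have xs: "set xs = ?T" "sorted_wrt (<) xs" using fin by (simp_all add: xs_def)
  have ne: "xs \<noteq> []" using xs assms by auto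
  define m where "m = length xs - 1"
  have len: "length xs = Suc m" using ne m_def by simp
  have mono: "xs ! s < xs ! t" if "s < t" "t \<le> m" for s t
    using xs(2) that len by (simp add: sorted_wrt_iff_nth_less)
  have "{0..m} = {0..<length xs}" using len by auto
  then have im: "(!) xs ` {0..m} = ?T"
    using nth_image[of "length xs" xs] xs(1) by simp
  have "a \<in> (!) xs ` {0..m}" using im assms by simp
  then obtain s where s: "s \<le> m" "xs ! s = a" by auto
  have "b \<in> (!) xs ` {0..m}" using im assms by simp
  then obtain t where t: "t \<le> m" "xs ! t = b" by auto
  have "xs ! 0 \<in> (!) xs ` {0..m}" "xs ! m \<in> (!) xs ` {0..m}" by (intro imageI; simp)+
  then have "xs ! 0 \<in> ?T" "xs ! m \<in> ?T" unfolding im by blast+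
  then have "a \<le> xs ! 0" "xs ! m \<le> b" by auto
  moreover have "s = 0" using mono[of 0 s] s calculation by (cases "s = 0") auto
  moreover have "t = m" using mono[of t m] t calculation by (cases "t = m") auto
  ultimately show ?thesis using that[of "(!) xs" m] s t mono im by auto
qed

lemma leaf_neighbours:
  assumes S: "polygon S" and l: "leaf S a b" and x: "x \<in> S" "a < x" "x < b" and u: "u \<in> S" "E x u"
  shows "a \<le> u" "u \<le> b" "x < u \<longrightarrow> S \<inter> {x<..<u} = {}" "u < x \<longrightarrow> S \<inter> {u<..<x} = {}"
proof -
  have ab: "a \<in> S" "b \<in> S" "E a b" using l unfolding leaf_def by auto
  show ge: "a \<le> u" using no_crossing[of u a x b] u x ab adj_sym by (meson not_le)
  show le: "u \<le> b" using no_crossing[of a x b u] u x ab by (meson not_le)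
  show "x < u \<longrightarrow> S \<inter> {x<..<u} = {}"
    using l x u ge le unfolding leaf_def by (metis less_imp_le nat_neq_iff)
  show "u < x \<longrightarrow> S \<inter> {u<..<x} = {}"
    using l x u ge le adj_sym unfolding leaf_def by (metis less_imp_le nat_neq_iff)
qed

text \<open>Listing \<open>S \<inter> {a..b}\<close> in increasing order gives the path of the ear. An edge from an inner vertex cannot
  leave the interval without crossing \<open>(a, b)\<close>, and cannot skip a vertex by the leaf property, so it joins
  consecutive vertices.\<close>

lemma leaf_cases:
  assumes S: "polygon S" and l: "leaf S a b"
  obtains (triangle) x where "triangle_ear S (S - {a<..<b}) a x b" "S \<inter> {a<..<b} = {x}"
  | (quad) x z where "quad_ear S (S - {a<..<b}) a x z b" "S \<inter> {a<..<b} = {x, z}"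
  | (path) v m where "path_ear S (S - {a<..<b}) v m" "v 0 = a" "v m = b"
proof -
  have ab: "a \<in> S" "b \<in> S" "a < b" "E a b" "S \<inter> {a<..<b} \<noteq> {}" using l unfolding leaf_def by auto
  note D = polygonD[OF S]
  let ?T = "S - {a<..<b}"
  obtain v and m :: nat where v: "v 0 = a" "v m = b" "\<And>s t. s < t \<Longrightarrow> t \<le> m \<Longrightarrow> v s < v t"
    "v ` {0..m} = S \<inter> {a..b}"
    by (rule interval_enumeration[OF D(1) ab(1-3)]) blast
  have vS: "v t \<in> S" "a \<le> v t" "v t \<le> b" if "t \<le> m" for t
  proof -
    have "v t \<in> v ` {0..m}" using that by (intro imageI) simp
    then have "v t \<in> S \<inter> {a..b}" using v(4) by simp
    then show "v t \<in> S" "a \<le> v t" "v t \<le> b" by auto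
  qed
  have inj: "v s = v t \<longleftrightarrow> s = t" if "s \<le> m" "t \<le> m" for s t
    using v(3)[of s t] v(3)[of t s] that by (cases s t rule: linorder_cases) auto
  have int: "a < v t" "v t < b" if "0 < t" "t < m" for t
    using v(1,2) v(3)[of 0 t] v(3)[of t m] that by auto
  have adj: "E (v t) (v (Suc t))" if "t < m" for t
  proof (rule D(8))
    show "v t \<in> S" "v (Suc t) \<in> S" "v t < v (Suc t)" using vS v(3) that by auto
    show "S \<inter> {v t<..<v (Suc t)} = {}"
    proof (rule ccontr)
      assume "S \<inter> {v t<..<v (Suc t)} \<noteq> {}"
      then obtain w where w: "w \<in> S" "v t < w" "w < v (Suc t)" by auto
      then have "w \<in> S \<inter> {a..b}" using vS[of t] vS[of "Suc t"] that by auto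
      then obtain s where s: "s \<le> m" "w = v s" unfolding v(4)[symmetric] by auto
      have "\<not> s \<le> t" using v(3)[of s t] w s that by (cases "s = t") auto
      moreover have "\<not> Suc t \<le> s" using v(3)[of "Suc t" s] w s that by (cases "s = Suc t") auto
      ultimately show False by simp
    qed
  qed
  have nbr: "u = v (t - 1) \<or> u = v (Suc t)" if t: "0 < t" "t < m" and u: "u \<in> S" "E (v t) u" for t u
  proof -
    note n = leaf_neighbours[OF S l vS(1) int[OF t] u]
    have tm: "t \<le> m" using t by simp
    have "u \<in> S \<inter> {a..b}" using n(1,2)[OF tm] u by auto
    then obtain s where s: "s \<le> m" "u = v s" unfolding v(4)[symmetric] by auto
    have "s \<noteq> t" using u s adj_irrefl by metis
    moreover have "\<not> Suc t < s"
    proof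
      assume "Suc t < s"
      then have "v (Suc t) \<in> S \<inter> {v t<..<u}" using s v(3)[of t "Suc t"] v(3)[of "Suc t" s] vS[of "Suc t"] by auto
      moreover have "v t < u" using \<open>Suc t < s\<close> s v(3)[of t s] by auto
      ultimately show False using n(3)[OF tm] by auto
    qed
    moreover have "\<not> s < t - 1"
    proof
      assume "s < t - 1"
      then have "v (t - 1) \<in> S \<inter> {u<..<v t}" using s v(3)[of s "t - 1"] v(3)[of "t - 1" t] vS[of "t - 1"] t by auto
      moreover have "u < v t" using \<open>s < t - 1\<close> s v(3)[of s t] t by auto
      ultimately show False using n(4)[OF tm] by auto
    qed
    ultimately have "s = t - 1 \<or> s = Suc t" by linarith
    then show ?thesis using s by auto
  qed
  have SI: "S \<inter> {a<..<b} = v ` {0<..<m}"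
  proof
    show "S \<inter> {a<..<b} \<subseteq> v ` {0<..<m}"
    proof
      fix w assume w: "w \<in> S \<inter> {a<..<b}"
      then have "w \<in> S \<inter> {a..b}" by auto
      then obtain s where s: "s \<le> m" "w = v s" unfolding v(4)[symmetric] by auto
      moreover have "s \<noteq> 0"
      proof
        assume "s = 0"
        then have "w = a" using s v(1) by simp
        then show False using w by simp
      qed
      moreover have "s \<noteq> m"
      proof
        assume "s = m"
        then have "w = b" using s v(2) by simp
        then show False using w by simp
      qed
      ultimately show "w \<in> v ` {0<..<m}" by (intro image_eqI[of _ _ s]) auto
    qed
    show "v ` {0<..<m} \<subseteq> S \<inter> {a<..<b}" using vS int by auto
  qed
  have S_eq: "S = ?T \<union> v ` {0<..<m}" unfolding SI[symmetric] by auto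
  have fT: "finite ?T" "a \<in> ?T" "b \<in> ?T" using D(1) ab by auto
  have nT: "v t \<notin> ?T" if "0 < t" "t < m" for t using int[OF that] by auto
  have "{0<..<m} \<noteq> {}" using ab(5) SI by auto
  then have "2 \<le> m" by auto
  then consider "m = 2" | "m = 3" | "4 \<le> m" by linarith
  then show ?thesis
  proof cases
    case 1
    have I: "{0<..<m} = {1}" using 1 by auto
    have E1: "E a (v 1)" "E (v 1) b" using adj[of 0] adj[of 1] v(1,2) 1 by (auto simp: numeral_2_eq_2)
    have N: "u = a \<or> u = b" if "u \<in> S" "E (v 1) u" for u using nbr[of 1 u] that 1 v by (auto simp: numeral_2_eq_2)
    have Seq: "S = insert (v 1) ?T" using S_eq unfolding I by blast
    have n1: "v 1 \<notin> ?T" by (rule nT) (use 1 in simp_all)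
    have "triangle_ear S ?T a (v 1) b"
      unfolding triangle_ear_def
      by (intro conjI ballI impI fT Seq n1 ab(4) E1(2) adj_sym[OF E1(1)] N) (use ab(3) in auto)
    moreover have "S \<inter> {a<..<b} = {v 1}" unfolding SI I by simp
    ultimately show ?thesis by (rule triangle)
  next
    case 2
    have I: "{0<..<m} = {1, 2}" using 2 by auto
    have E1: "E a (v 1)" "E (v 1) (v 2)" "E (v 2) b"
      using adj[of 0] adj[of 1] adj[of 2] v(1,2) 2 by (auto simp: numeral_2_eq_2 numeral_3_eq_3)
    have N: "u = a \<or> u = v 2" if "u \<in> S" "E (v 1) u" for u using nbr[of 1 u] that 2 v by (auto simp: numeral_2_eq_2)
    have N2: "u = v 1 \<or> u = b" if "u \<in> S" "E (v 2) u" for u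
      using nbr[of 2 u] that 2 v by (auto simp: numeral_2_eq_2 numeral_3_eq_3)
    have Seq: "S = insert (v 1) (insert (v 2) ?T)" using S_eq unfolding I by blast
    have n1: "v 1 \<notin> ?T" by (rule nT) (use 2 in simp_all)
    have n2: "v 2 \<notin> ?T" by (rule nT) (use 2 in simp_all)
    have n3: "v 1 \<noteq> v 2" using inj[of 1 2] 2 by simp
    have "quad_ear S ?T a (v 1) (v 2) b"
      unfolding quad_ear_def
      by (intro conjI ballI impI fT Seq n1 n2 n3 ab(4) E1 N N2) (use ab(3) in auto)
    moreover have "S \<inter> {a<..<b} = {v 1, v 2}" unfolding SI I by simp
    ultimately show ?thesis by (rule quad)
  next
    case 3
    have "path_ear S ?T v m"
      unfolding path_ear_def
    proof (intro conjI allI impI)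
      show "inj_on v {0..m}" using inj by (auto simp: inj_on_def)
    qed (use fT v(1,2) S_eq nbr adj nT 3 in \<open>auto\<close>)
    then show ?thesis using v(1,2) by (rule path)
  qed
qed

lemma leaf_deg:
  assumes S: "polygon S" and l: "leaf S a b"
  shows "deg (S - {a<..<b}) a < deg S a" "deg (S - {a<..<b}) b < deg S b"
proof -
  have ab: "a \<in> S" "b \<in> S" "a < b" "E a b" "S \<inter> {a<..<b} \<noteq> {}" using l unfolding leaf_def by auto
  then obtain w where w: "w \<in> S" "a < w" "w < b" by auto
  obtain t where t: "t \<in> S" "a < t" "t \<le> w" "E a t" using polygon_succ[OF S ab(1) w(1,2)] by metis
  obtain s where s: "s \<in> S" "s < b" "w \<le> s" "E b s" using polygon_pred[OF S ab(2) w(1,3)] by metis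
  show "deg (S - {a<..<b}) a < deg S a" "deg (S - {a<..<b}) b < deg S b"
    using deg_less[OF polygonD(1)[OF S], of "S - {a<..<b}" t a] deg_less[OF polygonD(1)[OF S], of "S - {a<..<b}" s b]
      s t w ab by auto
qed

lemma polygon_smaller:
  assumes S: "polygon S" and l: "leaf S a b"
  shows "polygon (S - {a<..<b})" "card (S - {a<..<b}) < card S"
  using l polygon_remove_interior[OF S] polygonD(1)[OF S] unfolding leaf_def
  by (auto intro!: psubset_card_mono)

section \<open>A triangle with two triangular leaves\<close>

text \<open>On the base edge \<open>ab\<close> stands a triangle with apex \<open>j\<close>, and its sides \<open>aj\<close> and \<open>jb\<close> carry triangular ears
  with tips \<open>x\<close> and \<open>z\<close>; \<open>T\<close> is what remains without \<open>x\<close>, \<open>j\<close> and \<open>z\<close>. Exchanging \<open>a\<close> with \<open>b\<close>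
  and \<open>x\<close> with \<open>z\<close> is a symmetry.\<close>

definition gadget where
  "gadget S T a x j z b \<longleftrightarrow> finite T \<and> S = insert x (insert j (insert z T)) \<and> distinct [a, x, j, z, b] \<and>
     x \<notin> T \<and> j \<notin> T \<and> z \<notin> T \<and> a \<in> T \<and> b \<in> T \<and>
     E a b \<and> E a x \<and> E x j \<and> E a j \<and> E z j \<and> E b z \<and> E b j \<and>
     (\<forall>u\<in>S. E x u \<longrightarrow> u = a \<or> u = j) \<and> (\<forall>u\<in>S. E z u \<longrightarrow> u = b \<or> u = j) \<and>
     (\<forall>u\<in>S. E j u \<longrightarrow> u = a \<or> u = x \<or> u = z \<or> u = b)"

lemma gadget_sym: "gadget S T a x j z b \<Longrightarrow> gadget S T b z j x a"
  unfolding gadget_def using adj_sym by (auto simp: insert_commute)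

lemma gadgetD:
  assumes "gadget S T a x j z b"
  shows "finite T" "S = insert x (insert j (insert z T))" "distinct [a, x, j, z, b]"
    "x \<notin> T" "j \<notin> T" "z \<notin> T" "a \<in> T" "b \<in> T" "E a b" "E a x" "E x j" "E a j" "E z j" "E b z" "E b j"
    "u \<in> S \<Longrightarrow> E x u \<Longrightarrow> u = a \<or> u = j" "u \<in> S \<Longrightarrow> E z u \<Longrightarrow> u = b \<or> u = j"
    "u \<in> S \<Longrightarrow> E j u \<Longrightarrow> u = a \<or> u = x \<or> u = z \<or> u = b"
    "a \<in> S" "b \<in> S" "x \<in> S" "j \<in> S" "z \<in> S"
proof -
  note A = assms[unfolded gadget_def]
  show S: "S = insert x (insert j (insert z T))" and "a \<in> T" "b \<in> T"
    using A by - (elim conjE, assumption)+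
  then show "a \<in> S" "b \<in> S" "x \<in> S" "j \<in> S" "z \<in> S" by simp_all
  show "finite T" "distinct [a, x, j, z, b]" "x \<notin> T" "j \<notin> T" "z \<notin> T"
    "E a b" "E a x" "E x j" "E a j" "E z j" "E b z" "E b j"
    using A by - (elim conjE, assumption)+
  have "\<forall>u\<in>S. E x u \<longrightarrow> u = a \<or> u = j" "\<forall>u\<in>S. E z u \<longrightarrow> u = b \<or> u = j"
    "\<forall>u\<in>S. E j u \<longrightarrow> u = a \<or> u = x \<or> u = z \<or> u = b"
    using A by - (elim conjE, assumption)+
  then show "u \<in> S \<Longrightarrow> E x u \<Longrightarrow> u = a \<or> u = j" "u \<in> S \<Longrightarrow> E z u \<Longrightarrow> u = b \<or> u = j"
    "u \<in> S \<Longrightarrow> E j u \<Longrightarrow> u = a \<or> u = x \<or> u = z \<or> u = b"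
    by blast+
qed

abbreviation gadget_edges where
  "gadget_edges a x j z b \<equiv> {{a, x}, {x, j}, {a, j}, {b, z}, {z, j}, {b, j}}"

lemma gadget_edges_on:
  assumes g: "gadget S T a x j z b"
  shows "edges_on S = edges_on T \<union> gadget_edges a x j z b" (is "?l = ?r")
proof
  note D = gadgetD[OF g]
  show "?l \<subseteq> ?r"
  proof
    fix e assume e: "e \<in> ?l"
    consider "x \<in> e" | "z \<in> e" | "j \<in> e" | "x \<notin> e" "z \<notin> e" "j \<notin> e" by blast
    then show "e \<in> ?r"
    proof cases
      case 1
      with e obtain u where "e = {x, u}" "u \<in> S" "E x u" by (metis edges_on_at)
      then have "e = {a, x} \<or> e = {x, j}" using D(16) by (metis insert_commute)
      then show ?thesis by (elim disjE) simp_all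
    next
      case 2
      with e obtain u where "e = {z, u}" "u \<in> S" "E z u" by (metis edges_on_at)
      then have "e = {b, z} \<or> e = {z, j}" using D(17) by (metis insert_commute)
      then show ?thesis by (elim disjE) simp_all
    next
      case 3
      with e obtain u where "e = {j, u}" "u \<in> S" "E j u" by (metis edges_on_at)
      then have "e = {a, j} \<or> e = {x, j} \<or> e = {z, j} \<or> e = {b, j}" using D(18) by (metis insert_commute)
      then show ?thesis by (elim disjE) simp_all
    next
      case 4
      obtain p q where pq: "e = {p, q}" "p \<in> S" "q \<in> S" "E p q" using e by (rule edges_onE)
      then have "p \<in> T" "q \<in> T" using 4 D(2) by auto
      then show ?thesis using pq by (simp add: pair_in_edges_on)
    qed
  qed
  show "?r \<subseteq> ?l"
  proof -
    have "edges_on T \<subseteq> edges_on S" using D(2) by (intro edges_on_mono) auto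
    moreover have "gadget_edges a x j z b \<subseteq> edges_on S"
      using D(9-15,19-23) by (simp add: pair_in_edges_on)
    ultimately show ?thesis by blast
  qed
qed

lemma gadget_conf_outer:
  assumes g: "gadget S T a x j z b" and f: "f \<in> edges_on S" "conf {a, x} f"
  shows "f = {x, j} \<or> f = {a, j} \<or> f = {b, j} \<or> f \<in> edges_on T \<and> a \<in> f"
proof -
  note D = gadgetD[OF g]
  have ne: "f \<noteq> {a, x}" using f(2) unfolding conf_def by auto
  from conf_pairD[OF f(2)] consider "a \<in> f" | "x \<in> f"
    | c d where "f = {c, d}" "distinct [a, x, c, d]" "E x c" "E c d" "E d a" by blast
  then show ?thesis
  proof cases
    case 1
    then obtain u where u: "f = {a, u}" "u \<in> S" "E a u" using f(1) by (metis edges_on_at)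
    have "u \<noteq> z" using u D(3) D(17)[of a] adj_sym D(19) by auto
    then have "u = x \<or> u = j \<or> u \<in> T" using u(2) D(2) by blast
    then show ?thesis using u ne D(7) by (auto simp: pair_in_edges_on)
  next
    case 2
    then obtain u where u: "f = {x, u}" "u \<in> S" "E x u" using f(1) by (metis edges_on_at)
    then show ?thesis using D(16) ne by (metis insert_commute)
  next
    case 3
    then have S: "c \<in> S" "d \<in> S" using f(1) by (simp_all add: pair_in_edges_on)
    then have c: "c = j" using 3 D(16)[of c] by auto
    then have "d = a \<or> d = x \<or> d = z \<or> d = b" using 3 D(18)[of d] S by auto
    moreover have "d \<noteq> z" using 3(5) D(3) D(17)[of a] D(19) by auto
    ultimately have "d = b" using 3(2) by auto
    then show ?thesis using 3 c by auto
  qed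
qed

lemma gadget_conf_inner:
  assumes g: "gadget S T a x j z b" and f: "f \<in> edges_on S" "conf {x, j} f"
  shows "f = {a, x} \<or> f = {a, j} \<or> f = {z, j} \<or> f = {b, j} \<or> f = {a, b}"
proof -
  note D = gadgetD[OF g]
  have ne: "f \<noteq> {x, j}" using f(2) unfolding conf_def by auto
  from conf_pairD[OF f(2)] consider "x \<in> f" | "j \<in> f"
    | c d where "f = {c, d}" "distinct [x, j, c, d]" "E j c" "E c d" "E d x" by blast
  then show ?thesis
  proof cases
    case 1
    then obtain u where u: "f = {x, u}" "u \<in> S" "E x u" using f(1) by (metis edges_on_at)
    then show ?thesis using D(16) ne by (metis insert_commute)
  next
    case 2
    then obtain u where u: "f = {j, u}" "u \<in> S" "E j u" using f(1) by (metis edges_on_at)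
    then show ?thesis using D(18) ne by (metis insert_commute)
  next
    case 3
    then have S: "c \<in> S" "d \<in> S" using f(1) by (simp_all add: pair_in_edges_on)
    then have d: "d = a" using 3 D(16)[of d] adj_sym by auto
    have "c = a \<or> c = x \<or> c = z \<or> c = b" using 3 D(18)[of c] S by auto
    moreover have "c \<noteq> z" using 3(4) d D(3) D(17)[of a] D(19) by auto
    ultimately have "c = b" using 3(2) d by auto
    then show ?thesis using 3 d by auto
  qed
qed

lemma gadget_conf_spoke:
  assumes g: "gadget S T a x j z b" and f: "f \<in> edges_on S" "conf {a, j} f"
  shows "f = {a, x} \<or> f = {x, j} \<or> f = {z, j} \<or> f = {b, j} \<or> f = {b, z} \<or>
    f \<in> edges_on T \<and> (a \<in> f \<or> b \<in> f)"
proof -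
  note D = gadgetD[OF g]
  have ne: "f \<noteq> {a, j}" using f(2) unfolding conf_def by auto
  from conf_pairD[OF f(2)] consider "a \<in> f" | "j \<in> f"
    | c d where "f = {c, d}" "distinct [a, j, c, d]" "E j c" "E c d" "E d a" by blast
  then show ?thesis
  proof cases
    case 1
    then obtain u where u: "f = {a, u}" "u \<in> S" "E a u" using f(1) by (metis edges_on_at)
    have "u \<noteq> z" using u D(3) D(17)[of a] adj_sym D(19) by auto
    then have "u = x \<or> u = j \<or> u \<in> T" using u(2) D(2) by blast
    then show ?thesis using u ne D(7) by (auto simp: pair_in_edges_on)
  next
    case 2
    then obtain u where u: "f = {j, u}" "u \<in> S" "E j u" using f(1) by (metis edges_on_at)
    then show ?thesis using D(18) ne by (metis insert_commute)
  next
    case 3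
    then have S: "c \<in> S" "d \<in> S" using f(1) by (simp_all add: pair_in_edges_on)
    have dz: "d \<noteq> z" using 3(5) D(3) D(17)[of a] D(19) by auto
    have cx: "c \<noteq> x" using 3 D(16)[of d] S by auto
    have c: "c = z \<or> c = b" using 3 D(18)[of c] S cx by auto
    show ?thesis
    proof (cases "c = z")
      case True
      then have "d = b" using 3 D(17)[of d] S by auto
      then show ?thesis using 3 True by auto
    next
      case False
      then have cb: "c = b" using c by simp
      have "d \<noteq> x" using 3(4) cb D(3) D(16)[of b] D(20) adj_sym by auto
      then have "d \<in> T" using S dz 3(2) D(2) by auto
      then show ?thesis using 3 cb D(8) by (auto simp: pair_in_edges_on)
    qed
  qed
qed

text \<open>Let \<open>C\<close> and \<open>D'\<close> be the two colours other than \<open>A\<close>, \<open>B\<close> and the colour of \<open>ab\<close>. The four edges at \<open>j\<close> all conflict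
  with \<open>ab\<close> and with each other. Giving \<open>C\<close> and \<open>D'\<close> to \<open>aj\<close> and \<open>bj\<close> leaves \<open>A\<close> and \<open>B\<close> for the rest: \<open>B\<close> for \<open>ax\<close>
  and \<open>zj\<close>, \<open>A\<close> for \<open>xj\<close> and \<open>bz\<close>.\<close>

lemma gadget_extend:
  assumes g: "gadget S T a x j z b" and col: "proper_on T 5 col"
    and AB: "A < 5" "B < 5" "A \<noteq> B" "A \<noteq> col {a, b}" "B \<noteq> col {a, b}"
    and at_a: "\<And>f. f \<in> edges_on T \<Longrightarrow> a \<in> f \<Longrightarrow> f \<noteq> {a, b} \<Longrightarrow> col f = A"
    and at_b: "\<And>f. f \<in> edges_on T \<Longrightarrow> b \<in> f \<Longrightarrow> f \<noteq> {a, b} \<Longrightarrow> col f = B"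
  shows "\<exists>col. proper_on S 5 col"
proof -
  note D = gadgetD[OF g]
  have "card {A, B, col {a, b}} < 5" using card_length[of "[A, B, col {a, b}]"] by simp
  then obtain C where C: "C < 5" "C \<notin> {A, B, col {a, b}}"
    using obtain_colour[of "{A, B, col {a, b}}" 5] by blast
  have "card {A, B, C, col {a, b}} < 5" using card_length[of "[A, B, C, col {a, b}]"] by simp
  then obtain D' where D': "D' < 5" "D' \<notin> {A, B, C, col {a, b}}"
    using obtain_colour[of "{A, B, C, col {a, b}}" 5] by blast
  define col' where "col' = col({a, j} := C, {b, j} := D', {a, x} := B, {z, j} := B, {x, j} := A, {b, z} := A)"
  have dist: "a \<noteq> x" "a \<noteq> j" "a \<noteq> z" "a \<noteq> b" "x \<noteq> j" "x \<noteq> z" "x \<noteq> b" "j \<noteq> z" "j \<noteq> b" "z \<noteq> b"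
    using D(3) by auto
  have v: "col' {a, j} = C" "col' {b, j} = D'" "col' {a, x} = B" "col' {z, j} = B" "col' {x, j} = A" "col' {b, z} = A"
    using dist unfolding col'_def by (simp_all add: doubleton_eq_iff)
  have notT: "e \<notin> edges_on T" if "e \<in> gadget_edges a x j z b" for e
    using that D(4-6) by (auto simp: pair_in_edges_on)
  have old: "col' e = col e" if "e \<in> edges_on T" for e
  proof -
    have "e \<notin> gadget_edges a x j z b" using notT that by blast
    then show ?thesis unfolding col'_def by simp
  qed
  have ab: "{a, b} \<in> edges_on T" using D(7-9) by (simp add: pair_in_edges_on)
  have ta: "col' f = col {a, b} \<or> col' f = A" if "f \<in> edges_on T" "a \<in> f" for f
    using at_a[OF that] old[OF that(1)] by metis
  have tb: "col' f = col {a, b} \<or> col' f = B" if "f \<in> edges_on T" "b \<in> f" for f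
    using at_b[OF that] old[OF that(1)] by metis
  have cc: "C \<noteq> A" "C \<noteq> B" "C \<noteq> col {a, b}" "D' \<noteq> A" "D' \<noteq> B" "D' \<noteq> C" "D' \<noteq> col {a, b}"
    using C(2) D'(2) by auto
  have cab: "col' {a, b} = col {a, b}" using old ab by blast
  note g' = gadget_sym[OF g]
  have swap: "{j, x} = {x, j}" "{b, a} = {a, b}" by auto
  have c1: "col' {a, x} \<noteq> col' f" if f: "f \<in> edges_on S" "conf {a, x} f" for f
    using gadget_conf_outer[OF g f] v AB cc ta by metis
  have c2: "col' {b, z} \<noteq> col' f" if f: "f \<in> edges_on S" "conf {b, z} f" for f
    using gadget_conf_outer[OF g' f] v AB cc tb by metis
  have c3: "col' {x, j} \<noteq> col' f" if f: "f \<in> edges_on S" "conf {x, j} f" for f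
    using gadget_conf_inner[OF g f] v AB cc cab by metis
  have c4: "col' {z, j} \<noteq> col' f" if f: "f \<in> edges_on S" "conf {z, j} f" for f
    using gadget_conf_inner[OF g' f] v AB cc cab swap by metis
  have c5: "col' {a, j} \<noteq> col' f" if f: "f \<in> edges_on S" "conf {a, j} f" for f
    using gadget_conf_spoke[OF g f] v AB cc ta tb by metis
  have c6: "col' {b, j} \<noteq> col' f" if f: "f \<in> edges_on S" "conf {b, j} f" for f
    using gadget_conf_spoke[OF g' f] v AB cc ta tb by metis
  have "proper_on S 5 col'"
  proof (rule proper_on_extend[OF col equalityD1[OF gadget_edges_on[OF g]] old])
    show "col' e < 5" if "e \<in> gadget_edges a x j z b" for e
      using that v AB C(1) D'(1) by auto
    show "col' e \<noteq> col' f" if e: "e \<in> gadget_edges a x j z b" and f: "f \<in> edges_on S" "conf e f" for e f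
      using e f c1 c2 c3 c4 c5 c6 by (elim insertE emptyE) simp_all
  qed
  then show ?thesis by blast
qed

lemma at_most_one_further_edge:
  assumes "finite T" "deg T a \<le> 2" "b \<in> T" "E a b" "f \<in> edges_on T" "a \<in> f" "f \<noteq> {a, b}"
    "g \<in> edges_on T" "a \<in> g" "g \<noteq> {a, b}"
  shows "f = g"
proof (rule ccontr)
  assume fg: "f \<noteq> g"
  obtain u where u: "f = {a, u}" "u \<in> T" "E a u" using assms(5,6) by (metis edges_on_at)
  obtain w where w: "g = {a, w}" "w \<in> T" "E a w" using assms(8,9) by (metis edges_on_at)
  have "card {b, u, w} \<le> deg T a"
    unfolding deg_def using assms(1,3,4) u w by (intro card_mono) auto
  moreover have "distinct [b, u, w]" using fg u w assms(7,10) by auto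
  ultimately show False using assms(2) distinct_card[of "[b, u, w]"] by simp
qed

text \<open>Outside the gadget at most one edge \<open>fa\<close> leaves \<open>a\<close> and at most one edge \<open>fb\<close> leaves \<open>b\<close>, apart from \<open>ab\<close>. If
  they have different colours, or one is absent, \<open>gadget_extend\<close> applies. If they have equal colours, the colouring does not extend as it stands. But then they
  are not in conflict, so their other ends \<open>w\<close> and \<open>w2\<close> are distinct and not adjacent. Then \<open>fa\<close> is on no
  4-cycle that avoids the gadget: it conflicts with \<open>ab\<close> and at most three edges at \<open>w\<close>. So \<open>fa\<close> can get a
  colour different from those three and from that of \<open>fb\<close>, after which \<open>ab\<close>, which conflicts
  only with \<open>fa\<close> and \<open>fb\<close>, is recoloured.\<close>

lemma gadget_colourable:
  assumes g: "gadget S T a x j z b" and col: "proper_on T 5 col"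
    and deg: "\<And>u. u \<in> S \<Longrightarrow> deg S u \<le> 4"
  shows "\<exists>col. proper_on S 5 col"
proof -
  note D = gadgetD[OF g]
  have fin: "finite S" using D(1,2) by auto
  have sub: "T \<subseteq> S" using D(2) by auto
  have ab: "{a, b} \<in> edges_on T" using D(7-9) by (simp add: pair_in_edges_on)
  have dist: "a \<noteq> b" using D(3) by auto
  have degT: "deg T u \<le> 4" if "u \<in> T" for u
    using deg_mono[OF fin sub, of u] deg[of u] that sub by force
  have degT2: "deg T u \<le> 2" if u: "u \<in> T" "E u j" "E u y" "y \<noteq> j" "y \<in> S" "y \<notin> T" for u y
  proof -
    have f1: "finite (insert j T)" using D(1) by simp
    have "deg T u < deg (insert j T) u"
      using u D(5) by (intro deg_less[OF f1, of T j]) auto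
    moreover have "deg (insert j T) u < deg S u"
      using u D(2) by (intro deg_less[OF fin, of "insert j T" y]) auto
    ultimately show ?thesis using deg[of u] u sub by force
  qed
  have da: "deg T a \<le> 2" using degT2[of a x] D by auto
  have db: "deg T b \<le> 2" using degT2[of b z] D by auto
  let ?F = "\<lambda>u. {f \<in> edges_on T. u \<in> f \<and> f \<noteq> {a, b}}"
  have Fa: "f = h" if "f \<in> ?F a" "h \<in> ?F a" for f h
    using at_most_one_further_edge[OF D(1) da D(8,9)] that by blast
  have Fb: "f = h" if "f \<in> ?F b" "h \<in> ?F b" for f h
    using at_most_one_further_edge[OF D(1) db D(7) adj_sym[OF D(9)]] that
    by (auto simp: insert_commute)
  have lt: "col f < 5" if "f \<in> edges_on T" for f using col that unfolding proper_on_def by blast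
  have cf: "col e \<noteq> col f" if "e \<in> edges_on T" "f \<in> edges_on T" "conf e f" for e f
    using col that unfolding proper_on_def by blast
  have c_ab: "col f \<noteq> col {a, b}" if "f \<in> ?F a \<or> f \<in> ?F b" for f
    using that cf[OF _ ab] unfolding conf_def by blast
  have Cu: "col h < 5 \<and> col h \<noteq> col {a, b} \<and> (\<forall>f\<in>?F u. col f = col h)" if h: "u = a \<or> u = b" "h \<in> ?F u" for u h
  proof (intro conjI ballI)
    show "col h < 5" using lt[of h] h by simp
    show "col h \<noteq> col {a, b}" using c_ab[of h] h by blast
    fix f assume "f \<in> ?F u"
    then have "f = h" using h(1) Fa[of f h] Fb[of f h] h(2) by (elim disjE) simp_all
    then show "col f = col h" by simp
  qed
  note Ca = Cu[OF disjI1[OF refl]] and Cb = Cu[OF disjI2[OF refl]]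
  have fresh: "\<exists>c<5. c \<noteq> p \<and> c \<noteq> q" for p q :: nat
  proof -
    have "card {p, q} < 5" using card_length[of "[p, q]"] by simp
    then show ?thesis using obtain_colour[of "{p, q}" 5] by (metis finite.emptyI finite_insert insertCI)
  qed
  show ?thesis
  proof (cases "\<exists>fa fb. fa \<in> ?F a \<and> fb \<in> ?F b \<and> col fa = col fb")
    case False
    define FA FB where "FA = ?F a" and "FB = ?F b"
    note Ca' = Ca[folded FA_def] and Cb' = Cb[folded FB_def]
    have "\<exists>A B. A < 5 \<and> B < 5 \<and> A \<noteq> B \<and> A \<noteq> col {a, b} \<and> B \<noteq> col {a, b} \<and>
      (\<forall>f\<in>FA. col f = A) \<and> (\<forall>f\<in>FB. col f = B)"
    proof -
      consider "FA = {}" "FB = {}" | fb where "FA = {}" "fb \<in> FB" | fa where "fa \<in> FA" "FB = {}"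
        | fa fb where "fa \<in> FA" "fb \<in> FB" by blast
      then show ?thesis
      proof cases
        case 1
        obtain A where "A < 5" "A \<noteq> col {a, b}" using fresh by metis
        moreover obtain B where "B < 5" "B \<noteq> A" "B \<noteq> col {a, b}" using fresh by metis
        ultimately show ?thesis using 1 by (intro exI[of _ A] exI[of _ B]) simp
      next
        case (2 fb)
        obtain A where "A < 5" "A \<noteq> col {a, b}" "A \<noteq> col fb" using fresh by metis
        then show ?thesis using 2(1) Cb'[OF 2(2)] by (intro exI[of _ A] exI[of _ "col fb"]) simp
      next
        case (3 fa)
        obtain B where "B < 5" "B \<noteq> col {a, b}" "B \<noteq> col fa" using fresh by metis
        then show ?thesis using 3(2) Ca'[OF 3(1)] by (intro exI[of _ "col fa"] exI[of _ B]) simp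
      next
        case (4 fa fb)
        then have "col fa \<noteq> col fb" using False unfolding FA_def FB_def by blast
        then show ?thesis using Ca'[OF 4(1)] Cb'[OF 4(2)] by (intro exI[of _ "col fa"] exI[of _ "col fb"]) simp
      qed
    qed
    then obtain A B where AB: "A < 5" "B < 5" "A \<noteq> B" "A \<noteq> col {a, b}" "B \<noteq> col {a, b}"
      "\<forall>f\<in>FA. col f = A" "\<forall>f\<in>FB. col f = B" by blast
    show ?thesis by (rule gadget_extend[OF g col AB(1-5)]) (use AB(6,7) in \<open>simp add: FA_def FB_def\<close>)+
  next
    case True
    then obtain fa fb where fa: "fa \<in> ?F a" and fb: "fb \<in> ?F b" and eq: "col fa = col fb" by blast
    obtain w where w: "fa = {a, w}" "w \<in> T" "E a w" using fa by (metis (no_types, lifting) edges_on_at mem_Collect_eq)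
    obtain w2 where w2: "fb = {b, w2}" "w2 \<in> T" "E b w2" using fb by (metis (no_types, lifting) edges_on_at mem_Collect_eq)
    have wab: "w \<noteq> b" "w2 \<noteq> a" "w \<noteq> a" "w2 \<noteq> b" using w w2 fa fb adj_irrefl by (auto simp: insert_commute)
    have nconf: "\<not> conf fa fb" using cf[of fa fb] fa fb eq by blast
    have fafb: "fa \<noteq> fb" using w w2 dist wab by (auto simp: doubleton_eq_iff)
    have ww: "w \<noteq> w2" using nconf fafb w w2 unfolding conf_def by auto
    have nadj: "\<not> E w w2"
    proof
      assume h: "E w w2"
      have "distinct [w, a, b, w2]" using wab ww dist by auto
      moreover have "E w a" "E w2 w" using h w adj_sym by blast+
      moreover have "fa = {w, a}" using w by auto
      ultimately have "conf fa fb" using fafb w2 D(9) unfolding conf_def by blast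
      then show False using nconf by simp
    qed
    have conf_fa: "f = {a, b} \<or> (w \<in> f \<and> f \<noteq> fa)" if f: "f \<in> edges_on T" "conf fa f" for f
    proof -
      have ne: "f \<noteq> fa" using f unfolding conf_def by auto
      from conf_pairD[OF f(2)[unfolded w]] consider "a \<in> f" | "w \<in> f"
        | c d where "f = {c, d}" "distinct [a, w, c, d]" "E w c" "E c d" "E d a" by blast
      then show ?thesis
      proof cases
        case 1
        then show ?thesis using Fa[of f fa] f fa ne by blast
      next
        case 2 then show ?thesis using ne by blast
      next
        case 3
        then have S: "c \<in> T" "d \<in> T" using f(1) by (simp_all add: pair_in_edges_on)
        have "{a, d} \<in> edges_on T" "{a, d} \<noteq> fa"
          using 3 S D(7) adj_sym w by (auto simp: pair_in_edges_on doubleton_eq_iff)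
        then have "{a, d} = {a, b}" using Fa[of "{a, d}" fa] fa by blast
        then have d: "d = b" by (auto simp: doubleton_eq_iff)
        have "{b, c} \<in> edges_on T" "{b, c} \<noteq> {a, b}"
          using 3 S d D(8) adj_sym by (auto simp: pair_in_edges_on doubleton_eq_iff)
        then have "{b, c} = fb" using Fb[of "{b, c}" fb] fb by blast
        then have "c = w2" using w2 wab by (auto simp: doubleton_eq_iff)
        then show ?thesis using 3 nadj by blast
      qed
    qed
    have conf_ab: "f = fa \<or> f = fb" if f: "f \<in> edges_on T" "conf {a, b} f" for f
    proof -
      have ne: "f \<noteq> {a, b}" using f unfolding conf_def by auto
      from conf_pairD[OF f(2)] consider "a \<in> f" | "b \<in> f"
        | c d where "f = {c, d}" "distinct [a, b, c, d]" "E b c" "E c d" "E d a" by blast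
      then show ?thesis
      proof cases
        case 1
        then show ?thesis using Fa[of f fa] f fa ne by blast
      next
        case 2
        then show ?thesis using Fb[of f fb] f fb ne by blast
      next
        case 3
        then have S: "c \<in> T" "d \<in> T" using f(1) by (simp_all add: pair_in_edges_on)
        have "{a, d} \<in> edges_on T" "{a, d} \<noteq> {a, b}" "{b, c} \<in> edges_on T" "{b, c} \<noteq> {a, b}"
          using 3 S D(7,8) adj_sym by (auto simp: pair_in_edges_on doubleton_eq_iff)
        then have "{a, d} = fa" "{b, c} = fb" using Fa[of "{a, d}" fa] Fb[of "{b, c}" fb] fa fb by blast+
        then have "d = w" "c = w2" using w w2 wab by (auto simp: doubleton_eq_iff)
        then show ?thesis using 3 nadj adj_sym by blast
      qed
    qed
    let ?W = "{f \<in> edges_on T. w \<in> f}"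
    have finW: "finite ?W" using finite_edges_on[OF D(1)] by auto
    have "card (?W - {fa}) < card ?W" using finW fa w by (intro psubset_card_mono) auto
    also have "\<dots> \<le> 4" using card_edges_at_le[OF D(1), of w] degT[OF w(2)] by simp
    finally have "card (col ` (?W - {fa})) \<le> 3"
      using card_image_le[of "?W - {fa}" col] finW by simp
    then have "card (insert (col fb) (col ` (?W - {fa}))) < 5"
      using finW by (simp add: card_insert_if)
    then obtain r where r: "r < 5" "r \<notin> insert (col fb) (col ` (?W - {fa}))"
      using obtain_colour[of "insert (col fb) (col ` (?W - {fa}))" 5] finW by blast
    obtain s where s: "s < 5" "s \<noteq> r" "s \<noteq> col fb" using fresh by metis
    define col' where "col' = col(fa := r, {a, b} := s)"
    have ne: "fa \<noteq> {a, b}" "fb \<noteq> {a, b}" using fa fb by blast+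
    have v: "col' fa = r" "col' {a, b} = s" "col' fb = col fb"
      using ne fafb unfolding col'_def by auto
    have old: "col' e = col e" if "e \<notin> {fa, {a, b}}" for e using that unfolding col'_def by auto
    have "proper_on T 5 col'"
    proof (rule proper_on_extend[OF col])
      show "edges_on T \<subseteq> edges_on T \<union> {fa, {a, b}}" by blast
      show "col' e = col e" if "e \<notin> {fa, {a, b}}" for e using old that by blast
      show "col' e < 5" if "e \<in> {fa, {a, b}}" for e using that v r s by blast
      show "col' e \<noteq> col' f" if e: "e \<in> {fa, {a, b}}" and f: "f \<in> edges_on T" "conf e f" for e f
      proof (cases "e = {a, b}")
        case True
        then show ?thesis using conf_ab[of f] f v s by metis
      next
        case False
        then have e: "e = fa" using e by blast
        show ?thesis
        proof (cases "f = {a, b}")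
          case True
          then show ?thesis using e v s by metis
        next
          case False
          then have "f \<in> ?W - {fa}" "f \<notin> {fa, {a, b}}" using conf_fa[of f] f e by blast+
          then show ?thesis using e v(1) old[of f] r(2) by auto
        qed
      qed
    qed
    then show ?thesis
    proof (rule gadget_extend[OF g, of _ r "col fb"])
      show "r < 5" "col fb < 5" "r \<noteq> col fb" "r \<noteq> col' {a, b}" "col fb \<noteq> col' {a, b}"
        using r s v lt[of fb] fb by auto
      show "col' f = r" if "f \<in> edges_on T" "a \<in> f" "f \<noteq> {a, b}" for f
        using Fa[of f fa] fa v that by blast
      show "col' f = col fb" if "f \<in> edges_on T" "b \<in> f" "f \<noteq> {a, b}" for f
        using Fb[of f fb] fb v that by blast
    qed
  qed
qed

section \<open>Colouring polygons\<close>

text \<open>For polygons with maximum degree at most \<open>\<Delta>\<close> this singles out the 4-cycle if \<open>\<Delta> = 2\<close>, and \<open>K\<^sub>4 - e\<close> if \<open>\<Delta> = 3\<close>. Larger values of \<open>\<Delta>\<close>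
  provide enough colours for both, and so does \<open>\<Delta> = 3\<close> for the 4-cycle, which matters because it
  may occur as a smaller polygon in the induction.\<close>

definition exceptional :: "nat \<Rightarrow> nat set \<Rightarrow> bool" where
  "exceptional \<Delta> S \<longleftrightarrow> card S = 4 \<and> (\<Delta> = 2 \<or> \<Delta> = 3 \<and> (\<exists>v\<in>S. deg S v = 3))"

lemma edges_on_card_two:
  assumes "card S = 2" "e \<in> edges_on S" shows "e = S"
proof -
  obtain p q where "e = {p, q}" "p \<in> S" "q \<in> S" "p \<noteq> q" using assms(2) by (rule edges_onE)
  then have "e \<subseteq> S" "card e = 2" by auto
  moreover have "finite S" using assms(1) card.infinite by fastforce
  ultimately show ?thesis using assms(1) by (metis card_subset_eq)
qed

text \<open>The leaves over which a colouring with \<open>\<Delta> + 1\<close> colours need not extend: a quadrilateral for \<open>\<Delta> = 2\<close>, and a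
  triangle whose base \<open>ab\<close> is on a second triangle \<open>aby\<close> while \<open>a\<close> and \<open>b\<close> have degree \<open>\<Delta>\<close>.\<close>

definition blocked :: "nat \<Rightarrow> nat set \<Rightarrow> nat \<Rightarrow> nat \<Rightarrow> bool" where
  "blocked \<Delta> S a b \<longleftrightarrow> \<Delta> = 2 \<and> (\<exists>x z. x \<noteq> z \<and> S \<inter> {a<..<b} = {x, z}) \<or>
    (\<exists>x y. triangle_ear S (S - {a<..<b}) a x b \<and> S \<inter> {a<..<b} = {x} \<and> y \<in> S - {a<..<b} \<and>
       E a y \<and> E b y \<and> deg S a = \<Delta> \<and> deg S b = \<Delta>)"

text \<open>An ear with at least four edges needs one free colour at either end and three in total, a quadrilateral
  needs two free colours at one end and four in total. For a triangle the number of conflicts at either end is at most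
  \<open>\<Delta>\<close>, so a colour is left for each of the two new edges. There is a choice for one of them, and hence an
  extension, unless the base is on a second triangle and both its ends have full degree.\<close>

lemma leaf_extend_or_blocked:
  assumes S: "polygon S" and l: "leaf S a b" and col: "proper_on (S - {a<..<b}) (Suc \<Delta>) col"
    and deg: "\<And>v. v \<in> S \<Longrightarrow> deg S v \<le> \<Delta>" and \<Delta>: "2 \<le> \<Delta>"
    and no: "\<not> (\<exists>col. proper_on S (Suc \<Delta>) col)"
  shows "blocked \<Delta> S a b"
proof -
  have ab: "a \<in> S" "b \<in> S" using l unfolding leaf_def by auto
  show ?thesis
  proof (cases rule: leaf_cases[OF S l])
    case (2 x z)
    have "\<not> 3 \<le> \<Delta>"
    proof
      assume "3 \<le> \<Delta>"
      then show False
        using no quad_ear_extend[OF 2(1) col le_imp_less_Suc[OF deg[OF ab(1)]] le_imp_less_Suc[OF deg[OF ab(2)]]]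
        by simp
    qed
    moreover have "x \<noteq> z" using 2(1) unfolding quad_ear_def by blast
    ultimately have "\<Delta> = 2 \<and> x \<noteq> z" using \<Delta> by simp
    then show ?thesis using 2(2) unfolding blocked_def by blast
  next
    case (3 v m)
    then show ?thesis using path_ear_extend[OF 3(1) col] deg[OF ab(1)] deg[OF ab(2)] no \<Delta> by simp
  next
    case (1 x)
    let ?T = "S - {a<..<b}"
    note t = 1(1) and t' = triangle_ear_sym[OF 1(1)]
    have d: "deg S a \<le> \<Delta>" "deg S b \<le> \<Delta>" using deg ab by auto
    have y: "\<exists>y\<in>?T. E a y \<and> E b y"
    proof (rule ccontr)
      assume h: "\<not> ?thesis"
      then have h': "\<not> (\<exists>y\<in>?T. E b y \<and> E a y)" by blast
      have "card (forbidden (S - {a<..<b}) a b) < Suc \<Delta>" "Suc (card (forbidden (S - {a<..<b}) b a)) < Suc \<Delta>"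
        using forbidden_bound(3)[OF t h] forbidden_bound(3)[OF t' h'] d by linarith+
      then show False using triangle_ear_extend[OF t col] no by blast
    qed
    have "\<not> deg S b < \<Delta>"
    proof
      assume "deg S b < \<Delta>"
      then have "card (forbidden (S - {a<..<b}) a b) < Suc \<Delta>" "Suc (card (forbidden (S - {a<..<b}) b a)) < Suc \<Delta>"
        using forbidden_bound(2)[OF t] forbidden_bound(2)[OF t'] d by linarith+
      then show False using triangle_ear_extend[OF t col] no by blast
    qed
    moreover have "\<not> deg S a < \<Delta>"
    proof
      assume "deg S a < \<Delta>"
      then have "card (forbidden (S - {a<..<b}) b a) < Suc \<Delta>" "Suc (card (forbidden (S - {a<..<b}) a b)) < Suc \<Delta>"
        using forbidden_bound(2)[OF t] forbidden_bound(2)[OF t'] d by linarith+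
      then show False using triangle_ear_extend[OF t' col] no by blast
    qed
    ultimately have "deg S a = \<Delta>" "deg S b = \<Delta>" using d by simp_all
    then show ?thesis using y t 1(2) unfolding blocked_def by blast
  qed
qed

lemma interval_neighbour:
  assumes "a \<in> S" "b \<in> S" "E a b" "a < j" "j < b" "E j u"
  shows "a \<le> u" "u \<le> b"
  using no_crossing[of u a j b] no_crossing[of a j b u] adj_sym assms by (meson not_le)+

lemma polygon_interior:
  assumes S: "polygon S" and c3: "3 \<le> card S" shows "S \<inter> {Min S<..<Max S} \<noteq> {}"
proof
  assume "S \<inter> {Min S<..<Max S} = {}"
  then have "S \<subseteq> {Min S, Max S}" using polygonD(9,10)[OF S] by force
  then have "card S \<le> card {Min S, Max S}" by (intro card_mono) auto
  also have "\<dots> \<le> 2" by (simp add: card_insert_if)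
  finally show False using c3 by simp
qed

lemma polygon_has_leaf:
  assumes S: "polygon S" and c3: "3 \<le> card S" shows "\<exists>a b. leaf S a b"
  using leaf_exists[OF polygonD(4-7)[OF S] polygon_interior[OF S c3]] by blast

text \<open>A leaf base has an end of degree at least three if anything lies beyond it, so the leaf is the whole polygon. Its base
  is then on no second triangle, which leaves the quadrilateral.\<close>

lemma blocked_degree_two:
  assumes S: "polygon S" and c3: "3 \<le> card S" and deg: "\<And>v. v \<in> S \<Longrightarrow> deg S v \<le> 2"
    and blocked: "\<And>a b. leaf S a b \<Longrightarrow> \<not> exceptional 2 (S - {a<..<b}) \<Longrightarrow> blocked 2 S a b"
  shows "card S = 4"
proof -
  note D = polygonD[OF S]
  obtain a b where l: "leaf S a b" using polygon_has_leaf[OF S c3] by blast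
  let ?T = "S - {a<..<b}"
  have ab: "a \<in> ?T" "b \<in> ?T" "a < b" using l unfolding leaf_def by auto
  note T = polygonD[OF polygon_smaller(1)[OF S l]]
  have "deg ?T a < 2" using leaf_deg(1)[OF S l] deg[of a] ab by fastforce
  then have "\<not> 3 \<le> card ?T" using polygon_min_degree[OF polygon_smaller(1)[OF S l] _ ab(1)] by fastforce
  then have cT: "card ?T = 2" using T(2) by linarith
  have Teq: "{a, b} = ?T" using T(1) ab cT by (intro card_subset_eq) auto
  have nT: "\<not> (y \<in> ?T \<and> E a y \<and> E b y)" for y
  proof
    assume h: "y \<in> ?T \<and> E a y \<and> E b y"
    then have "y = a \<or> y = b" unfolding Teq[symmetric] by simp
    then show False using h adj_irrefl by metis
  qed
  have "\<not> exceptional 2 ?T" using cT unfolding exceptional_def by simp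
  then obtain x z where xz: "x \<noteq> z" "S \<inter> {a<..<b} = {x, z}" using blocked[OF l] nT unfolding blocked_def by blast
  have "card S = card (?T \<union> (S \<inter> {a<..<b}))" by (rule arg_cong[of _ _ card]) blast
  also have "\<dots> = card ?T + card (S \<inter> {a<..<b})" using D(1) by (intro card_Un_disjoint) auto
  finally show ?thesis using cT xz by simp
qed

text \<open>Removing a leaf never leaves \<open>K\<^sub>4 - e\<close>, since the ends of the base have degree at most two in
  the rest. So some leaf is blocked, and \<open>a\<close>, \<open>b\<close> have no neighbours but each other, \<open>x\<close> and \<open>y\<close>. If \<open>y\<close> is
  beyond \<open>b\<close>, then \<open>a\<close> has no predecessor and is the smallest vertex, whose neighbour \<open>Max S\<close> can only be
  \<open>y\<close>; and the successor of \<open>b\<close> is \<open>y\<close>. This leaves the four vertices \<open>a\<close>, \<open>x\<close>, \<open>b\<close>, \<open>y\<close>. The other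
  case is the mirror image.\<close>

lemma blocked_degree_three:
  assumes S: "polygon S" and c3: "3 \<le> card S" and deg: "\<And>v. v \<in> S \<Longrightarrow> deg S v \<le> 3"
    and blocked: "\<And>a b. leaf S a b \<Longrightarrow> \<not> exceptional 3 (S - {a<..<b}) \<Longrightarrow> blocked 3 S a b"
  shows "card S = 4 \<and> (\<exists>v\<in>S. deg S v = 3)"
proof -
  note D = polygonD[OF S]
  obtain a b where l: "leaf S a b" using polygon_has_leaf[OF S c3] by blast
  let ?T = "S - {a<..<b}"
  have ab: "a \<in> ?T" "b \<in> ?T" "a < b" "E a b" "a \<in> S" "b \<in> S" using l unfolding leaf_def by auto
  note T = polygonD[OF polygon_smaller(1)[OF S l]]
  have da: "deg ?T a \<le> 2" "deg ?T b \<le> 2"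
    using leaf_deg[OF S l] deg[OF ab(5)] deg[OF ab(6)] by simp_all
  have "\<not> exceptional 3 ?T"
  proof
    assume "exceptional 3 ?T"
    then obtain v where v: "card ?T = 4" "v \<in> ?T" "deg ?T v = 3" unfolding exceptional_def by auto
    have "v \<noteq> a" "v \<noteq> b" using da v by auto
    have "{u \<in> ?T. E v u} = ?T - {v}"
    proof (rule card_subset_eq)
      show "{u \<in> ?T. E v u} \<subseteq> ?T - {v}" using adj_irrefl by blast
      show "card {u \<in> ?T. E v u} = card (?T - {v})" using v T(1) unfolding deg_def by simp
    qed (use T(1) in simp)
    then have va: "E v a" "E v b" using ab \<open>v \<noteq> a\<close> \<open>v \<noteq> b\<close> by blast+
    have "card {a, b, v} < card ?T" using v(1) \<open>v \<noteq> a\<close> \<open>v \<noteq> b\<close> ab(3) by simp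
    then obtain u where u: "u \<in> ?T" "u \<noteq> a" "u \<noteq> b" "u \<noteq> v"
      by (metis card_mono finite.emptyI finite_insert insertCI not_less subsetI)
    have sub: "{a, b, v, u} = ?T"
      using u v ab \<open>v \<noteq> a\<close> \<open>v \<noteq> b\<close> T(1) by (intro card_subset_eq) auto
    have "\<not> E u a"
    proof
      assume "E u a"
      then have "card {b, v, u} \<le> deg ?T a" unfolding deg_def
        using T(1) u v ab va adj_sym by (intro card_mono) auto
      then show False using da u \<open>v \<noteq> b\<close> by simp
    qed
    moreover have "\<not> E u b"
    proof
      assume "E u b"
      then have "card {a, v, u} \<le> deg ?T b" unfolding deg_def
        using T(1) u v ab va adj_sym by (intro card_mono) auto
      then show False using da u \<open>v \<noteq> a\<close> by simp
    qed
    ultimately have "{w \<in> ?T. E u w} \<subseteq> {v}"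
      unfolding sub[symmetric] using adj_irrefl[of u] by auto
    then have "deg ?T u \<le> 1" unfolding deg_def using card_mono[of "{v}"] by fastforce
    moreover have "2 \<le> deg ?T u"
      using polygon_min_degree[OF polygon_smaller(1)[OF S l] _ u(1)] v(1) by simp
    ultimately show False by simp
  qed
  then obtain x y where xy: "S \<inter> {a<..<b} = {x}" "y \<in> ?T" "E a y" "E b y" "deg S a = 3" "deg S b = 3"
    "triangle_ear S ?T a x b" using blocked[OF l] unfolding blocked_def by auto
  have "x \<in> S \<inter> {a<..<b}" using xy(1) by simp
  moreover have "E x a" "E x b" using xy(7) unfolding triangle_ear_def by simp_all
  ultimately have x: "x \<in> S" "a < x" "x < b" "E a x" "E b x" using adj_sym by simp_all
  have y: "y \<in> S" "y \<noteq> a" "y \<noteq> b" "y < a \<or> b < y"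
    using xy(2-4) adj_irrefl ab(3) by (auto, metis linorder_neqE_nat)
  have nb: "{u \<in> S. E a u} = {x, b, y}"
  proof (rule sym, rule card_subset_eq)
    show "{x, b, y} \<subseteq> {u \<in> S. E a u}" using x y ab xy by blast
    show "card {x, b, y} = card {u \<in> S. E a u}" using xy(5) x y ab(3) unfolding deg_def by auto
  qed (use D(1) in simp)
  have nb': "{u \<in> S. E b u} = {x, a, y}"
  proof (rule sym, rule card_subset_eq)
    show "{x, a, y} \<subseteq> {u \<in> S. E b u}" using x y ab xy adj_sym by blast
    show "card {x, a, y} = card {u \<in> S. E b u}" using xy(6) x y ab(3) unfolding deg_def by auto
  qed (use D(1) in simp)
  have sub: "S \<subseteq> {a, x, b, y}"
    using y(4)
  proof
    assume yb: "b < y"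
    have mn: "Min S = a"
    proof (rule ccontr)
      assume "Min S \<noteq> a"
      then have "Min S < a" using D(9)[OF ab(5)] by simp
      then obtain t where "t \<in> S" "t < a" "E a t" using polygon_pred[OF S ab(5) D(4)] by metis
      then have "t \<in> {x, b, y}" "t < a" using nb by blast+
      then show False using x ab(3) yb by auto
    qed
    then have "Max S \<in> {x, b, y}" using nb D(5,7) by blast
    then have mx: "Max S = y" using D(10)[OF y(1)] x yb by auto
    obtain t where t: "t \<in> S" "b < t" "S \<inter> {b<..<t} = {}" "E b t" using polygon_succ[OF S ab(6) y(1) yb] by metis
    then have "t \<in> {x, a, y}" using nb' by blast
    then have "t = y" using t(2) x ab(3) by auto
    show ?thesis
    proof
      fix s assume s: "s \<in> S"
      then have "a \<le> s" "s \<le> y" using mn mx D(9,10) by auto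
      moreover have "s \<notin> {a<..<b} \<or> s = x" using s xy(1) by blast
      moreover have "s \<notin> {b<..<y}" using s t(3) \<open>t = y\<close> by blast
      ultimately show "s \<in> {a, x, b, y}" by auto
    qed
  next
    assume ya: "y < a"
    have mn: "Max S = b"
    proof (rule ccontr)
      assume "Max S \<noteq> b"
      then have "b < Max S" using D(10)[OF ab(6)] by simp
      then obtain t where "t \<in> S" "b < t" "E b t" using polygon_succ[OF S ab(6) D(5)] by metis
      then have "t \<in> {x, a, y}" "b < t" using nb' by blast+
      then show False using x ab(3) ya by auto
    qed
    then have "Min S \<in> {x, a, y}" using nb' D(4,7) adj_sym by blast
    then have mx: "Min S = y" using D(9)[OF y(1)] x ya by auto
    obtain t where t: "t \<in> S" "t < a" "S \<inter> {t<..<a} = {}" "E a t" using polygon_pred[OF S ab(5) y(1) ya] by metis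
    then have "t \<in> {x, b, y}" using nb by blast
    then have "t = y" using t(2) x ab(3) by auto
    show ?thesis
    proof
      fix s assume s: "s \<in> S"
      then have "y \<le> s" "s \<le> b" using mn mx D(9,10) by auto
      moreover have "s \<notin> {a<..<b} \<or> s = x" using s xy(1) by blast
      moreover have "s \<notin> {y<..<a}" using s t(3) \<open>t = y\<close> by blast
      ultimately show "s \<in> {a, x, b, y}" by auto
    qed
  qed
  then have "S = {a, x, b, y}" using ab(5,6) x(1) y(1) by blast
  then have "card S = 4" using x y ab(3) by auto
  then show ?thesis using xy(5) ab(5) by blast
qed

text \<open>If all leaves are blocked, the second triangle on a leaf next to a face with only one non-leaf neighbour is
  that face itself. So the face is a triangle \<open>ajb\<close>, and the degree of its apex \<open>j\<close> is \<open>\<Delta> \<ge> 4\<close>. The vertex \<open>j\<close> has at most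
  one neighbour inside each of its two sides, so both sides carry a triangular leaf and \<open>\<Delta> = 4\<close>.\<close>

lemma blocked_large_degree:
  assumes S: "polygon S" and c3: "3 \<le> card S" and \<Delta>: "4 \<le> \<Delta>"
    and blocked: "\<And>a b. leaf S a b \<Longrightarrow> blocked \<Delta> S a b"
  shows "\<Delta> = 4 \<and> (\<exists>a b x j z. a \<in> S \<and> b \<in> S \<and> a < b \<and> E a b \<and> S \<inter> {a<..<b} \<noteq> {} \<and>
    gadget S (S - {a<..<b}) a x j z b)"
proof -
  note D = polygonD[OF S]
  have tri: "\<exists>x y. triangle_ear S (S - {a<..<b}) a x b \<and> S \<inter> {a<..<b} = {x} \<and> y \<in> S - {a<..<b} \<and>
     E a y \<and> E b y \<and> deg S a = \<Delta> \<and> deg S b = \<Delta>" if "leaf S a b" for a b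
    using blocked[OF that] \<Delta> unfolding blocked_def by auto
  \<comment> \<open>A deep edge has a face behind it that is not a leaf. The face behind a deep edge of minimal
     span has only leaves as further neighbours.\<close>
  define deep where "deep p \<longleftrightarrow> (case p of (a, b) \<Rightarrow> a \<in> S \<and> b \<in> S \<and> a < b \<and> E a b \<and> S \<inter> {a<..<b} \<noteq> {} \<and> \<not> leaf S a b)"
    for p
  have "deep (Min S, Max S)"
  proof (rule ccontr)
    assume "\<not> ?thesis"
    then have "leaf S (Min S) (Max S)" using D polygon_interior[OF S c3] unfolding deep_def by auto
    then obtain y where y: "y \<in> S - {Min S<..<Max S}" "E (Min S) y" "E (Max S) y" using tri by blast
    then have "y = Min S \<or> y = Max S" using D(9,10)[of y] by auto
    then show False using y adj_irrefl by metis
  qed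
  then obtain p where p: "deep p" "\<And>q. deep q \<Longrightarrow> snd p - fst p \<le> snd q - fst q"
    using ex_has_least_nat[of deep _ "\<lambda>p. snd p - fst p"] by blast
  obtain a b where pab: "p = (a, b)" by fastforce
  have ab: "a \<in> S" "b \<in> S" "a < b" "E a b" "S \<inter> {a<..<b} \<noteq> {}" "\<not> leaf S a b"
    using p(1) unfolding pab deep_def by auto
  have nested: "leaf S c d" if h: "c \<in> S" "d \<in> S" "a \<le> c" "c < d" "d \<le> b" "E c d" "S \<inter> {c<..<d} \<noteq> {}"
    "c \<noteq> a \<or> d \<noteq> b" for c d
  proof (rule ccontr)
    assume "\<not> leaf S c d"
    then have "deep (c, d)" using h unfolding deep_def by auto
    from p(2)[OF this] show False using h pab by auto
  qed
  have whole: "c = a \<and> d = b" if h: "c \<in> S" "d \<in> S" "a \<le> c" "c < d" "d \<le> b" "E c d"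
    "c \<le> c'" "c' < d'" "d' \<le> d" "leaf S c' d'" "c \<noteq> c' \<or> d \<noteq> d'" for c d c' d'
  proof (rule ccontr)
    assume h': "\<not> (c = a \<and> d = b)"
    have cd': "c' \<in> S" "d' \<in> S" "E c' d'" "S \<inter> {c'<..<d'} \<noteq> {}" using h(10) unfolding leaf_def by auto
    then have "S \<inter> {c<..<d} \<noteq> {}" using h by fastforce
    then have "leaf S c d" using nested h h' by blast
    then show False using cd' h unfolding leaf_def by blast
  qed
  obtain c d where cd: "c \<in> S" "d \<in> S" "a \<le> c" "c < d" "d \<le> b" "E c d" "S \<inter> {c<..<d} \<noteq> {}" "c \<noteq> a \<or> d \<noteq> b"
    using ab unfolding leaf_def by blast
  note lcd = nested[OF cd]
  obtain x y where xy: "triangle_ear S (S - {c<..<d}) c x d" "y \<in> S - {c<..<d}" "E c y" "E d y"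
    "deg S c = \<Delta>" "deg S d = \<Delta>" using tri[OF lcd] by blast
  have y: "y \<in> S" "y \<noteq> c" "y \<noteq> d" "y < c \<or> d < y"
    using xy(2-4) adj_irrefl cd(4) by (auto, metis linorder_neqE_nat)
  have yab: "a \<le> y" "y \<le> b"
  proof -
    have "a < c \<or> d < b" using cd by linarith
    then have "a \<le> y \<and> y \<le> b"
      using interval_neighbour[OF ab(1,2,4), of c y] interval_neighbour[OF ab(1,2,4), of d y] xy(3,4) cd
      by (meson le_less_trans less_le_trans)
    then show "a \<le> y" "y \<le> b" by simp_all
  qed
  \<comment> \<open>The second triangle on \<open>cd\<close> has \<open>y\<close> as its apex, so \<open>{c, d, y}\<close> is the face behind \<open>(a, b)\<close>. Its
     apex over \<open>ab\<close> is the one of \<open>c\<close> and \<open>d\<close> which is neither \<open>a\<close> nor \<open>b\<close>.\<close>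
  obtain j where j: "j \<in> S" "a < j" "j < b" "E a j" "E j b" "deg S j = \<Delta>"
    using y(4)
  proof
    assume h: "d < y"
    then have "c = a \<and> y = b"
      using whole[of c y c d] cd y yab xy(3) lcd by auto
    then show thesis using that[of d] cd h xy by blast
  next
    assume h: "y < c"
    then have "y = a \<and> d = b"
      using whole[of y d c d] cd y yab adj_sym[OF xy(4)] lcd by auto
    then show thesis using that[of c] cd h xy adj_sym by blast
  qed
  have L: "S \<inter> {a<..<j} = {} \<or> (\<exists>x. triangle_ear S (S - {a<..<j}) a x j \<and> S \<inter> {a<..<j} = {x})"
    using tri[OF nested[of a j]] ab j by fastforce
  have R: "S \<inter> {j<..<b} = {} \<or> (\<exists>z. triangle_ear S (S - {j<..<b}) j z b \<and> S \<inter> {j<..<b} = {z})"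
    using tri[OF nested[of j b]] ab j by fastforce
  have nbj: "{u \<in> S. E j u} \<subseteq> {a, b} \<union> (S \<inter> {a<..<j}) \<union> (S \<inter> {j<..<b})"
  proof
    fix u assume "u \<in> {u \<in> S. E j u}"
    then have u: "u \<in> S" "E j u" by auto
    have "a \<le> u" "u \<le> b" using interval_neighbour[OF ab(1,2,4) j(2,3) u(2)] by auto
    moreover have "u \<noteq> j" using u adj_irrefl by metis
    ultimately show "u \<in> {a, b} \<union> (S \<inter> {a<..<j}) \<union> (S \<inter> {j<..<b})" using u(1) by auto
  qed
  have c1: "card (S \<inter> {a<..<j}) \<le> 1" "card (S \<inter> {j<..<b}) \<le> 1" using L R by auto
  have "\<Delta> \<le> card ({a, b} \<union> (S \<inter> {a<..<j}) \<union> (S \<inter> {j<..<b}))"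
    using j(6) nbj D(1) unfolding deg_def by (metis card_mono finite.emptyI finite_Int finite_Un finite_insert)
  also have "\<dots> \<le> card {a, b} + card (S \<inter> {a<..<j}) + card (S \<inter> {j<..<b})"
    by (meson add_le_mono card_Un_le le_refl le_trans)
  finally have "\<Delta> \<le> 2 + card (S \<inter> {a<..<j}) + card (S \<inter> {j<..<b})"
    using ab(3) by simp
  then have \<Delta>4: "\<Delta> = 4" and ne: "S \<inter> {a<..<j} \<noteq> {}" "S \<inter> {j<..<b} \<noteq> {}" using c1 \<Delta> by auto
  obtain x where x: "triangle_ear S (S - {a<..<j}) a x j" "S \<inter> {a<..<j} = {x}" using L ne by blast
  obtain z where z: "triangle_ear S (S - {j<..<b}) j z b" "S \<inter> {j<..<b} = {z}" using R ne by blast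
  let ?T = "S - {a<..<b}"
  have "x \<in> S \<inter> {a<..<j}" "z \<in> S \<inter> {j<..<b}" using x(2) z(2) by simp_all
  then have xin: "x \<in> S" "a < x" "x < j" and zin: "z \<in> S" "j < z" "z < b" by simp_all
  have I: "S \<inter> {a<..<b} = {x, j, z}"
  proof
    show "S \<inter> {a<..<b} \<subseteq> {x, j, z}"
    proof
      fix s assume s: "s \<in> S \<inter> {a<..<b}"
      show "s \<in> {x, j, z}"
      proof (cases s j rule: linorder_cases)
        case less
        then have "s \<in> S \<inter> {a<..<j}" using s by auto
        then show ?thesis using x(2) by blast
      next
        case greater
        then have "s \<in> S \<inter> {j<..<b}" using s by auto
        then show ?thesis using z(2) by blast
      qed blast
    qed
  qed (use xin zin j in auto)
  have gd: "gadget S ?T a x j z b"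
    unfolding gadget_def
  proof (intro conjI)
    show "finite ?T" using D(1) by simp
    show "S = insert x (insert j (insert z ?T))" using I by blast
    show "distinct [a, x, j, z, b]" using xin zin ab by auto
    show "x \<notin> ?T" "j \<notin> ?T" "z \<notin> ?T" using I by blast+
    show "a \<in> ?T" "b \<in> ?T" using ab by auto
    show "E a b" "E a j" "E b j" using ab j adj_sym by blast+
    have "E x a" "E z b" using x(1) z(1) unfolding triangle_ear_def by simp_all
    then show "E a x" "E b z" by (simp_all add: adj_sym)
    show "E x j" using x(1) unfolding triangle_ear_def by (elim conjE)
    show "E z j" using z(1) unfolding triangle_ear_def by (elim conjE)
    show "\<forall>u\<in>S. E x u \<longrightarrow> u = a \<or> u = j" using x(1) unfolding triangle_ear_def by (elim conjE)
    have "\<forall>u\<in>S. E z u \<longrightarrow> u = j \<or> u = b" using z(1) unfolding triangle_ear_def by (elim conjE)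
    then show "\<forall>u\<in>S. E z u \<longrightarrow> u = b \<or> u = j" by blast
    show "\<forall>u\<in>S. E j u \<longrightarrow> u = a \<or> u = x \<or> u = z \<or> u = b" using nbj x(2) z(2) by blast
  qed
  then show ?thesis using \<Delta>4 ab(1-5) by blast
qed

text \<open>Some leaf face is removed. If no leaf allows the colouring of the rest to be extended, all leaves are
  blocked, and the polygon is exceptional or contains the configuration of three vertices that are removed together.\<close>

theorem polygon_colourable:
  assumes "polygon S" "\<And>v. v \<in> S \<Longrightarrow> deg S v \<le> \<Delta>" "2 \<le> \<Delta>" "\<not> exceptional \<Delta> S"
  shows "\<exists>col. proper_on S (Suc \<Delta>) col"
  using assms
proof (induction "card S" arbitrary: S rule: less_induct)
  case less
  note S = less.prems(1) and deg = less.prems(2) and \<Delta> = less.prems(3)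
  note D = polygonD[OF S]
  have IH: "\<exists>col. proper_on (S - {a<..<b}) (Suc \<Delta>) col"
    if "a \<in> S" "b \<in> S" "a < b" "E a b" "S \<inter> {a<..<b} \<noteq> {}" "\<not> exceptional \<Delta> (S - {a<..<b})" for a b
  proof (rule less.hyps)
    show "card (S - {a<..<b}) < card S" using D(1) that(5) by (intro psubset_card_mono) auto
    show "polygon (S - {a<..<b})" by (rule polygon_remove_interior[OF S that(1-4)])
    show "deg (S - {a<..<b}) v \<le> \<Delta>" if "v \<in> S - {a<..<b}" for v
      using deg_mono[OF D(1), of "S - {a<..<b}" v] deg[of v] that by fastforce
  qed (use \<Delta> that in auto)
  show ?case
  proof (cases "card S = 2")
    case True
    then have "proper_on S (Suc \<Delta>) (\<lambda>_. 0)"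
      unfolding proper_on_def conf_def by (metis edges_on_card_two zero_less_Suc)
    then show ?thesis by blast
  next
    case False
    then have c3: "3 \<le> card S" using D(2) by linarith
    show ?thesis
    proof (rule ccontr)
      assume no: "\<not> ?thesis"
      have blocked: "blocked \<Delta> S a b" if h: "leaf S a b" "\<not> exceptional \<Delta> (S - {a<..<b})" for a b
      proof -
        obtain col where "proper_on (S - {a<..<b}) (Suc \<Delta>) col"
          using IH[of a b] h unfolding leaf_def by blast
        then show ?thesis using leaf_extend_or_blocked[OF S h(1) _ deg \<Delta> no] by blast
      qed
      consider "\<Delta> = 2" | "\<Delta> = 3" | "4 \<le> \<Delta>" using \<Delta> by linarith
      then show False
      proof cases
        case 1
        then have "card S = 4" using blocked_degree_two[OF S c3] deg blocked by blast
        then show False using less.prems(4) 1 unfolding exceptional_def by blast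
      next
        case 2
        then have "card S = 4 \<and> (\<exists>v\<in>S. deg S v = 3)" using blocked_degree_three[OF S c3] deg blocked by blast
        then show False using less.prems(4) 2 unfolding exceptional_def by blast
      next
        case 3
        then have nex: "\<not> exceptional \<Delta> T" for T unfolding exceptional_def by simp
        obtain a b x j z where \<Delta>4: "\<Delta> = 4" and ab: "a \<in> S" "b \<in> S" "a < b" "E a b" "S \<inter> {a<..<b} \<noteq> {}"
          and gd: "gadget S (S - {a<..<b}) a x j z b"
          using blocked_large_degree[OF S c3 3 blocked[OF _ nex]] by blast
        obtain col where "proper_on (S - {a<..<b}) (Suc \<Delta>) col" using IH[OF ab nex] by blast
        then have "\<exists>col. proper_on S 5 col"
          using gadget_colourable[OF gd] deg \<Delta>4 by (simp add: numeral_eq_Suc)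
        then show False using no \<Delta>4 by (simp add: numeral_eq_Suc)
      qed
    qed
  qed
qed

section \<open>Cliques of conflicting edges\<close>

definition conf_clique :: "nat set \<Rightarrow> nat set set \<Rightarrow> bool" where
  "conf_clique S K \<longleftrightarrow> K \<subseteq> edges_on S \<and> (\<forall>e\<in>K. \<forall>f\<in>K. e \<noteq> f \<longrightarrow> conf e f)"

lemma card_star_le:
  assumes "finite S" "K \<subseteq> edges_on S" "\<And>f. f \<in> K \<Longrightarrow> i \<in> f"
  shows "card K \<le> deg S i"
proof -
  have "card K \<le> card {f \<in> edges_on S. i \<in> f}"
    using assms finite_edges_on[OF assms(1)] by (intro card_mono) auto
  then show ?thesis using card_edges_at_le[OF assms(1), of i] by simp
qed

lemma at_most_one_common_neighbour:
  assumes "E i x" "E j x" "i \<noteq> j" and "finite W" "\<And>w. w \<in> W \<Longrightarrow> E i w \<and> E j w \<and> w \<noteq> x"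
  shows "card W \<le> 1"
proof -
  have "w = w'" if "w \<in> W" "w' \<in> W" for w w'
    using common_neighbours_at_most_two[of i x j w w'] assms(1-3) assms(5)[OF that(1)] assms(5)[OF that(2)] by blast
  then show ?thesis
    using assms(4) by (subst card_le_Suc0_iff_eq[unfolded One_nat_def[symmetric]]) auto
qed

text \<open>Besides the star of \<open>i\<close>, a clique through the new edge \<open>ix\<close> can only contain \<open>jx\<close> and the edge from \<open>j\<close> to
  the second common neighbour \<open>y\<close> of \<open>i\<close> and \<open>j\<close>. If one of these occurs, few edges of the star remain, and the clique
  has at most five elements.\<close>

lemma clique_at_triangle_ear:
  assumes t: "triangle_ear S T i x j" and K: "conf_clique S K" and ix: "{i, x} \<in> K"
    and deg: "deg S i \<le> \<Delta>" and \<Delta>: "5 \<le> \<Delta>"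
  shows "card K \<le> \<Delta>"
proof -
  have fT: "finite T" and SI: "S = insert x T" and xT: "x \<notin> T" "i \<in> T" "j \<in> T" "i \<noteq> j"
    and adj: "E i j" "E x i" "E x j" and nx: "\<forall>u\<in>S. E x u \<longrightarrow> u = i \<or> u = j"
    using t unfolding triangle_ear_def by - (elim conjE, assumption)+
  have fS: "finite S" using fT SI by simp
  have Kc: "conf e f" if "e \<in> K" "f \<in> K" "e \<noteq> f" for e f using K that unfolding conf_clique_def by blast
  have KE: "f \<in> edges_on S" if "f \<in> K" for f using K that unfolding conf_clique_def by blast
  define Y where "Y = {y \<in> T. E i y \<and> E j y}"
  have fY: "finite Y" using fT unfolding Y_def by simp
  have cY: "card Y \<le> 1"
    by (rule at_most_one_common_neighbour[of i x j]) (use adj adj_sym xT fY in \<open>auto simp: Y_def\<close>)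
  have R: "f = {i, x} \<or> f = {j, x} \<or> f \<in> edges_on T \<and> (i \<in> f \<or> (\<exists>y\<in>Y. f = {j, y}))" if f: "f \<in> K" for f
  proof (cases "f = {i, x}")
    case False
    then have "conf {i, x} f" using Kc[OF ix f] by simp
    from triangle_ear_conf[OF t KE[OF f] this] show ?thesis unfolding Y_def edges_on_def by blast
  qed simp
  show ?thesis
  proof (cases "{j, x} \<in> K")
    case True
    have R': "f = {i, x} \<or> f = {j, x} \<or> f \<in> edges_on T \<and> (j \<in> f \<or> (\<exists>y\<in>Y. f = {i, y}))" if f: "f \<in> K" for f
    proof (cases "f = {j, x}")
      case False
      then have "conf {j, x} f" using Kc[OF True f] by simp
      from triangle_ear_conf[OF triangle_ear_sym[OF t] KE[OF f] this] show ?thesis unfolding Y_def edges_on_def by blast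
    qed simp
    have "K \<subseteq> {{i, x}, {j, x}, {i, j}} \<union> (\<lambda>y. {i, y}) ` Y \<union> (\<lambda>y. {j, y}) ` Y"
    proof
      fix f assume f: "f \<in> K"
      from R[OF f] R'[OF f] consider "f = {i, x}" | "f = {j, x}" | "f \<in> edges_on T" "i \<in> f" "j \<in> f"
        | y where "y \<in> Y" "f = {i, y}" | y where "y \<in> Y" "f = {j, y}" by blast
      then show "f \<in> {{i, x}, {j, x}, {i, j}} \<union> (\<lambda>y. {i, y}) ` Y \<union> (\<lambda>y. {j, y}) ` Y"
      proof cases
        case 3
        then obtain u where "f = {i, u}" by (metis edges_on_at)
        then have "f = {i, j}" using 3 xT(4) by auto
        then show ?thesis by simp
      qed simp_all
    qed
    then have "card K \<le> card ({{i, x}, {j, x}, {i, j}} \<union> (\<lambda>y. {i, y}) ` Y \<union> (\<lambda>y. {j, y}) ` Y)"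
      using fY by (intro card_mono) simp_all
    also have "\<dots> \<le> card {{i, x}, {j, x}, {i, j}} + card ((\<lambda>y. {i, y}) ` Y) + card ((\<lambda>y. {j, y}) ` Y)"
      by (meson add_le_mono card_Un_le le_refl le_trans)
    also have "\<dots> \<le> 3 + 1 + 1"
      using cY card_image_le[OF fY, of "\<lambda>y. {i, y}"] card_image_le[OF fY, of "\<lambda>y. {j, y}"]
        card_length[of "[{i, x}, {j, x}, {i, j}]"]
      by (intro add_mono) simp_all
    finally show ?thesis using \<Delta> by simp
  next
    case nj: False
    show ?thesis
    proof (cases "\<exists>y\<in>Y. {j, y} \<in> K")
      case False
      have "i \<in> f" if "f \<in> K" for f using R[OF that] nj False that by blast
      then have "card K \<le> deg S i" using K fS unfolding conf_clique_def by (intro card_star_le) auto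
      then show ?thesis using deg by simp
    next
      case True
      then obtain y where y: "y \<in> Y" "{j, y} \<in> K" by blast
      then have y': "y \<in> T" "E i y" "E j y" unfolding Y_def by simp_all
      have yne: "y \<noteq> i" "y \<noteq> j" "y \<noteq> x" using y' adj_irrefl xT(1) by blast+
      have Yy: "y' = y" if "y' \<in> Y" for y'
        using cY fY that y(1) card_le_Suc0_iff_eq[OF fY] by simp
      define W where "W = {w \<in> S. E i w \<and> E y w \<and> w \<noteq> j}"
      have fW: "finite W" using fS unfolding W_def by simp
      have cW: "card W \<le> 1"
        by (rule at_most_one_common_neighbour[of i j y]) (use adj adj_sym y' yne fW in \<open>auto simp: W_def\<close>)
      have "K \<subseteq> {{i, x}, {i, j}, {i, y}, {j, y}} \<union> (\<lambda>w. {i, w}) ` W"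
      proof
        fix f assume f: "f \<in> K"
        show "f \<in> {{i, x}, {i, j}, {i, y}, {j, y}} \<union> (\<lambda>w. {i, w}) ` W"
        proof (cases "i \<in> f \<and> f \<noteq> {i, x}")
          case False
          then have "f = {i, x} \<or> f = {j, y}" using R[OF f] f nj Yy by blast
          then show ?thesis by (elim disjE) simp_all
        next
          case True
          then obtain w where w: "f = {i, w}" "w \<in> S" "E i w" using KE[OF f] by (metis edges_on_at)
          show ?thesis
          proof (cases "w = j \<or> w = y")
            case False
            have jf: "j \<notin> f" "y \<notin> f" using w xT(4) yne False by auto
            then have "conf {j, y} f" using Kc[OF y(2) f] by blast
            from conf_pairD[OF this] jf have "\<exists>c d. f = {c, d} \<and> distinct [j, y, c, d] \<and> E y c \<and> E c d \<and> E d j"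
              by (elim disjE) simp_all
            then obtain c d where cd: "f = {c, d}" "E y c" "E c d" "E d j" by (elim exE conjE)
            have "{i, w} = {c, d}" using w(1) cd(1) by simp
            then have "c = i \<and> d = w \<or> c = w \<and> d = i" unfolding doubleton_eq_iff by blast
            then consider "c = i" "d = w" | "c = w" "d = i" by blast
            then have "w \<in> W"
            proof cases
              case 1
              have wx: "w \<noteq> x" using True w by blast
              show ?thesis
                using common_neighbours_at_most_two[of i x j y w] adj(2,3)[THEN adj_sym] y'(2,3) w(3)
                  adj_sym[OF cd(4)[unfolded 1]] xT(4) yne(3) wx False by auto
            next
              case 2
              then show ?thesis unfolding W_def using w cd False by simp
            qed
            then show ?thesis using w by simp
          qed (use w in auto)
        qed
      qed
      then have "card K \<le> card ({{i, x}, {i, j}, {i, y}, {j, y}} \<union> (\<lambda>w. {i, w}) ` W)"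
        using fW by (intro card_mono) simp_all
      also have "\<dots> \<le> card {{i, x}, {i, j}, {i, y}, {j, y}} + card ((\<lambda>w. {i, w}) ` W)" by (rule card_Un_le)
      also have "\<dots> \<le> 4 + 1"
        using cW card_image_le[OF fW, of "\<lambda>w. {i, w}"] card_length[of "[{i, x}, {i, j}, {i, y}, {j, y}]"]
        by (intro add_mono) simp_all
      finally show ?thesis using \<Delta> by simp
    qed
  qed
qed

lemma clique_at_quad_ear:
  assumes t: "quad_ear S T i x z j" and K: "conf_clique S K" and ix: "{i, x} \<in> K" and nxz: "{x, z} \<notin> K"
    and deg: "deg S i \<le> \<Delta>" and \<Delta>: "5 \<le> \<Delta>"
  shows "card K \<le> \<Delta>"
proof -
  have fS: "finite S" "i \<noteq> j" using t unfolding quad_ear_def by auto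
  have Kc: "conf e f" if "e \<in> K" "f \<in> K" "e \<noteq> f" for e f using K that unfolding conf_clique_def by blast
  have KE: "f \<in> edges_on S" if "f \<in> K" for f using K that unfolding conf_clique_def by blast
  have R: "f = {i, x} \<or> f = {j, z} \<or> f \<in> edges_on T \<and> i \<in> f" if f: "f \<in> K" for f
  proof (cases "f = {i, x}")
    case False
    then have "conf {i, x} f" using Kc[OF ix f] by simp
    from quad_ear_conf_end[OF t KE[OF f] this] show ?thesis using nxz f by blast
  qed simp
  show ?thesis
  proof (cases "{j, z} \<in> K")
    case True
    have "K \<subseteq> {{i, x}, {j, z}, {i, j}}"
    proof
      fix f assume f: "f \<in> K"
      show "f \<in> {{i, x}, {j, z}, {i, j}}"
      proof (cases "f = {i, x} \<or> f = {j, z}")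
        case False
        then have fi: "f \<in> edges_on T" "i \<in> f" using R[OF f] by blast+
        have "conf {j, z} f" using Kc[OF True f] False by blast
        from quad_ear_conf_end[OF quad_ear_sym[OF t] KE[OF f] this]
        have "j \<in> f" using False nxz f by (metis insert_commute)
        moreover obtain u where "f = {i, u}" using fi by (metis edges_on_at)
        ultimately have "f = {i, j}" using fS(2) by auto
        then show ?thesis by simp
      qed (elim disjE; simp)
    qed
    then have "card K \<le> card {{i, x}, {j, z}, {i, j}}" by (intro card_mono) simp_all
    also have "\<dots> \<le> 3" using card_length[of "[{i, x}, {j, z}, {i, j}]"] by simp
    finally show ?thesis using \<Delta> by simp
  next
    case False
    have "i \<in> f" if "f \<in> K" for f using R[OF that] False that by blast
    then have "card K \<le> deg S i" using K fS unfolding conf_clique_def by (intro card_star_le) auto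
    then show ?thesis using deg by simp
  qed
qed

text \<open>The edges of the ear are in conflict with their neighbours only. A clique that also contains an edge \<open>g\<close> off the ear
  meets the ear in a single end edge, and then lies in the star of that end.\<close>

lemma clique_at_path_ear:
  assumes p: "path_ear S T v m" and K: "conf_clique S K" and t: "t < m" "{v t, v (Suc t)} \<in> K"
    and deg: "deg S (v 0) \<le> \<Delta>" "deg S (v m) \<le> \<Delta>" and \<Delta>: "5 \<le> \<Delta>"
  shows "card K \<le> \<Delta>"
proof -
  note D = path_earD[OF p]
  have fS: "finite S" by (rule path_ear_deg(3)[OF p])
  let ?e = "\<lambda>t. {v t, v (Suc t)}"
  have Kc: "conf e f" if "e \<in> K" "f \<in> K" "e \<noteq> f" for e f using K that unfolding conf_clique_def by blast
  have KE: "f \<in> edges_on S" if "f \<in> K" for f using K that unfolding conf_clique_def by blast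
  have R: "f = ?e s \<or> (\<exists>r<m. f = ?e r \<and> (r = Suc s \<or> s = Suc r)) \<or>
     f \<in> edges_on T \<and> (s = 0 \<and> v 0 \<in> f \<or> Suc s = m \<and> v m \<in> f)" if "f \<in> K" "s < m" "?e s \<in> K" for f s
  proof (cases "f = ?e s")
    case False
    then have "conf (?e s) f" using Kc[OF that(3,1)] by simp
    from path_ear_conf[OF p that(2) KE[OF that(1)] this] show ?thesis by blast
  qed simp
  show ?thesis
  proof (cases "K \<inter> edges_on T = {}")
    case True
    have "K \<subseteq> {?e t, ?e (Suc t), ?e (t - 1)}"
    proof
      fix f assume f: "f \<in> K"
      then have "f = ?e t \<or> (\<exists>r<m. f = ?e r \<and> (r = Suc t \<or> t = Suc r))"
        using R[OF f t] True by blast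
      then show "f \<in> {?e t, ?e (Suc t), ?e (t - 1)}" by auto
    qed
    then have "card K \<le> card {?e t, ?e (Suc t), ?e (t - 1)}" by (intro card_mono) simp_all
    also have "\<dots> \<le> 3" using card_length[of "[?e t, ?e (Suc t), ?e (t - 1)]"] by simp
    finally show ?thesis using \<Delta> by simp
  next
    case False
    then obtain g where g: "g \<in> K" "g \<in> edges_on T" by blast
    have nT: "?e s \<notin> edges_on T" if "s < m" for s
    proof (cases "s = 0")
      case True
      then show ?thesis using D(6)[of 1] D(2) by (simp add: pair_in_edges_on)
    next
      case False
      then show ?thesis using D(6)[of s] that by (simp add: pair_in_edges_on)
    qed
    have ends: "s = 0 \<and> v 0 \<in> g \<or> Suc s = m \<and> v m \<in> g" if "s < m" "?e s \<in> K" for s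
      using R[OF g(1) that] nT g(2) that(1) by blast
    have only: "f \<in> edges_on T \<and> (t = 0 \<and> v 0 \<in> f \<or> Suc t = m \<and> v m \<in> f)" if f: "f \<in> K" "f \<noteq> ?e t" for f
    proof -
      have "\<not> (\<exists>r<m. f = ?e r \<and> (r = Suc t \<or> t = Suc r))"
      proof
        assume "\<exists>r<m. f = ?e r \<and> (r = Suc t \<or> t = Suc r)"
        then obtain r where r: "r < m" "f = ?e r" "r = Suc t \<or> t = Suc r" by blast
        then have "r = 0 \<or> Suc r = m" using ends f(1) by blast
        moreover have "t = 0 \<or> Suc t = m" using ends t by blast
        ultimately show False using r(3) D(2) by auto
      qed
      then show ?thesis using R[OF f(1) t] f(2) by blast
    qed
    \<comment> \<open>Since \<open>m \<ge> 4\<close>, the edge in the clique is at one end of the ear only.\<close>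
    from ends[OF t] show ?thesis
    proof
      assume t0: "t = 0 \<and> v 0 \<in> g"
      then have "Suc t \<noteq> m" using D(2) by simp
      then have "v 0 \<in> f" if "f \<in> K" for f using only[OF that] t0 by (cases "f = ?e t") auto
      then have "card K \<le> deg S (v 0)" using K fS unfolding conf_clique_def by (intro card_star_le) auto
      then show ?thesis using deg by simp
    next
      assume tm: "Suc t = m \<and> v m \<in> g"
      then have "t \<noteq> 0" using D(2) by simp
      then have "v m \<in> f" if "f \<in> K" for f using only[OF that] tm by (cases "f = ?e t") auto
      then have "card K \<le> deg S (v m)" using K fS unfolding conf_clique_def by (intro card_star_le) auto
      then show ?thesis using deg by simp
    qed
  qed
qed

theorem polygon_clique_bound:
  assumes "polygon S" "\<And>v. v \<in> S \<Longrightarrow> deg S v \<le> \<Delta>" "5 \<le> \<Delta>" "conf_clique S K"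
  shows "card K \<le> \<Delta>"
  using assms
proof (induction "card S" arbitrary: S rule: less_induct)
  case less
  note S = less.prems(1) and deg = less.prems(2) and \<Delta> = less.prems(3) and K = less.prems(4)
  note D = polygonD[OF S]
  have KE: "K \<subseteq> edges_on S" using K unfolding conf_clique_def by blast
  have Kc: "conf e f" if "e \<in> K" "f \<in> K" "e \<noteq> f" for e f using K that unfolding conf_clique_def by blast
  show ?case
  proof (cases "card S = 2")
    case True
    then have "K \<subseteq> {S}" using KE edges_on_card_two by blast
    then have "card K \<le> 1" using card_mono[of "{S}" K] by simp
    then show ?thesis using \<Delta> by simp
  next
    case False
    then have c3: "3 \<le> card S" using D(2) by linarith
    then obtain a b where l: "leaf S a b" using polygon_has_leaf[OF S] by blast
    let ?T = "S - {a<..<b}"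
    have ab: "a \<in> S" "b \<in> S" using l unfolding leaf_def by auto
    have IH: "card K \<le> \<Delta>" if "K \<subseteq> edges_on ?T"
    proof (rule less.hyps[OF polygon_smaller(2,1)[OF S l] _ \<Delta>])
      show "deg ?T v \<le> \<Delta>" if "v \<in> ?T" for v
        using deg_mono[OF D(1), of ?T v] deg[of v] that by fastforce
      show "conf_clique ?T K" using that Kc unfolding conf_clique_def by blast
    qed
    show ?thesis
    proof (cases rule: leaf_cases[OF S l])
      case (1 x)
      note t = 1(1)
      consider "K \<subseteq> edges_on ?T" | "{a, x} \<in> K" | "{b, x} \<in> K"
        using KE triangle_ear_edges[OF t] by blast
      then show ?thesis
        using IH clique_at_triangle_ear[OF t K _ deg[OF ab(1)] \<Delta>]
          clique_at_triangle_ear[OF triangle_ear_sym[OF t] K _ deg[OF ab(2)] \<Delta>] by cases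
    next
      case (2 x z)
      note t = 2(1) and t' = quad_ear_sym[OF 2(1)]
      have zx: "{z, x} = {x, z}" by auto
      consider (T) "K \<subseteq> edges_on ?T" | (mid) "{x, z} \<in> K" | (l) "{x, z} \<notin> K" "{a, x} \<in> K"
        | (r) "{x, z} \<notin> K" "{b, z} \<in> K"
        using KE quad_ear_edges[OF t] by blast
      then show ?thesis
      proof cases
        case T
        then show ?thesis by (rule IH)
      next
        case mid
        have "K \<subseteq> {{x, z}, {a, x}, {b, z}, {a, b}}"
        proof
          fix f assume f: "f \<in> K"
          show "f \<in> {{x, z}, {a, x}, {b, z}, {a, b}}"
          proof (cases "f = {x, z}")
            case False
            then have "conf {x, z} f" using Kc[OF mid f] by simp
            moreover have "f \<in> edges_on S" using KE f by blast
            ultimately show ?thesis using quad_ear_conf_middle[OF t] by blast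
          qed simp
        qed
        then have "card K \<le> card {{x, z}, {a, x}, {b, z}, {a, b}}" by (intro card_mono) simp_all
        also have "\<dots> \<le> 4" using card_length[of "[{x, z}, {a, x}, {b, z}, {a, b}]"] by simp
        finally show ?thesis using \<Delta> by simp
      next
        case l
        then show ?thesis using clique_at_quad_ear[OF t K _ _ deg[OF ab(1)] \<Delta>] by simp
      next
        case r
        then show ?thesis using clique_at_quad_ear[OF t' K _ _ deg[OF ab(2)] \<Delta>] zx by simp
      qed
    next
      case (3 v m)
      show ?thesis
      proof (cases "K \<subseteq> edges_on ?T")
        case True
        then show ?thesis by (rule IH)
      next
        case False
        then obtain t where t: "t < m" "{v t, v (Suc t)} \<in> K"
          using KE path_ear_edges[OF 3(1)] by blast
        have "deg S (v 0) \<le> \<Delta>" "deg S (v m) \<le> \<Delta>" using deg ab 3(2,3) by simp_all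
        then show ?thesis using clique_at_path_ear[OF 3(1) K t _ _ \<Delta>] by simp
      qed
    qed
  qed
qed

end

section \<open>Outerplane graphs are polygons\<close>

abbreviation adj :: "'a sgraph \<Rightarrow> 'a \<Rightarrow> 'a \<Rightarrow> bool" where
  "adj G u v \<equiv> {u, v} \<in> edges G"

definition vpath :: "'a sgraph \<Rightarrow> 'a list \<Rightarrow> bool" where
  "vpath G xs \<longleftrightarrow> distinct xs \<and> set xs \<subseteq> verts G \<and> successively (adj G) xs"

fun path_edges :: "'a list \<Rightarrow> 'a set set" where
  "path_edges (x # y # zs) = insert {x, y} (path_edges (y # zs))"
| "path_edges xs = {}"

lemma path_edges_append: "path_edges (xs @ y # zs) = path_edges (xs @ [y]) \<union> path_edges (y # zs)"
proof (induction xs)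
  case (Cons x xs)
  then show ?case by (cases xs) auto
qed (cases zs, auto)

lemma path_edges_subset: "e \<in> path_edges xs \<Longrightarrow> e \<subseteq> set xs"
  by (induction xs rule: path_edges.induct) auto

lemma path_edges_card: "distinct xs \<Longrightarrow> e \<in> path_edges xs \<Longrightarrow> card e = 2"
  by (induction xs rule: path_edges.induct) auto

lemma path_edges_in_edges: "successively (adj G) xs \<Longrightarrow> path_edges xs \<subseteq> edges G"
  by (induction xs rule: path_edges.induct) auto

lemma path_edges_cover: "2 \<le> length xs \<Longrightarrow> v \<in> set xs \<Longrightarrow> \<exists>e\<in>path_edges xs. v \<in> e"
proof (induction xs rule: path_edges.induct)
  case (1 x y zs)
  then show ?case by (cases zs) auto
qed auto

lemma ends_not_path_edge:
  assumes "distinct xs" "3 \<le> length xs" shows "{hd xs, last xs} \<notin> path_edges xs"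
proof -
  obtain x y zs where "xs = x # y # zs"
    using assms(2) by (cases xs rule: path_edges.cases) auto
  with assms(2) have xs: "xs = x # y # zs" "zs \<noteq> []" by auto
  have "last zs \<in> set zs" using xs by simp
  then have "last zs \<noteq> y" "last zs \<noteq> x" using assms(1) xs by auto
  moreover have "{x, last zs} \<notin> path_edges (y # zs)"
    using path_edges_subset[of "{x, last zs}" "y # zs"] assms(1) xs by auto
  ultimately show ?thesis using xs by (auto simp: doubleton_eq_iff)
qed

lemma path_edges_disjoint:
  assumes "distinct xs" "3 \<le> length xs" "set xs \<inter> set ys \<subseteq> {hd xs, last xs}"
  shows "path_edges xs \<inter> path_edges ys = {}"
proof (rule ccontr)
  assume "\<not> ?thesis"
  then obtain e where e: "e \<in> path_edges xs" "e \<in> path_edges ys" by blast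
  then have "e \<subseteq> {hd xs, last xs}" "card e = 2"
    using path_edges_subset[OF e(1)] path_edges_subset[OF e(2)] path_edges_card[OF assms(1) e(1)] assms(3) by auto
  moreover have "card {hd xs, last xs} \<le> 2" by (simp add: card_insert_if)
  ultimately have "e = {hd xs, last xs}" by (intro card_seteq) auto
  then show False using e ends_not_path_edge[OF assms(1,2)] by simp
qed

text \<open>The list may run in either direction, so that both halves of a cycle are paths between the same two
  vertices.\<close>

definition path_between :: "'a sgraph \<Rightarrow> 'a \<Rightarrow> 'a \<Rightarrow> 'a list \<Rightarrow> bool" where
  "path_between G a b xs \<longleftrightarrow> vpath G xs \<and> 2 \<le> length xs \<and>
     (hd xs = a \<and> last xs = b \<or> hd xs = b \<and> last xs = a)"

lemma path_between_interior:
  assumes "path_between G a b xs" "3 \<le> length xs"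
  obtains x where "x \<in> set xs" "x \<noteq> a" "x \<noteq> b"
proof -
  have "card (set xs) = length xs" using assms unfolding path_between_def vpath_def by (simp add: distinct_card)
  moreover have "card {a, b} \<le> 2" by (simp add: card_insert_if)
  ultimately have "\<not> set xs \<subseteq> {a, b}" using assms(2) card_mono[of "{a, b}" "set xs"] by auto
  then show ?thesis using that by blast
qed

lemma arc_between_join:
  assumes "arc_between a b P" "arc_between b c Q" "P \<inter> Q = {b}"
  shows "arc_between a c (P \<union> Q)"
proof -
  obtain g where g: "arc g" "pathstart g = a" "pathfinish g = b" "path_image g = P"
    using assms unfolding arc_between_def by blast
  obtain h where h: "arc h" "pathstart h = b" "pathfinish h = c" "path_image h = Q"
    using assms unfolding arc_between_def by blast
  have "arc (g +++ h)" by (rule arc_join) (use g h assms(3) in auto)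
  moreover have "path_image (g +++ h) = P \<union> Q" using g h by (simp add: path_image_join)
  ultimately show ?thesis unfolding arc_between_def using g h by (metis pathfinish_join pathstart_join)
qed

lemma successively_overlap:
  "successively P (xs @ y # zs) \<longleftrightarrow> successively P (xs @ [y]) \<and> successively P (y # zs)"
  by (auto simp: successively_append_iff)

locale outerplane_graph =
  fixes G :: "'a sgraph" and p :: "'a \<Rightarrow> complex" and \<gamma> :: "'a set \<Rightarrow> real \<Rightarrow> complex" and F
  assumes simple: "simple_graph G" and emb: "plane_embedding G p \<gamma>"
    and face: "F \<in> faces G p \<gamma>" and outer: "p ` verts G \<subseteq> frontier F"
begin

definition drawing :: "'a list \<Rightarrow> complex set" where
  "drawing xs = (\<Union>e\<in>path_edges xs. path_image (\<gamma> e))"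

lemma inj_p: "inj_on p (verts G)"
  using emb unfolding plane_embedding_def by blast

lemma edge_card: "e \<in> edges G \<Longrightarrow> card e = 2" "e \<in> edges G \<Longrightarrow> e \<subseteq> verts G"
  using simple unfolding simple_graph_def by auto

lemma edge_arc:
  assumes "{u, v} \<in> edges G" shows "arc_between (p u) (p v) (path_image (\<gamma> {u, v}))"
proof -
  have a: "arc (\<gamma> {u, v})" "{pathstart (\<gamma> {u, v}), pathfinish (\<gamma> {u, v})} = {p u, p v}"
    using assms emb unfolding plane_embedding_def by auto
  then have "pathstart (\<gamma> {u, v}) = p u \<and> pathfinish (\<gamma> {u, v}) = p v \<or>
      pathstart (\<gamma> {u, v}) = p v \<and> pathfinish (\<gamma> {u, v}) = p u" by (simp add: doubleton_eq_iff)
  then show ?thesis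
    using a(1) arc_between_sym unfolding arc_between_def by metis
qed

lemma edges_meet: "e \<in> edges G \<Longrightarrow> f \<in> edges G \<Longrightarrow> e \<noteq> f \<Longrightarrow>
    path_image (\<gamma> e) \<inter> path_image (\<gamma> f) = p ` (e \<inter> f)"
  using emb unfolding plane_embedding_def by blast

lemma vertex_on_edge:
  assumes "e \<in> edges G" "v \<in> e" shows "p v \<in> path_image (\<gamma> e)"
  using assms emb unfolding plane_embedding_def by blast

lemma vertex_in_drawing:
  assumes "vpath G xs" "2 \<le> length xs" "v \<in> set xs" shows "p v \<in> drawing xs"
  using path_edges_cover[OF assms(2,3)] path_edges_in_edges vertex_on_edge assms(1)
  unfolding drawing_def vpath_def by blast

lemma drawing_inter_subset:
  assumes "vpath G xs" "vpath G ys" "path_edges xs \<inter> path_edges ys = {}"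
  shows "drawing xs \<inter> drawing ys \<subseteq> p ` (set xs \<inter> set ys)"
proof
  fix z assume "z \<in> drawing xs \<inter> drawing ys"
  then obtain e f where ef: "e \<in> path_edges xs" "f \<in> path_edges ys" "z \<in> path_image (\<gamma> e)" "z \<in> path_image (\<gamma> f)"
    unfolding drawing_def by blast
  then have "e \<in> edges G" "f \<in> edges G" "e \<noteq> f"
    using assms path_edges_in_edges unfolding vpath_def by blast+
  then have "z \<in> p ` (e \<inter> f)" using edges_meet ef by blast
  then show "z \<in> p ` (set xs \<inter> set ys)" using path_edges_subset ef by blast
qed

lemma drawing_inter:
  assumes "vpath G xs" "vpath G ys" "2 \<le> length xs" "2 \<le> length ys" "path_edges xs \<inter> path_edges ys = {}"
  shows "drawing xs \<inter> drawing ys = p ` (set xs \<inter> set ys)"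
  using drawing_inter_subset[OF assms(1,2,5)] vertex_in_drawing[OF assms(1,3)] vertex_in_drawing[OF assms(2,4)]
  by blast

lemma drawing_arc:
  assumes "vpath G xs" "2 \<le> length xs"
  shows "arc_between (p (hd xs)) (p (last xs)) (drawing xs)"
  using assms
proof (induction xs rule: path_edges.induct)
  case (1 x y zs)
  have e: "{x, y} \<in> edges G" using 1(2) unfolding vpath_def by simp
  have A: "arc_between (p x) (p y) (path_image (\<gamma> {x, y}))" by (rule edge_arc[OF e])
  show ?case
  proof (cases "zs = []")
    case True
    then show ?thesis using A unfolding drawing_def by simp
  next
    case False
    have v: "vpath G (y # zs)" "vpath G [x, y]" using 1(2) unfolding vpath_def by auto
    have l: "2 \<le> length (y # zs)" using False by (cases zs) auto
    have B: "arc_between (p y) (p (last (y # zs))) (drawing (y # zs))" using 1(1)[OF v(1) l] by simp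
    have "x \<notin> set (y # zs)" using 1(2) unfolding vpath_def by auto
    then have "path_edges [x, y] \<inter> path_edges (y # zs) = {}" using path_edges_subset by fastforce
    from drawing_inter[OF v(2,1) _ l this] \<open>x \<notin> set (y # zs)\<close>
    have "path_image (\<gamma> {x, y}) \<inter> drawing (y # zs) = {p y}" unfolding drawing_def by auto
    from arc_between_join[OF A B this] show ?thesis unfolding drawing_def by simp
  qed
qed auto

lemma path_between_arc:
  assumes "path_between G a b xs" shows "arc_between (p a) (p b) (drawing xs)"
  using assms drawing_arc[of xs] arc_between_sym unfolding path_between_def by blast

lemma theta_of_paths:
  assumes P: "path_between G a b xs" "3 \<le> length xs" and Q: "path_between G a b ys" "3 \<le> length ys"
    and R: "path_between G a b zs"
    and int: "set xs \<inter> set ys = {a, b}" "set xs \<inter> set zs = {a, b}" "set ys \<inter> set zs = {a, b}"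
  shows "theta (p a) (p b) (drawing xs) (drawing ys) (drawing zs)"
proof -
  have d: "path_edges xs \<inter> path_edges ys = {}" "path_edges xs \<inter> path_edges zs = {}" "path_edges ys \<inter> path_edges zs = {}"
    using path_edges_disjoint[of xs ys] path_edges_disjoint[of xs zs] path_edges_disjoint[of ys zs] P Q R int
    unfolding path_between_def vpath_def by auto
  have "drawing xs \<inter> drawing ys = {p a, p b}" "drawing xs \<inter> drawing zs = {p a, p b}" "drawing ys \<inter> drawing zs = {p a, p b}"
    using drawing_inter[of xs ys] drawing_inter[of xs zs] drawing_inter[of ys zs] P Q R d int
    unfolding path_between_def by auto
  then show ?thesis unfolding theta_def using path_between_arc P(1) Q(1) R by blast
qed

lemma face_connected: "connected F"
  using face unfolding faces_def by (rule in_components_connected)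

lemma face_avoids_drawing:
  assumes "vpath G xs" shows "F \<inter> drawing xs = {}"
proof -
  have "F \<subseteq> - (p ` verts G \<union> (\<Union>e\<in>edges G. path_image (\<gamma> e)))"
    using face unfolding faces_def by (rule in_components_subset)
  then show ?thesis using assms path_edges_in_edges[of G xs] unfolding drawing_def vpath_def by blast
qed

lemma vertex_in_face_closure: "v \<in> verts G \<Longrightarrow> p v \<in> closure F"
  using outer unfolding frontier_def by blast

lemma inner_vertex_image:
  assumes "path_between G a b xs" "x \<in> set xs" "x \<noteq> a" "x \<noteq> b"
  shows "p x \<in> drawing xs - {p a, p b}"
proof -
  have h: "vpath G xs" "2 \<le> length xs" "xs \<noteq> []" "a = hd xs \<or> a = last xs" "b = hd xs \<or> b = last xs"
    using assms(1) unfolding path_between_def by auto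
  then have "a \<in> set xs" "b \<in> set xs" by auto
  then have "a \<in> verts G" "b \<in> verts G" "x \<in> verts G" using h(1) assms(2) unfolding vpath_def by auto
  then have "p x \<noteq> p a" "p x \<noteq> p b" using inj_p assms(3,4) by (auto dest: inj_onD)
  then show ?thesis using vertex_in_drawing[OF h(1,2) assms(2)] by simp
qed

text \<open>The three paths form a theta curve, and each has an inner vertex in the closure of \<open>F\<close>.\<close>

lemma no_three_long_paths:
  assumes P: "path_between G a b xs" "3 \<le> length xs" and Q: "path_between G a b ys" "3 \<le> length ys"
    and R: "path_between G a b zs" "3 \<le> length zs"
    and int: "set xs \<inter> set ys = {a, b}" "set xs \<inter> set zs = {a, b}" "set ys \<inter> set zs = {a, b}"
  shows False
proof -
  obtain x where x: "x \<in> set xs" "x \<noteq> a" "x \<noteq> b" using path_between_interior[OF P] .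
  obtain y where y: "y \<in> set ys" "y \<noteq> a" "y \<noteq> b" using path_between_interior[OF Q] .
  obtain z where z: "z \<in> set zs" "z \<noteq> a" "z \<noteq> b" using path_between_interior[OF R] .
  have v: "vpath G xs" "vpath G ys" "vpath G zs" using P Q R unfolding path_between_def by auto
  have c: "p x \<in> closure F" "p y \<in> closure F" "p z \<in> closure F"
    using v x y z vertex_in_face_closure unfolding vpath_def by blast+
  have "F \<inter> (drawing xs \<union> drawing ys \<union> drawing zs) = {}"
    using face_avoids_drawing v by blast
  from theta_closure_misses_arc[OF theta_of_paths[OF P Q R(1) int] face_connected this
      inner_vertex_image[OF P(1) x] c(1) inner_vertex_image[OF Q(1) y] c(2) inner_vertex_image[OF R(1) z] c(3)]
  show False .
qed

text \<open>A list of two adjacent vertices counts as a degenerate cycle; it is the starting point for choosing a longest one.\<close>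

definition cyc :: "'a list \<Rightarrow> bool" where
  "cyc xs \<longleftrightarrow> 2 \<le> length xs \<and> vpath G xs \<and> adj G (last xs) (hd xs)"

lemma cyc_rotate:
  assumes "cyc (xs @ ys)" shows "cyc (ys @ xs)"
proof (cases "xs = [] \<or> ys = []")
  case True
  then show ?thesis using assms by auto
next
  case False
  then show ?thesis using assms unfolding cyc_def vpath_def
    by (auto simp: successively_append_iff)
qed

text \<open>The cycle together with the chord \<open>u0 u2\<close> is a theta curve, and \<open>F\<close> as well as the chord \<open>u1 u3\<close> accumulate at \<open>u1\<close>
  and \<open>u3\<close>; so both are on the other side of the cycle than \<open>u0 u2\<close>. Exchanging the roles of the chords, \<open>F\<close> is also on
  the other side than \<open>u1 u3\<close>. Three connected sets cannot be pairwise on different sides of a closed curve.\<close>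

lemma no_crossing_chords:
  assumes c: "cyc (u0 # B @ u1 # C @ u2 # D @ u3 # H)" and ch: "adj G u0 u2" "adj G u1 u3"
  shows False
proof -
  let ?P = "u0 # B @ u1 # C @ [u2]" and ?Q = "u2 # D @ u3 # H @ [u0]"
  let ?P' = "u1 # C @ u2 # D @ [u3]" and ?Q' = "u3 # H @ u0 # B @ [u1]"
  have dist: "distinct (u0 # B @ u1 # C @ u2 # D @ u3 # H)"
    and sub: "set (u0 # B @ u1 # C @ u2 # D @ u3 # H) \<subseteq> verts G"
    and suc: "successively (adj G) (u0 # B @ u1 # C @ u2 # D @ u3 # H)"
    and cl: "adj G (last (u3 # H)) u0"
    using c unfolding cyc_def vpath_def by auto
  have seg: "successively (adj G) (u0 # B @ [u1])" "successively (adj G) (u1 # C @ [u2])"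
    "successively (adj G) (u2 # D @ [u3])" "successively (adj G) (u3 # H @ [u0])"
  proof -
    have 1: "successively (adj G) (u0 # B @ [u1]) \<and> successively (adj G) (u1 # C @ u2 # D @ u3 # H)"
      using iffD1[OF successively_overlap[of "adj G" "u0 # B" u1 "C @ u2 # D @ u3 # H"]] suc
      unfolding append_Cons by blast
    then have 2: "successively (adj G) (u1 # C @ [u2]) \<and> successively (adj G) (u2 # D @ u3 # H)"
      using successively_overlap[of "adj G" "u1 # C" u2 "D @ u3 # H"] unfolding append_Cons by blast
    then have 3: "successively (adj G) (u2 # D @ [u3]) \<and> successively (adj G) (u3 # H)"
      using successively_overlap[of "adj G" "u2 # D" u3 H] unfolding append_Cons by blast
    then have "successively (adj G) (u3 # H @ [u0])"
      using cl successively_append_iff[of "adj G" "u3 # H" "[u0]"] by simp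
    with 1 2 3 show "successively (adj G) (u0 # B @ [u1])" "successively (adj G) (u1 # C @ [u2])"
      "successively (adj G) (u2 # D @ [u3])" "successively (adj G) (u3 # H @ [u0])" by blast+
  qed
  have SP: "successively (adj G) ?P" using successively_overlap[of "adj G" "u0 # B" u1 "C @ [u2]"] seg(1,2) unfolding append_Cons by blast
  have SQ: "successively (adj G) ?Q" using successively_overlap[of "adj G" "u2 # D" u3 "H @ [u0]"] seg(3,4) unfolding append_Cons by blast
  have SP': "successively (adj G) ?P'" using successively_overlap[of "adj G" "u1 # C" u2 "D @ [u3]"] seg(2,3) unfolding append_Cons by blast
  have SQ': "successively (adj G) ?Q'" using successively_overlap[of "adj G" "u3 # H" u0 "B @ [u1]"] seg(4,1) unfolding append_Cons by blast
  have P: "path_between G u0 u2 ?P"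
    unfolding path_between_def vpath_def using SP dist sub by auto
  have Q: "path_between G u0 u2 ?Q"
    unfolding path_between_def vpath_def using SQ dist sub by auto
  have P': "path_between G u1 u3 ?P'"
    unfolding path_between_def vpath_def using SP' dist sub by auto
  have Q': "path_between G u1 u3 ?Q'"
    unfolding path_between_def vpath_def using SQ' dist sub by auto
  have R: "path_between G u0 u2 [u0, u2]" and R': "path_between G u1 u3 [u1, u3]"
    using dist sub ch unfolding path_between_def vpath_def by auto
  have L: "3 \<le> length ?P" "3 \<le> length ?Q" "3 \<le> length ?P'" "3 \<le> length ?Q'" by simp_all
  have th: "theta (p u0) (p u2) (drawing ?P) (drawing ?Q) (drawing [u0, u2])"
    by (rule theta_of_paths[OF P L(1) Q L(2) R]) (use dist in auto)
  have th': "theta (p u1) (p u3) (drawing ?P') (drawing ?Q') (drawing [u1, u3])"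
    by (rule theta_of_paths[OF P' L(3) Q' L(4) R']) (use dist in auto)
  have PE: "path_edges ?P = path_edges (u0 # B @ [u1]) \<union> path_edges (u1 # C @ [u2])"
    "path_edges ?Q = path_edges (u2 # D @ [u3]) \<union> path_edges (u3 # H @ [u0])"
    "path_edges ?P' = path_edges (u1 # C @ [u2]) \<union> path_edges (u2 # D @ [u3])"
    "path_edges ?Q' = path_edges (u3 # H @ [u0]) \<union> path_edges (u0 # B @ [u1])"
    using path_edges_append[of "u0 # B" u1 "C @ [u2]"] path_edges_append[of "u2 # D" u3 "H @ [u0]"]
      path_edges_append[of "u1 # C" u2 "D @ [u3]"] path_edges_append[of "u3 # H" u0 "B @ [u1]"] by simp_all
  have same: "drawing ?P' \<union> drawing ?Q' = drawing ?P \<union> drawing ?Q"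
    unfolding drawing_def PE by blast
  have V: "u0 \<in> verts G" "u1 \<in> verts G" "u2 \<in> verts G" "u3 \<in> verts G" using sub by auto
  have cF: "p u0 \<in> closure F" "p u1 \<in> closure F" "p u2 \<in> closure F" "p u3 \<in> closure F"
    using vertex_in_face_closure V by auto
  have vp: "vpath G ?P" "vpath G ?Q" "vpath G [u0, u2]" "vpath G ?P'" "vpath G ?Q'" "vpath G [u1, u3]"
    using P Q R P' Q' R' unfolding path_between_def by auto
  have av: "F \<inter> (drawing ?P \<union> drawing ?Q \<union> drawing [u0, u2]) = {}"
    "F \<inter> (drawing ?P' \<union> drawing ?Q' \<union> drawing [u1, u3]) = {}"
    using face_avoids_drawing vp by blast+
  have in1: "p u1 \<in> drawing ?P - {p u0, p u2}" "p u3 \<in> drawing ?Q - {p u0, p u2}"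
    using inner_vertex_image[OF P, of u1] inner_vertex_image[OF Q, of u3] dist by auto
  have in2: "p u2 \<in> drawing ?P' - {p u1, p u3}" "p u0 \<in> drawing ?Q' - {p u1, p u3}"
    using inner_vertex_image[OF P', of u2] inner_vertex_image[OF Q', of u0] dist by auto
  let ?I = "inside (drawing ?P \<union> drawing ?Q)" and ?O = "outside (drawing ?P \<union> drawing ?Q)"
  let ?A = "drawing [u0, u2] - {p u0, p u2}" and ?B = "drawing [u1, u3] - {p u1, p u3}"
  have arcs: "arc_between (p u0) (p u2) (drawing [u0, u2])" "arc_between (p u1) (p u3) (drawing [u1, u3])"
    using path_between_arc R R' by auto
  note A = arc_between_open_part[OF arcs(1)] and B = arc_between_open_part[OF arcs(2)]
  have 1: "F \<subseteq> ?I \<and> ?A \<subseteq> ?O \<or> F \<subseteq> ?O \<and> ?A \<subseteq> ?I"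
    by (rule theta_opposite_sides[OF th face_connected av(1) in1(1) cF(2) in1(2) cF(4)])
  have 2: "F \<subseteq> ?I \<and> ?B \<subseteq> ?O \<or> F \<subseteq> ?O \<and> ?B \<subseteq> ?I"
    using theta_opposite_sides[OF th' face_connected av(2) in2(1) cF(3) in2(2) cF(1)] unfolding same .
  have cB: "p u1 \<in> closure ?B" "p u3 \<in> closure ?B" using B(5-7) by blast+
  have "path_edges [u1, u3] \<inter> path_edges [u0, u2] = {}" using dist by (auto simp: doubleton_eq_iff)
  then have dr: "drawing [u1, u3] \<inter> drawing [u0, u2] = {}"
    using drawing_inter[OF vp(6,3)] dist by auto
  have "drawing [u1, u3] \<inter> (drawing ?P \<union> drawing ?Q) = {p u1, p u3}"
    using th' unfolding theta_def same[symmetric] by blast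
  then have avB: "?B \<inter> (drawing ?P \<union> drawing ?Q \<union> drawing [u0, u2]) = {}" using dr by blast
  have 3: "?B \<subseteq> ?I \<and> ?A \<subseteq> ?O \<or> ?B \<subseteq> ?O \<and> ?A \<subseteq> ?I"
    by (rule theta_opposite_sides[OF th B(3) avB in1(1) cB(1) in1(2) cB(2)])
  have "F \<noteq> {}" using cF by auto
  then show False using 1 2 3 A(4) B(4) inside_Int_outside[of "drawing ?P \<union> drawing ?Q"] by blast
qed

text \<open>A walk into \<open>A\<close> can be shortened to a path whose last vertex is its only one in \<open>A\<close>.\<close>

lemma hitting_path:
  assumes "(x, y) \<in> {(x, y). adj H x y}\<^sup>*" "y \<in> A"
  shows "\<exists>xs. xs \<noteq> [] \<and> distinct xs \<and> hd xs = x \<and> successively (adj H) xs \<and> last xs \<in> A \<and>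
    set (butlast xs) \<inter> A = {}"
  using assms(1)
proof (induction rule: converse_rtrancl_induct)
  case base
  show ?case by (rule exI[of _ "[y]"]) (use assms(2) in auto)
next
  case (step x z)
  then obtain xs where xs: "xs \<noteq> []" "distinct xs" "hd xs = z" "successively (adj H) xs" "last xs \<in> A"
    "set (butlast xs) \<inter> A = {}" by blast
  consider "x \<in> A" | "x \<notin> A" "x \<in> set xs" | "x \<notin> A" "x \<notin> set xs" by blast
  then show ?case
  proof cases
    case 1
    then show ?thesis by (intro exI[of _ "[x]"]) auto
  next
    case 2
    then obtain as bs where ab: "xs = as @ x # bs" by (meson split_list)
    then have "set (butlast (x # bs)) \<inter> A = {}" using xs(6) by (cases bs) (auto simp: butlast_append)
    moreover have "distinct (x # bs)" "successively (adj H) (x # bs)" "last (x # bs) \<in> A"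
      using xs ab by (auto simp: successively_append_iff)
    ultimately show ?thesis by (intro exI[of _ "x # bs"]) simp
  next
    case 3
    then show ?thesis using xs step(1) by (intro exI[of _ "x # xs"]) (auto simp: successively_Cons)
  qed
qed

text \<open>If a longest cycle misses a vertex, then some edge leaves the cycle at a vertex \<open>u\<close>, and since the graph
  without \<open>u\<close> is connected, this edge continues to a path that returns to the cycle at another vertex \<open>w\<close>. If \<open>u\<close> and \<open>w\<close> are
  consecutive on the cycle, the detour makes it longer; otherwise the detour and the two parts of the
  cycle are three long paths from \<open>u\<close> to \<open>w\<close>.\<close>

theorem hamiltonian_cycle:
  assumes tc: "two_connected G"
  shows "\<exists>xs. cyc xs \<and> set xs = verts G"
proof -
  have fin: "finite (verts G)" using simple unfolding simple_graph_def by blast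
  have c3: "3 \<le> card (verts G)" and con: "graph_connected G"
    and con2: "\<And>v. v \<in> verts G \<Longrightarrow> graph_connected (delete_vertex G v)"
    using tc unfolding two_connected_def by auto
  have conD: "(u, v) \<in> {(x, y). adj G x y}\<^sup>*" if "u \<in> verts G" "v \<in> verts G" for u v
    using con that unfolding graph_connected_def by blast
  have ex: "\<exists>xs. cyc xs"
  proof -
    obtain u where u: "u \<in> verts G" using c3 by fastforce
    have "verts G \<noteq> {u}" using c3 by auto
    then obtain v where v: "v \<in> verts G" "v \<noteq> u" using u by blast
    from conD[OF u v(1)] v(2) obtain w where w: "adj G u w" by (auto elim: converse_rtranclE)
    then have "cyc [u, w]" using edge_card[OF w] unfolding cyc_def vpath_def
      by (auto simp: insert_commute card_insert_if split: if_splits)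
    then show ?thesis by blast
  qed
  have len: "length xs \<le> card (verts G)" if "cyc xs" for xs
    using that distinct_card[of xs] card_mono[OF fin, of "set xs"] unfolding cyc_def vpath_def by auto
  obtain xs where xs: "cyc xs" and mx: "\<And>ys. cyc ys \<Longrightarrow> length ys \<le> length xs"
    using ex_has_greatest_nat[of cyc _ length "Suc (card (verts G))"] ex len
    unfolding less_Suc_eq_le by blast
  have "set xs = verts G"
  proof (rule ccontr)
    assume ne: "set xs \<noteq> verts G"
    have sub: "set xs \<subseteq> verts G" using xs unfolding cyc_def vpath_def by blast
    then obtain v where v: "v \<in> verts G" "v \<notin> set xs" using ne by blast
    obtain u0 where u0: "u0 \<in> set xs" using xs unfolding cyc_def by fastforce
    have "(u0, v) \<in> {(x, y). adj G x y}\<^sup>*" using conD u0 v sub by blast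
    then have "\<exists>u v'. u \<in> set xs \<and> v' \<notin> set xs \<and> adj G u v'"
      using u0 v(2)
    proof (induction rule: rtrancl_induct)
      case (step y z)
      then show ?case by (cases "y \<in> set xs") auto
    qed auto
    then obtain u v' where uv: "u \<in> set xs" "v' \<notin> set xs" "adj G u v'" by blast
    have v'V: "v' \<in> verts G" using edge_card(2)[OF uv(3)] by auto
    obtain as bs where ab: "xs = as @ u # bs" using uv(1) by (meson split_list)
    define ys where "ys = bs @ as"
    have cy: "cyc (u # ys)" using cyc_rotate[of as "u # bs"] xs ab unfolding ys_def by simp
    have lys: "length (u # ys) = length xs" and sys: "set (u # ys) = set xs" unfolding ys_def ab by auto
    have ysne: "ys \<noteq> []" using cy unfolding cyc_def by auto
    have dys: "distinct (u # ys)" "set (u # ys) \<subseteq> verts G" "successively (adj G) (u # ys)" "adj G (last ys) u"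
      using cy ysne unfolding cyc_def vpath_def by auto
    let ?H = "delete_vertex G u"
    have HE: "adj G x y \<and> x \<noteq> u \<and> y \<noteq> u" if "adj ?H x y" for x y
      using that unfolding delete_vertex_def by auto
    have "hd ys \<in> verts ?H" "v' \<in> verts ?H"
      using dys ysne v'V uv unfolding delete_vertex_def by auto
    then have "(v', hd ys) \<in> {(x, y). adj ?H x y}\<^sup>*"
      using con2[of u] dys(2) unfolding graph_connected_def by auto
    from hitting_path[OF this, of "set ys"] ysne obtain ps where
      ps: "ps \<noteq> []" "distinct ps" "hd ps = v'" "successively (adj ?H) ps" "last ps \<in> set ys" "set (butlast ps) \<inter> set ys = {}"
      by auto
    define qs w where "qs = butlast ps" and "w = last ps"
    have psq: "ps = qs @ [w]" using ps(1) unfolding qs_def w_def by simp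
    have wy: "w \<in> set ys" and qy: "set qs \<inter> set ys = {}" using ps unfolding qs_def w_def by auto
    have qne: "qs \<noteq> []" using ps(3) psq wy uv(2) sys by (cases qs) auto
    have hq: "hd qs = v'" using ps(3) psq qne by simp
    have sH: "successively (adj ?H) (qs @ [w])" using ps(4) psq by simp
    then have sG: "successively (adj G) (qs @ [w])" by (rule successively_mono) (use HE in blast)
    have uq: "u \<notin> set qs"
    proof
      assume "u \<in> set qs"
      then obtain cs ds where "qs = cs @ u # ds" by (meson split_list)
      then have "qs @ [w] = cs @ u # (ds @ [w])" by simp
      then have "successively (adj ?H) (u # (ds @ [w]))" using sH by (metis successively_append_iff)
      then have "adj ?H u (hd (ds @ [w]))" by (simp add: successively_Cons)
      then show False using HE by blast
    qed
    have qV: "set qs \<subseteq> verts G"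
    proof
      fix q assume "q \<in> set qs"
      then have "q \<in> set (qs @ [w])" by simp
      from path_edges_cover[OF _ this] qne obtain e where "e \<in> path_edges (qs @ [w])" "q \<in> e"
        by (cases qs) auto
      then show "q \<in> verts G" using path_edges_in_edges[OF sG] edge_card(2) by blast
    qed
    have dq: "distinct qs" using ps(2) psq by simp
    have uv': "adj G u (hd qs)" using uv(3) hq by simp
    have qw: "adj G (last qs) w" "successively (adj G) qs" using sG qne by (auto simp: successively_append_iff)
    obtain A B where AB: "ys = A @ w # B" using wy by (meson split_list)
    consider "A = []" | "B = []" | "A \<noteq> []" "B \<noteq> []" by blast
    then show False
    proof cases
      case 1
      have "cyc (u # qs @ ys)"
        unfolding cyc_def vpath_def using dys dq qV uq qy uv' qw qne ysne 1 AB
        by (auto simp: successively_append_iff successively_Cons)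
      from mx[OF this] show False using lys qne by (cases qs) simp_all
    next
      case 2
      have sr: "successively (adj G) (rev qs)" using qw(2) by (simp add: insert_commute)
      have "successively (adj G) ((u # ys) @ rev qs)"
        unfolding successively_append_iff using dys(3) sr qw(1) qne ysne 2 AB
        by (simp add: hd_rev insert_commute)
      then have "cyc (u # ys @ rev qs)"
        unfolding cyc_def vpath_def using dys(1,2) dq qV uq qy uv' qne
        by (cases qs) (auto simp: last_rev insert_commute)
      from mx[OF this] show False using lys qne by (cases qs) simp_all
    next
      case 3
      have X: "path_between G u w (u # A @ [w])" "path_between G u w (w # B @ [u])" "path_between G u w (u # qs @ [w])"
        using dys dq qV uq qy uv' qw qne ysne 3 AB sG unfolding path_between_def vpath_def
        by (auto simp: successively_append_iff successively_Cons)
      have L: "3 \<le> length (u # A @ [w])" "3 \<le> length (w # B @ [u])" "3 \<le> length (u # qs @ [w])"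
        using 3 qne by (simp_all add: Suc_le_eq)
      show False
        by (rule no_three_long_paths[OF X(1) L(1) X(2) L(2) X(3) L(3)]) (use dys uq qy AB in auto)
    qed
  qed
  then show ?thesis using xs by blast
qed

end

section \<open>Transfer of the bounds to outerplane graphs\<close>

lemma distinct4: "a \<noteq> b \<Longrightarrow> b \<noteq> c \<Longrightarrow> c \<noteq> d \<Longrightarrow> d \<noteq> a \<Longrightarrow> a \<noteq> c \<Longrightarrow> b \<noteq> d \<Longrightarrow> distinct [a, b, c, d]"
  by auto

lemma four_cyclesE:
  assumes "C \<in> four_cycles G"
  obtains a b c d where "C = {{a, b}, {b, c}, {c, d}, {d, a}}" "distinct [a, b, c, d]"
    "adj G a b" "adj G b c" "adj G c d" "adj G d a"
proof -
  from assms[unfolded four_cycles_def] obtain a b c d where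
    "C = {{a, b}, {b, c}, {c, d}, {d, a}}" "distinct [a, b, c, d]"
    "{{a, b}, {b, c}, {c, d}, {d, a}} \<subseteq> edges G"
    by (elim CollectE exE conjE)
  moreover from this have "adj G a b" "adj G b c" "adj G c d" "adj G d a" by blast+
  ultimately show ?thesis using that by blast
qed

locale hamiltonian_outerplane_graph = outerplane_graph +
  fixes xs assumes cyc_xs: "cyc xs" and set_xs: "set xs = verts G" and long: "3 \<le> length xs"
begin

definition E :: "nat \<Rightarrow> nat \<Rightarrow> bool" where
  "E i j \<longleftrightarrow> i < length xs \<and> j < length xs \<and> adj G (xs ! i) (xs ! j)"

lemma dist_xs: "distinct xs" "successively (adj G) xs"
  using cyc_xs unfolding cyc_def vpath_def by auto

lemma chords_do_not_cross:
  assumes "a < b" "b < c" "c < d" "E a c" "E b d" shows False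
proof -
  have len: "a < length xs" "b < length xs" "c < length xs" "d < length xs"
    using assms unfolding E_def by auto
  have 1: "xs = take d xs @ xs ! d # drop (Suc d) xs" by (rule id_take_nth_drop[OF len(4)])
  have 2: "take d xs = take c xs @ xs ! c # drop (Suc c) (take d xs)"
    using id_take_nth_drop[of c "take d xs"] len assms by (simp add: min_def)
  have 3: "take c xs = take b xs @ xs ! b # drop (Suc b) (take c xs)"
    using id_take_nth_drop[of b "take c xs"] len assms by (simp add: min_def)
  have 4: "take b xs = take a xs @ xs ! a # drop (Suc a) (take b xs)"
    using id_take_nth_drop[of a "take b xs"] len assms by (simp add: min_def)
  let ?rest = "xs ! a # drop (Suc a) (take b xs) @ xs ! b # drop (Suc b) (take c xs) @ xs ! c #
      drop (Suc c) (take d xs) @ xs ! d # drop (Suc d) xs"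
  have "xs = take a xs @ ?rest"
  proof -
    have "take d xs = take a xs @ xs ! a # drop (Suc a) (take b xs) @ xs ! b # drop (Suc b) (take c xs) @
      xs ! c # drop (Suc c) (take d xs)"
      by (subst 2, subst 3, subst 4) simp
    then show ?thesis by (subst 1) simp
  qed
  then have "cyc (?rest @ take a xs)" using cyc_rotate[of "take a xs" ?rest] cyc_xs by simp
  then show False
    using no_crossing_chords[of "xs ! a" _ "xs ! b" _ "xs ! c" _ "xs ! d"] assms(4,5) unfolding E_def by simp
qed

sublocale noncrossing E
proof
  show "E b a" if "E a b" for a b using that unfolding E_def by (auto simp: insert_commute)
  show "\<not> E a a" for a using edge_card(1)[of "{xs ! a}"] unfolding E_def by auto
qed (rule chords_do_not_cross)

abbreviation "N \<equiv> {..<length xs}"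

lemma E_Suc: "Suc i < length xs \<Longrightarrow> E i (Suc i)"
  using dist_xs(2) unfolding E_def by (auto simp: successively_conv_nth)

lemma polygon_N: "polygon N"
proof -
  have mm: "Min N = 0" "Max N = length xs - 1"
    using long by (auto intro!: Min_eqI Max_eqI)
  have "E 0 (length xs - 1)"
  proof -
    have "xs \<noteq> []" using long by auto
    then show ?thesis
      using cyc_xs unfolding E_def cyc_def by (auto simp: hd_conv_nth last_conv_nth insert_commute)
  qed
  moreover have "E a b" if "a \<in> N" "b \<in> N" "a < b" "N \<inter> {a<..<b} = {}" for a b
  proof -
    have "\<not> Suc a < b"
    proof
      assume "Suc a < b"
      then have "Suc a \<in> N \<inter> {a<..<b}" using that(2) by simp
      then show False using that(4) by blast
    qed
    then have "b = Suc a" using that by simp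
    then show ?thesis using E_Suc that by simp
  qed
  ultimately show ?thesis unfolding polygon_def mm using long by simp
qed

definition position :: "'a \<Rightarrow> nat" where "position = inv_into N ((!) xs)"

lemma nth_bij: "bij_betw ((!) xs) N (verts G)"
  by (rule bij_betw_nth) (use dist_xs set_xs in auto)

lemma position_bij: "bij_betw position (verts G) N"
  unfolding position_def by (rule bij_betw_inv_into[OF nth_bij])

lemma nth_position: "v \<in> verts G \<Longrightarrow> xs ! position v = v"
  unfolding position_def using bij_betw_inv_into_right[OF nth_bij] by simp

lemma position_less: "v \<in> verts G \<Longrightarrow> position v < length xs"
  using position_bij bij_betwE by blast

lemma position_inj: "u \<in> verts G \<Longrightarrow> v \<in> verts G \<Longrightarrow> position u = position v \<longleftrightarrow> u = v"
  using nth_position by metis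

lemma adj_verts: "adj G u v \<Longrightarrow> u \<in> verts G \<and> v \<in> verts G \<and> u \<noteq> v"
  using edge_card[of "{u, v}"] by auto

lemma E_position: "u \<in> verts G \<Longrightarrow> v \<in> verts G \<Longrightarrow> E (position u) (position v) \<longleftrightarrow> adj G u v"
  unfolding E_def using position_less nth_position by simp

lemma E_position': "adj G u v \<Longrightarrow> E (position u) (position v)"
  using E_position adj_verts by blast

lemma edge_pair:
  assumes "e \<in> edges G" obtains u v where "e = {u, v}" "adj G u v"
  using edge_card(1)[OF assms] assms by (metis card_2_iff)

lemma position_edge: "e \<in> edges G \<Longrightarrow> position ` e \<in> edges_on N"
proof -
  assume "e \<in> edges G"
  then obtain u v where e: "e = {u, v}" "adj G u v" by (rule edge_pair)
  then show ?thesis using E_position'[OF e(2)] adj_verts[OF e(2)] position_less by (simp add: pair_in_edges_on)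
qed

lemma position_image_inj: "inj_on ((`) position) (edges G)"
proof (rule inj_onI)
  fix e f assume "e \<in> edges G" "f \<in> edges G" "position ` e = position ` f"
  moreover have "inj_on position (verts G)" using position_bij by (rule bij_betw_imp_inj_on)
  ultimately show "e = f" using edge_card(2) inj_on_image_eq_iff by metis
qed

lemma deg_le_degree: "i < length xs \<Longrightarrow> deg N i \<le> degree G (xs ! i)"
proof -
  assume i: "i < length xs"
  let ?f = "\<lambda>j. {xs ! i, xs ! j}"
  have fin: "finite (edges G)"
    using simple finite_subset[of "edges G" "Pow (verts G)"] unfolding simple_graph_def by auto
  have "inj_on ?f {u \<in> N. E i u}"
  proof (rule inj_onI)
    fix j k assume "j \<in> {u \<in> N. E i u}" "k \<in> {u \<in> N. E i u}" "?f j = ?f k"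
    then show "j = k" using dist_xs(1) by (auto simp: doubleton_eq_iff nth_eq_iff_index_eq)
  qed
  then have "deg N i = card (?f ` {u \<in> N. E i u})" unfolding deg_def by (simp add: card_image)
  also have "\<dots> \<le> degree G (xs ! i)"
    unfolding degree_def using fin by (intro card_mono) (auto simp: E_def)
  finally show ?thesis .
qed

lemma deg_bound:
  assumes "max_degree G \<le> \<Delta>" "i \<in> N" shows "deg N i \<le> \<Delta>"
proof -
  have "xs ! i \<in> verts G" using nth_mem[of i xs] assms(2) unfolding set_xs by simp
  then have "degree G (xs ! i) \<le> max_degree G"
    unfolding max_degree_def using simple unfolding simple_graph_def by (intro Max_ge) auto
  then show ?thesis using deg_le_degree[of i] assms by simp
qed

lemma conf_incident:
  assumes "e \<in> edges G" "f \<in> edges G" "e \<noteq> f" "e \<inter> f \<noteq> {}" shows "conf (position ` e) (position ` f)"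
  using assms position_image_inj unfolding conf_def by (auto dest: inj_onD)

lemma conf_opposite:
  assumes "distinct [a, b, c, d]" "adj G a b" "adj G b c" "adj G c d" "adj G d a"
  shows "conf (position ` {a, b}) (position ` {c, d})"
proof -
  have V: "a \<in> verts G" "b \<in> verts G" "c \<in> verts G" "d \<in> verts G" using assms adj_verts by blast+
  have d: "distinct [position a, position b, position c, position d]" using assms(1) position_inj V by auto
  moreover have "position ` {a, b} \<noteq> position ` {c, d}" using d by (auto simp: doubleton_eq_iff)
  ultimately show ?thesis using assms(2-5)[THEN E_position'] unfolding conf_def by auto
qed

lemma B_coloring_of_proper:
  assumes col: "proper_on N k col"
  shows "B_coloring G (\<lambda>e. col (position ` e))" "(\<lambda>e. col (position ` e)) ` edges G \<subseteq> {..<k}"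
proof -
  have neq: "col (position ` e) \<noteq> col (position ` f)" if "e \<in> edges G" "f \<in> edges G" "conf (position ` e) (position ` f)" for e f
    using col position_edge that unfolding proper_on_def by blast
  show "(\<lambda>e. col (position ` e)) ` edges G \<subseteq> {..<k}"
    using col position_edge unfolding proper_on_def by blast
  have "card ((\<lambda>e. col (position ` e)) ` C) = 4" if "C \<in> four_cycles G" for C
  proof -
    obtain a b c d where C: "C = {{a, b}, {b, c}, {c, d}, {d, a}}" and d: "distinct [a, b, c, d]"
      and e: "adj G a b" "adj G b c" "adj G c d" "adj G d a"
      using \<open>C \<in> four_cycles G\<close> by (rule four_cyclesE)
    have ne: "{a, b} \<noteq> {b, c}" "{b, c} \<noteq> {c, d}" "{c, d} \<noteq> {d, a}" "{d, a} \<noteq> {a, b}"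
      using d by (auto simp: doubleton_eq_iff)
    have m: "{a, b} \<inter> {b, c} \<noteq> {}" "{b, c} \<inter> {c, d} \<noteq> {}" "{c, d} \<inter> {d, a} \<noteq> {}" "{d, a} \<inter> {a, b} \<noteq> {}"
      by blast+
    note c = conf_incident[OF e(1,2) ne(1) m(1)] conf_incident[OF e(2,3) ne(2) m(2)]
      conf_incident[OF e(3,4) ne(3) m(3)] conf_incident[OF e(4,1) ne(4) m(4)]
    note i = neq[OF e(1,2) c(1)] neq[OF e(2,3) c(2)] neq[OF e(3,4) c(3)] neq[OF e(4,1) c(4)]
    have "conf (position ` {b, c}) (position ` {d, a})" by (rule conf_opposite) (use d e in auto)
    note o = neq[OF e(1,3) conf_opposite[OF d e]] neq[OF e(2,4) this]
    have "distinct [col (position ` {a, b}), col (position ` {b, c}), col (position ` {c, d}), col (position ` {d, a})]"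
      by (rule distinct4[OF i o])
    from distinct_card[OF this] show ?thesis unfolding C by simp
  qed
  moreover have "proper_edge_coloring G (\<lambda>e. col (position ` e))"
    unfolding proper_edge_coloring_def using neq conf_incident by blast
  ultimately show "B_coloring G (\<lambda>e. col (position ` e))" unfolding B_coloring_def by blast
qed

lemma graph_isoI:
  assumes "bij_betw \<sigma> N (verts H)" "\<And>i j. i \<in> N \<Longrightarrow> j \<in> N \<Longrightarrow> E i j \<longleftrightarrow> {\<sigma> i, \<sigma> j} \<in> edges H"
  shows "graph_iso G H"
  unfolding graph_iso_def
proof (intro exI[of _ "\<sigma> \<circ> position"] conjI ballI)
  show "bij_betw (\<sigma> \<circ> position) (verts G) (verts H)" by (rule bij_betw_trans[OF position_bij assms(1)])
  show "adj G u v \<longleftrightarrow> {(\<sigma> \<circ> position) u, (\<sigma> \<circ> position) v} \<in> edges H" if "u \<in> verts G" "v \<in> verts G" for u v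
    using assms(2)[of "position u" "position v"] E_position[OF that] position_less that by simp
qed

lemma four_vertices_adj:
  assumes n: "length xs = 4"
  shows "E 0 1" "E 1 2" "E 2 3" "E 3 0" "E 1 0" "E 2 1" "E 3 2" "E 0 3" "\<not> E 0 2 \<or> \<not> E 1 3"
proof -
  show 1: "E 0 1" "E 1 2" "E 2 3" using E_Suc[of 0] E_Suc[of 1] E_Suc[of 2] n by (simp_all add: numeral_2_eq_2 numeral_3_eq_3)
  have "Min N = 0" "Max N = 3" using n by (auto intro!: Min_eqI Max_eqI)
  then show 2: "E 0 3" using polygon_N unfolding polygon_def by simp
  show "E 3 0" "E 1 0" "E 2 1" "E 3 2" using 1 2 adj_sym by blast+
  show "\<not> E 0 2 \<or> \<not> E 1 3" using no_crossing[of 0 1 2 3] by auto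
qed

lemma N4: "length xs = 4 \<Longrightarrow> N = {0, 1, 2, 3}"
  by auto

text \<open>All adjacencies of a polygon with four vertices, up to its two possible chords. The number one is written as \<open>Suc 0\<close>, the
  form that the simplifier uses.\<close>

lemma four_vertices_table:
  assumes "length xs = 4"
  shows "E 0 (Suc 0)" "E (Suc 0) 2" "E 2 3" "E 3 0" "E (Suc 0) 0" "E 2 (Suc 0)" "E 3 2" "E 0 3" "\<not> E i i"
    "E 2 0 \<longleftrightarrow> E 0 2" "E 3 (Suc 0) \<longleftrightarrow> E (Suc 0) 3"
  using four_vertices_adj[OF assms] adj_sym[of 0 2] adj_sym[of 2 0] adj_sym[of 1 3] adj_sym[of 3 1] adj_irrefl
  by auto

lemma iso_cycle4:
  assumes n: "length xs = 4" and ch: "\<not> E 0 2" "\<not> E (Suc 0) 3"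
  shows "graph_iso G cycle4"
proof (rule graph_isoI[of "\<lambda>i. i"])
  show "bij_betw (\<lambda>i. i) N (verts cycle4)" unfolding N4[OF n] cycle4_def by (simp add: bij_betw_def)
  show "E i j \<longleftrightarrow> {i, j} \<in> edges cycle4" if "i \<in> N" "j \<in> N" for i j
    using that unfolding N4[OF n] cycle4_def insert_iff empty_iff
    by (elim disjE) (simp_all add: four_vertices_table[OF n] ch doubleton_eq_iff)
qed

lemma K4_minus_edge_adj:
  assumes "i \<in> {0, 1, 2, 3}" "j \<in> {0, 1, 2, 3}"
  shows "{i, j} \<in> edges K4_minus_edge \<longleftrightarrow> i \<noteq> j \<and> {i, j} \<noteq> {1, 3}"
  using assms unfolding K4_minus_edge_def by (simp add: card_insert_if)

lemma K4_minus_edge_no_loop: "{i} \<notin> edges K4_minus_edge"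
  unfolding K4_minus_edge_def by simp

lemma iso_K4_minus_edge:
  assumes n: "length xs = 4" and ch: "E 0 2 \<or> E (Suc 0) 3"
  shows "graph_iso G K4_minus_edge"
proof -
  note T = four_vertices_table[OF n]
  have nb: "\<not> E 0 2 \<or> \<not> E (Suc 0) 3" using four_vertices_adj(9)[OF n] by simp
  show ?thesis
  proof (cases "E 0 2")
    case True
    with nb have h: "E 0 2" "\<not> E (Suc 0) 3" by auto
    show ?thesis
    proof (rule graph_isoI[of "\<lambda>i. i"])
      show "bij_betw (\<lambda>i. i) N (verts K4_minus_edge)"
        unfolding N4[OF n] K4_minus_edge_def by (simp add: bij_betw_def)
      show "E i j \<longleftrightarrow> {i, j} \<in> edges K4_minus_edge" if "i \<in> N" "j \<in> N" for i j
        using that unfolding N4[OF n] insert_iff empty_iff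
        by (elim disjE) (simp_all add: K4_minus_edge_adj K4_minus_edge_no_loop T h doubleton_eq_iff)
    qed
  next
    case False
    with ch have h: "\<not> E 0 2" "E (Suc 0) 3" by auto
    let ?s = "\<lambda>i::nat. if i = 3 then 0 else Suc i"
    show ?thesis
    proof (rule graph_isoI[of ?s])
      show "bij_betw ?s N (verts K4_minus_edge)"
        unfolding N4[OF n] K4_minus_edge_def by (auto simp: bij_betw_def inj_on_def)
      show "E i j \<longleftrightarrow> {?s i, ?s j} \<in> edges K4_minus_edge" if "i \<in> N" "j \<in> N" for i j
        using that unfolding N4[OF n] insert_iff empty_iff
        by (elim disjE) (simp_all add: K4_minus_edge_adj K4_minus_edge_no_loop T h doubleton_eq_iff)
    qed
  qed
qed

lemma exceptional_iso:
  assumes ex: "exceptional \<Delta> N"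
  shows "graph_iso G cycle4 \<or> graph_iso G K4_minus_edge"
proof -
  have n: "length xs = 4" using ex unfolding exceptional_def by simp
  show ?thesis using iso_cycle4[OF n] iso_K4_minus_edge[OF n] by blast
qed

lemma q_B_bound:
  assumes "max_degree G \<le> \<Delta>" "\<not> graph_iso G cycle4" "\<not> graph_iso G K4_minus_edge"
  shows "q_B G \<le> \<Delta> + 1"
proof -
  have 0: "0 \<in> N" using long by (cases xs) auto
  have "2 \<le> deg N 0" using polygon_min_degree[OF polygon_N _ 0] long by simp
  moreover have "deg N 0 \<le> \<Delta>" by (rule deg_bound[OF assms(1) 0])
  moreover have "\<not> exceptional \<Delta> N" using exceptional_iso assms(2,3) by blast
  ultimately obtain col where "proper_on N (Suc \<Delta>) col"
    using polygon_colourable[OF polygon_N deg_bound[OF assms(1)]] by auto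
  from B_coloring_of_proper[OF this] show ?thesis
    unfolding q_B_def by (intro Least_le) auto
qed

lemma clique_conf:
  assumes K: "is_clique (ext_line_graph G) K"
  shows "conf_clique N ((`) position ` K)"
  unfolding conf_clique_def
proof (intro conjI ballI impI)
  have sub: "K \<subseteq> edges G" using K unfolding is_clique_def ext_line_graph_def by simp
  then show "(`) position ` K \<subseteq> edges_on N" using position_edge by blast
  fix e' f' assume "e' \<in> (`) position ` K" "f' \<in> (`) position ` K" "e' \<noteq> f'"
  then obtain e f where ef: "e \<in> K" "f \<in> K" "e' = position ` e" "f' = position ` f" "e \<noteq> f" by blast
  then have "{e, f} \<in> edges (ext_line_graph G)" using K unfolding is_clique_def by blast
  then obtain g h where gh: "{e, f} = {g, h}" "g \<inter> h \<noteq> {} \<or> (\<exists>C\<in>four_cycles G. g \<in> C \<and> h \<in> C)"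
    unfolding ext_line_graph_def by auto
  then have r: "e \<inter> f \<noteq> {} \<or> (\<exists>C\<in>four_cycles G. e \<in> C \<and> f \<in> C)"
    by (auto simp: doubleton_eq_iff)
  have E: "e \<in> edges G" "f \<in> edges G" using ef sub by auto
  show "conf e' f'"
  proof (cases "e \<inter> f = {}")
    case False
    then show ?thesis using conf_incident[OF E ef(5)] ef by simp
  next
    case True
    then obtain C where C: "C \<in> four_cycles G" "e \<in> C" "f \<in> C" using r by blast
    obtain a b c d where abcd: "C = {{a, b}, {b, c}, {c, d}, {d, a}}" "distinct [a, b, c, d]"
      and a: "adj G a b" "adj G b c" "adj G c d" "adj G d a"
      using C(1) by (rule four_cyclesE)
    have 1: "conf (position ` {a, b}) (position ` {c, d})" by (rule conf_opposite[OF abcd(2) a])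
    have 2: "conf (position ` {b, c}) (position ` {d, a})" by (rule conf_opposite) (use abcd(2) a in auto)
    have "e = {a, b} \<and> f = {c, d} \<or> e = {c, d} \<and> f = {a, b} \<or> e = {b, c} \<and> f = {d, a} \<or> e = {d, a} \<and> f = {b, c}"
      using C(2,3) True unfolding abcd(1) insert_iff empty_iff by (elim disjE) simp_all
    then show ?thesis using 1 2 conf_sym ef(3,4) by blast
  qed
qed

lemma clique_number_bound:
  assumes "max_degree G \<le> \<Delta>" "5 \<le> \<Delta>"
  shows "clique_number (ext_line_graph G) \<le> \<Delta>"
proof -
  have fin: "finite (edges G)"
    using simple finite_subset[of "edges G" "Pow (verts G)"] unfolding simple_graph_def by auto
  have sub: "K \<subseteq> edges G" if "is_clique (ext_line_graph G) K" for K
    using that unfolding is_clique_def ext_line_graph_def by simp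
  have "{card K | K. is_clique (ext_line_graph G) K} \<subseteq> card ` Pow (edges G)" using sub by blast
  then have "finite {card K | K. is_clique (ext_line_graph G) K}" using fin by (meson finite_Pow_iff finite_imageI finite_subset)
  moreover have "is_clique (ext_line_graph G) {}" unfolding is_clique_def by simp
  moreover have "card K \<le> \<Delta>" if "is_clique (ext_line_graph G) K" for K
  proof -
    have "card ((`) position ` K) = card K"
      using inj_on_subset[OF position_image_inj sub[OF that]] by (rule card_image)
    then show ?thesis
      using polygon_clique_bound[OF polygon_N deg_bound[OF assms(1)] assms(2) clique_conf[OF that]] by simp
  qed
  ultimately show ?thesis unfolding clique_number_def by (subst Max_le_iff) auto
qed

end

lemma outerplanar_hamiltonian:
  assumes "simple_graph G" "two_connected G" "outerplanar G"
  obtains p \<gamma> F xs where "hamiltonian_outerplane_graph G p \<gamma> F xs"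
proof -
  obtain p \<gamma> F where h: "plane_embedding G p \<gamma>" "F \<in> faces G p \<gamma>" "p ` verts G \<subseteq> frontier F"
    using assms(3) unfolding outerplanar_def by blast
  interpret outerplane_graph G p \<gamma> F
    by unfold_locales (use assms h in auto)
  obtain xs where xs: "cyc xs" "set xs = verts G" using hamiltonian_cycle[OF assms(2)] by blast
  have "3 \<le> length xs"
    using xs assms(2) distinct_card[of xs] unfolding cyc_def vpath_def two_connected_def by auto
  with xs have "hamiltonian_outerplane_graph G p \<gamma> F xs" by unfold_locales
  then show ?thesis by (rule that)
qed

section \<open>Fans and the two exceptional graphs\<close>

text \<open>The vertex \<open>0\<close> is the hub, joined to all vertices of the path \<open>1, \<dots>, n\<close>.\<close>

definition fan :: "nat \<Rightarrow> nat sgraph" where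
  "fan n = SGraph {0..n} ((\<lambda>k. {0, k}) ` {1..n} \<union> (\<lambda>k. {k, Suc k}) ` {1..<n})"

lemma fan_verts: "verts (fan n) = {0..n}"
  by (simp add: fan_def)

lemma fan_edges: "edges (fan n) = (\<lambda>k. {0, k}) ` {1..n} \<union> (\<lambda>k. {k, Suc k}) ` {1..<n}"
  by (simp add: fan_def)

lemma spoke_edge: "1 \<le> k \<Longrightarrow> k \<le> n \<Longrightarrow> {0, k} \<in> edges (fan n)"
  unfolding fan_edges by auto

lemma rim_edge: "1 \<le> k \<Longrightarrow> k < n \<Longrightarrow> {k, Suc k} \<in> edges (fan n)"
  unfolding fan_edges by auto

lemma fan_edge_cases:
  assumes "e \<in> edges (fan n)"
  obtains k where "e = {0, k}" "1 \<le> k" "k \<le> n" | k where "e = {k, Suc k}" "1 \<le> k" "k < n"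
  using assms unfolding fan_edges by auto

lemma fan_simple: "simple_graph (fan n)"
  unfolding simple_graph_def fan_verts by (auto elim!: fan_edge_cases)

lemma graph_connected_from:
  assumes "c \<in> verts H" "\<And>v. v \<in> verts H \<Longrightarrow> (c, v) \<in> {(x, y). adj H x y}\<^sup>*"
  shows "graph_connected H"
proof -
  have "sym {(x, y). adj H x y}" by (auto simp: sym_def insert_commute)
  then have "(u, c) \<in> {(x, y). adj H x y}\<^sup>*" if "u \<in> verts H" for u
    using assms(2)[OF that] sym_rtrancl by (metis symD)
  then have "(u, v) \<in> {(x, y). adj H x y}\<^sup>*" if "u \<in> verts H" "v \<in> verts H" for u v
    using rtrancl_trans[of u c _ v] assms(2)[OF that(2)] that(1) by blast
  then show ?thesis using assms(1) unfolding graph_connected_def by blast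
qed

lemma fan_two_connected:
  assumes "2 \<le> n" shows "two_connected (fan n)"
  unfolding two_connected_def
proof (intro conjI ballI)
  show "3 \<le> card (verts (fan n))" using assms by (simp add: fan_verts)
  show "graph_connected (fan n)"
  proof (rule graph_connected_from[of 0])
    show "(0, v) \<in> {(x, y). adj (fan n) x y}\<^sup>*" if "v \<in> verts (fan n)" for v
      using that spoke_edge[of v n] by (cases "v = 0") (auto simp: fan_verts)
  qed (simp add: fan_verts)
  fix d assume d: "d \<in> verts (fan n)"
  let ?H = "delete_vertex (fan n) d"
  show "graph_connected ?H"
  proof (cases "d = 0")
    case False
    show ?thesis
    proof (rule graph_connected_from[of 0])
      show "0 \<in> verts ?H" using False by (simp add: delete_vertex_def fan_verts)
      show "(0, v) \<in> {(x, y). adj ?H x y}\<^sup>*" if "v \<in> verts ?H" for v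
      proof (cases "v = 0")
        case v: False
        then have "adj ?H 0 v" using that False spoke_edge[of v n] by (auto simp: delete_vertex_def fan_verts)
        then show ?thesis by auto
      qed simp
    qed
  next
    case True
    show ?thesis
    proof (rule graph_connected_from[of 1])
      show "1 \<in> verts ?H" using True assms by (simp add: delete_vertex_def fan_verts)
      have "(1, v) \<in> {(x, y). adj ?H x y}\<^sup>*" if "1 \<le> v" "v \<le> n" for v
        using that
      proof (induction v rule: dec_induct)
        case (step v)
        then have "adj ?H v (Suc v)" using True rim_edge[of v n] by (simp add: delete_vertex_def)
        then show ?case using step by (auto intro: rtrancl_into_rtrancl)
      qed simp
      then show "(1, v) \<in> {(x, y). adj ?H x y}\<^sup>*" if "v \<in> verts ?H" for v
        using that True by (simp add: delete_vertex_def fan_verts)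
    qed
  qed
qed

lemma max_degree_le:
  assumes "simple_graph G" "card (verts G) = Suc d" shows "max_degree G \<le> d"
proof -
  have fin: "finite (verts G)" using assms(1) unfolding simple_graph_def by blast
  have "degree G v \<le> d" if v: "v \<in> verts G" for v
  proof -
    have "{e \<in> edges G. v \<in> e} \<subseteq> (\<lambda>u. {v, u}) ` (verts G - {v})"
    proof
      fix e assume "e \<in> {e \<in> edges G. v \<in> e}"
      then have e: "v \<in> e" "e \<subseteq> verts G" "card e = 2" using assms(1) unfolding simple_graph_def by auto
      then obtain u where "e = {v, u}" "u \<noteq> v" by (metis card_2_iff doubleton_eq_iff insert_iff singletonD)
      then show "e \<in> (\<lambda>u. {v, u}) ` (verts G - {v})" using e(2) by auto
    qed
    then have "degree G v \<le> card ((\<lambda>u. {v, u}) ` (verts G - {v}))"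
      unfolding degree_def using fin by (intro card_mono) auto
    also have "\<dots> \<le> card (verts G - {v})" using fin by (intro card_image_le) auto
    finally show ?thesis using assms(2) v fin by simp
  qed
  moreover have "verts G \<noteq> {}" using assms(2) by auto
  ultimately show ?thesis unfolding max_degree_def using fin by (subst Max_le_iff) auto
qed

lemma fan_max_degree: "max_degree (fan n) \<le> n"
  by (rule max_degree_le[OF fan_simple]) (simp add: fan_verts)


text \<open>The hub is at the origin and the path on the line \<open>Re z = 1\<close>. All vertices are then on the boundary of the rectangle with corners
  \<open>0\<close> and \<open>1 + n \<i>\<close>, and every edge is drawn inside it.\<close>

definition fan_point :: "nat \<Rightarrow> complex" where
  "fan_point k = (if k = 0 then 0 else Complex 1 (real k))"

definition fan_curve :: "nat set \<Rightarrow> real \<Rightarrow> complex" where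
  "fan_curve e = linepath (fan_point (Min e)) (fan_point (Max e))"

lemma fan_curve_spoke: "1 \<le> k \<Longrightarrow> fan_curve {0, k} = linepath 0 (Complex 1 (real k))"
  unfolding fan_curve_def fan_point_def by simp

lemma fan_curve_rim: "1 \<le> k \<Longrightarrow> fan_curve {k, Suc k} = linepath (Complex 1 (real k)) (Complex 1 (real k + 1))"
  unfolding fan_curve_def fan_point_def by (simp add: add.commute)

lemma spoke_image:
  assumes "1 \<le> k"
  shows "path_image (fan_curve {0, k}) = {z. 0 \<le> Re z \<and> Re z \<le> 1 \<and> Im z = real k * Re z}"
proof -
  have "z \<in> closed_segment 0 (Complex 1 (real k)) \<longleftrightarrow> 0 \<le> Re z \<and> Re z \<le> 1 \<and> Im z = real k * Re z" for z
    unfolding in_segment by (auto simp: complex_eq_iff intro!: exI[of _ "Re z"])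
  then show ?thesis unfolding fan_curve_spoke[OF assms] by auto
qed

lemma rim_image:
  assumes "1 \<le> k"
  shows "path_image (fan_curve {k, Suc k}) = {z. Re z = 1 \<and> real k \<le> Im z \<and> Im z \<le> real k + 1}"
proof -
  have "z \<in> closed_segment (Complex 1 (real k)) (Complex 1 (real k + 1)) \<longleftrightarrow>
      Re z = 1 \<and> real k \<le> Im z \<and> Im z \<le> real k + 1" for z
    unfolding in_segment by (auto simp: complex_eq_iff algebra_simps intro!: exI[of _ "Im z - real k"])
  then show ?thesis unfolding fan_curve_rim[OF assms] by auto
qed

lemma fan_point_eq: "fan_point i = fan_point j \<longleftrightarrow> i = j"
  unfolding fan_point_def by (auto simp: complex_eq_iff)

lemma fan_point_on_spoke:
  assumes "1 \<le> k" shows "fan_point j \<in> path_image (fan_curve {0, k}) \<longleftrightarrow> j = 0 \<or> j = k"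
  unfolding spoke_image[OF assms] fan_point_def by auto

lemma fan_point_on_rim:
  assumes "1 \<le> k" shows "fan_point j \<in> path_image (fan_curve {k, Suc k}) \<longleftrightarrow> j = k \<or> j = Suc k"
  unfolding rim_image[OF assms] fan_point_def using assms by auto

lemma fan_edge_meets_vertices:
  assumes "e \<in> edges (fan n)" shows "fan_point j \<in> path_image (fan_curve e) \<longleftrightarrow> j \<in> e"
  using assms by (cases rule: fan_edge_cases) (auto simp: fan_point_on_spoke fan_point_on_rim)

lemma fan_curves_meet_in_vertex:
  assumes e: "e \<in> edges (fan n)" and f: "f \<in> edges (fan n)" and ne: "e \<noteq> f"
    and z: "z \<in> path_image (fan_curve e)" "z \<in> path_image (fan_curve f)"
  shows "\<exists>j. z = fan_point j"
proof -
  have sr: "\<exists>j. z = fan_point j" if "1 \<le> k" "1 \<le> l" "z \<in> path_image (fan_curve {0, k})"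
    "z \<in> path_image (fan_curve {l, Suc l})" for k l
  proof -
    have "z = fan_point k"
      using that unfolding spoke_image[OF that(1)] rim_image[OF that(2)] fan_point_def
      by (auto simp: complex_eq_iff)
    then show ?thesis by blast
  qed
  have ss: "\<exists>j. z = fan_point j" if "1 \<le> k" "1 \<le> l" "k \<noteq> l" "z \<in> path_image (fan_curve {0, k})"
    "z \<in> path_image (fan_curve {0, l})" for k l
  proof -
    have "z = fan_point 0"
      using that unfolding spoke_image[OF that(1)] spoke_image[OF that(2)] fan_point_def
      by (auto simp: complex_eq_iff)
    then show ?thesis by blast
  qed
  have rr: "\<exists>j. z = fan_point j" if "1 \<le> k" "k < l" "z \<in> path_image (fan_curve {k, Suc k})"
    "z \<in> path_image (fan_curve {l, Suc l})" for k l
  proof -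
    have "1 \<le> l" using that by simp
    have "real k + 1 \<le> real l" using that(2) by linarith
    then have "z = fan_point l"
      using that unfolding rim_image[OF that(1)] rim_image[OF \<open>1 \<le> l\<close>] fan_point_def
      by (auto simp: complex_eq_iff)
    then show ?thesis by blast
  qed
  show ?thesis
    using e
  proof (cases rule: fan_edge_cases)
    case ek: (1 k)
    show ?thesis using f
      by (cases rule: fan_edge_cases) (use ek ne z ss[of k] sr[of k] in auto)
  next
    case ek: (2 k)
    show ?thesis using f
    proof (cases rule: fan_edge_cases)
      case (1 l)
      then show ?thesis using ek z sr[of l k] by simp
    next
      case (2 l)
      then have "k < l \<or> l < k" using ek ne by auto
      then show ?thesis using ek 2 z rr[of k l] rr[of l k] by auto
    qed
  qed
qed

lemma fan_plane_embedding: "plane_embedding (fan n) fan_point fan_curve"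
  unfolding plane_embedding_def
proof (intro conjI ballI impI)
  show "inj_on fan_point (verts (fan n))" by (auto simp: inj_on_def fan_point_eq)
next
  fix e assume e: "e \<in> edges (fan n)"
  then have ev: "e \<subseteq> verts (fan n)" and c: "card e = 2" using fan_simple unfolding simple_graph_def by auto
  then have mm: "Min e \<noteq> Max e" "{Min e, Max e} = e"
    by (auto simp: card_2_iff min_def max_def split: if_splits)
  then show "arc (fan_curve e)" unfolding fan_curve_def by (simp add: fan_point_eq arc_linepath)
  have "{pathstart (fan_curve e), pathfinish (fan_curve e)} = fan_point ` {Min e, Max e}"
    unfolding fan_curve_def by simp
  then show "{pathstart (fan_curve e), pathfinish (fan_curve e)} = fan_point ` e" using mm(2) by simp
  show "path_image (fan_curve e) \<inter> fan_point ` verts (fan n) = fan_point ` e"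
    using fan_edge_meets_vertices[OF e] ev by auto
next
  fix e f assume h: "e \<in> edges (fan n)" "f \<in> edges (fan n)" "e \<noteq> f"
  show "path_image (fan_curve e) \<inter> path_image (fan_curve f) = fan_point ` (e \<inter> f)"
  proof
    show "path_image (fan_curve e) \<inter> path_image (fan_curve f) \<subseteq> fan_point ` (e \<inter> f)"
    proof
      fix z assume z: "z \<in> path_image (fan_curve e) \<inter> path_image (fan_curve f)"
      then obtain j where "z = fan_point j" using fan_curves_meet_in_vertex[OF h, of z] by blast
      then show "z \<in> fan_point ` (e \<inter> f)"
        using z fan_edge_meets_vertices[OF h(1)] fan_edge_meets_vertices[OF h(2)] by blast
    qed
    show "fan_point ` (e \<inter> f) \<subseteq> path_image (fan_curve e) \<inter> path_image (fan_curve f)"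
      using fan_edge_meets_vertices[OF h(1)] fan_edge_meets_vertices[OF h(2)] by blast
  qed
qed

text \<open>The complement of the rectangle that contains the drawing is connected, so it lies in a single face, and every
  vertex is a limit of points of it.\<close>

lemma fan_outerplanar: "outerplanar (fan n)"
proof -
  let ?D = "fan_point ` verts (fan n) \<union> (\<Union>e\<in>edges (fan n). path_image (fan_curve e))"
  let ?T = "cbox 0 (Complex 1 (real n))"
  have sub: "?D \<subseteq> ?T"
  proof -
    have "fan_point ` verts (fan n) \<subseteq> ?T"
      unfolding fan_point_def fan_verts by (auto simp: in_cbox_complex_iff)
    moreover have "path_image (fan_curve e) \<subseteq> ?T" if "e \<in> edges (fan n)" for e
      using that
    proof (cases rule: fan_edge_cases)
      case (1 k)
      have "real k * t \<le> real n" if "0 \<le> t" "t \<le> 1" for t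
        using mult_mono[of "real k" "real n" t 1] that 1 by simp
      then show ?thesis unfolding 1(1) spoke_image[OF 1(2)] by (auto simp: in_cbox_complex_iff)
    next
      case (2 k)
      then have "real k + 1 \<le> real n" by linarith
      then show ?thesis unfolding 2(1) rim_image[OF 2(2)] by (auto simp: in_cbox_complex_iff)
    qed
    ultimately show ?thesis by blast
  qed
  have con: "connected (- ?T)"
    by (rule connected_complement_bounded_convex) (auto simp: bounded_cbox)
  have "- ?T \<noteq> {}" using bounded_cbox[of 0 "Complex 1 (real n)"] not_bounded_UNIV by (metis Compl_empty_eq double_compl)
  then obtain F where F: "F \<in> components (- ?D)" "- ?T \<subseteq> F"
    using exists_component_superset[of "- ?T" "- ?D"] con sub by blast
  have "fan_point v \<in> frontier F" if v: "v \<in> verts (fan n)" for v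
  proof -
    have "fan_point v \<notin> interior ?T"
      unfolding interior_cbox by (simp add: in_box_complex_iff fan_point_def)
    then have "fan_point v \<in> closure (- ?T)" by (simp add: closure_complement)
    then have "fan_point v \<in> closure F" using closure_mono[OF F(2)] by blast
    moreover have "fan_point v \<notin> F" using in_components_subset[OF F(1)] v by blast
    ultimately show ?thesis unfolding frontier_def using interior_subset by blast
  qed
  then show ?thesis
    unfolding outerplanar_def faces_def using fan_plane_embedding F(1) by blast
qed


text \<open>For distinct edges of \<open>G\<close> this is adjacency in the extended line graph: two edges of a common 4-cycle
  either are disjoint or satisfy the first alternative.\<close>

definition linked :: "'a sgraph \<Rightarrow> 'a set \<Rightarrow> 'a set \<Rightarrow> bool" where
  "linked G e f \<longleftrightarrow> e \<inter> f \<noteq> {} \<or> (\<exists>C\<in>four_cycles G. e \<in> C \<and> f \<in> C)"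

lemma linkedI: "C \<in> four_cycles G \<Longrightarrow> e \<in> C \<Longrightarrow> f \<in> C \<Longrightarrow> linked G e f"
  unfolding linked_def by blast

lemma simple_finite_edges: "simple_graph G \<Longrightarrow> finite (edges G)"
  using finite_subset[of "edges G" "Pow (verts G)"] unfolding simple_graph_def by auto

lemma four_cycle_card:
  assumes "C \<in> four_cycles G" shows "card C = 4" "C \<subseteq> edges G"
proof -
  obtain a b c d where C: "C = {{a, b}, {b, c}, {c, d}, {d, a}}" and d: "distinct [a, b, c, d]"
    and e: "adj G a b" "adj G b c" "adj G c d" "adj G d a"
    using assms by (rule four_cyclesE)
  have "distinct [{a, b}, {b, c}, {c, d}, {d, a}]"
    by (rule distinct4) (use d in \<open>auto simp: doubleton_eq_iff\<close>)
  from distinct_card[OF this] show "card C = 4" unfolding C by simp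
  show "C \<subseteq> edges G" unfolding C using e by simp
qed

lemma injective_B_coloring:
  assumes "inj_on col (edges G)" shows "B_coloring G col"
proof -
  have "card (col ` C) = 4" if "C \<in> four_cycles G" for C
    using four_cycle_card[OF that] card_image[OF inj_on_subset[OF assms]] by metis
  moreover have "proper_edge_coloring G col"
    using assms unfolding proper_edge_coloring_def by (auto dest: inj_onD)
  ultimately show ?thesis unfolding B_coloring_def by blast
qed

lemma q_B_le_card_edges:
  assumes "simple_graph G"
  shows "q_B G \<le> card (edges G)" "\<exists>col. B_coloring G col \<and> col ` edges G \<subseteq> {..<q_B G}"
proof -
  obtain col :: "'a set \<Rightarrow> nat" where "bij_betw col (edges G) {..<card (edges G)}"
    using ex_bij_betw_finite_nat[OF simple_finite_edges[OF assms]] unfolding atLeast0LessThan by blast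
  then have *: "\<exists>col. B_coloring G col \<and> col ` edges G \<subseteq> {..<card (edges G)}"
    using injective_B_coloring unfolding bij_betw_def by blast
  then show "q_B G \<le> card (edges G)" unfolding q_B_def by (rule Least_le)
  from * show "\<exists>col. B_coloring G col \<and> col ` edges G \<subseteq> {..<q_B G}"
    unfolding q_B_def by (rule LeastI)
qed

lemma q_B_ge_linked:
  assumes G: "simple_graph G" and K: "K \<subseteq> edges G"
    and l: "\<And>e f. e \<in> K \<Longrightarrow> f \<in> K \<Longrightarrow> e \<noteq> f \<Longrightarrow> linked G e f"
  shows "card K \<le> q_B G"
proof -
  obtain col where col: "B_coloring G col" "col ` edges G \<subseteq> {..<q_B G}"
    using q_B_le_card_edges(2)[OF G] by blast
  have "inj_on col K"
  proof (rule inj_onI, rule ccontr)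
    fix e f assume h: "e \<in> K" "f \<in> K" "col e = col f" "e \<noteq> f"
    from l[OF h(1,2,4)] consider "e \<inter> f \<noteq> {}" | C where "C \<in> four_cycles G" "e \<in> C" "f \<in> C"
      unfolding linked_def by blast
    then show False
    proof cases
      case 1
      then show False using col(1) h K unfolding B_coloring_def proper_edge_coloring_def by blast
    next
      case (2 C)
      then have "card (col ` C) = card C" "finite C"
        using col(1) four_cycle_card(1)[OF 2(1)] card.infinite[of C] unfolding B_coloring_def by force+
      then have "inj_on col C" by (intro eq_card_imp_inj_on)
      then show False using 2 h by (auto dest: inj_onD)
    qed
  qed
  then have "card K = card (col ` K)" by (simp add: card_image)
  also have "\<dots> \<le> card {..<q_B G}" using col(2) K by (intro card_mono) auto
  finally show ?thesis by simp
qed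

lemma clique_number_ge_linked:
  assumes G: "simple_graph G" and K: "K \<subseteq> edges G"
    and l: "\<And>e f. e \<in> K \<Longrightarrow> f \<in> K \<Longrightarrow> e \<noteq> f \<Longrightarrow> linked G e f"
  shows "card K \<le> clique_number (ext_line_graph G)"
proof -
  have "{card K | K. is_clique (ext_line_graph G) K} \<subseteq> card ` Pow (edges G)"
    unfolding is_clique_def ext_line_graph_def by auto
  then have fin: "finite {card K | K. is_clique (ext_line_graph G) K}"
    using simple_finite_edges[OF G] by (meson finite_Pow_iff finite_imageI finite_subset)
  have "{e, f} \<in> edges (ext_line_graph G)" if "e \<in> K" "f \<in> K" "e \<noteq> f" for e f
  proof -
    have "e \<inter> f \<noteq> {} \<or> e \<inter> f = {} \<and> (\<exists>C\<in>four_cycles G. e \<in> C \<and> f \<in> C)"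
      using l[OF that] unfolding linked_def by blast
    then show ?thesis
      unfolding ext_line_graph_def sgraph.sel using that K by blast
  qed
  then have "is_clique (ext_line_graph G) K"
    using K unfolding is_clique_def by (simp add: ext_line_graph_def)
  then show ?thesis unfolding clique_number_def using fin by (intro Max_ge) auto
qed

lemma four_cycleI:
  assumes "distinct [a, b, c, d]" "adj G a b" "adj G b c" "adj G c d" "adj G d a"
  shows "{{a, b}, {b, c}, {c, d}, {d, a}} \<in> four_cycles G"
  unfolding four_cycles_def using assms by blast

lemma q_B_cycle4: "q_B cycle4 = 4"
proof -
  have s: "simple_graph cycle4" unfolding simple_graph_def cycle4_def by auto
  have C: "edges cycle4 \<in> four_cycles cycle4"
    using four_cycleI[of 0 1 2 3 cycle4] by (simp add: cycle4_def)
  have "card (edges cycle4) \<le> q_B cycle4"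
    by (rule q_B_ge_linked[OF s]) (use C in \<open>auto simp: linked_def\<close>)
  then show ?thesis using q_B_le_card_edges(1)[OF s] four_cycle_card(1)[OF C] by simp
qed

lemma K4_minus_edge_edges: "edges K4_minus_edge = {{0, 2}, {0, 1}, {1, 2}, {2, 3}, {3, 0}}"
proof
  show "edges K4_minus_edge \<subseteq> {{0, 2}, {0, 1}, {1, 2}, {2, 3}, {3, 0}}"
  proof
    fix e assume "e \<in> edges K4_minus_edge"
    then have e: "e \<subseteq> {0, 1, 2, 3}" "card e = 2" "e \<noteq> {1, 3}" unfolding K4_minus_edge_def by auto
    then obtain i j where ij: "e = {i, j}" "i \<noteq> j" by (meson card_2_iff)
    then have "i = 0 \<or> i = 1 \<or> i = 2 \<or> i = 3" "j = 0 \<or> j = 1 \<or> j = 2 \<or> j = 3" using e(1) by simp_all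
    then show "e \<in> {{0, 2}, {0, 1}, {1, 2}, {2, 3}, {3, 0}}"
      using ij e(3) by (elim disjE) (simp_all add: doubleton_eq_iff)
  qed
  show "{{0, 2}, {0, 1}, {1, 2}, {2, 3}, {3, 0}} \<subseteq> edges K4_minus_edge"
    unfolding K4_minus_edge_def by (auto simp: doubleton_eq_iff)
qed

lemma q_B_K4_minus_edge: "q_B K4_minus_edge = 5"
proof -
  let ?G = K4_minus_edge
  have s: "simple_graph ?G" unfolding simple_graph_def K4_minus_edge_def by auto
  obtain C where C_def: "C = {{0, 1}, {1, 2}, {2, 3}, {3, 0 :: nat}}" by blast
  have C: "C \<in> four_cycles ?G"
    unfolding C_def by (rule four_cycleI) (auto simp: K4_minus_edge_edges)
  have E: "edges ?G = insert {0, 2} C"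
    unfolding C_def by (rule K4_minus_edge_edges)
  have diag: "{0, 2} \<inter> e \<noteq> {}" if "e \<in> edges ?G" for e
    using that unfolding K4_minus_edge_edges insert_iff empty_iff by (elim disjE) simp_all
  have l: "linked ?G e f" if "e \<in> edges ?G" "f \<in> edges ?G" for e f
  proof (cases "e = {0, 2} \<or> f = {0, 2}")
    case True
    then have "e \<inter> f \<noteq> {}" using diag[OF that(1)] diag[OF that(2)] by (elim disjE) (simp_all add: Int_commute)
    then show ?thesis unfolding linked_def by blast
  next
    case False
    then have "e \<in> C" "f \<in> C" using that unfolding E by blast+
    then show ?thesis by (rule linkedI[OF C])
  qed
  have "card (edges ?G) \<le> q_B ?G" by (rule q_B_ge_linked[OF s]) (use l in auto)
  moreover have "card (edges ?G) = 5" unfolding K4_minus_edge_edges by (simp add: doubleton_eq_iff)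
  ultimately show ?thesis using q_B_le_card_edges(1)[OF s] by simp
qed

lemma graph_iso_card: "graph_iso G H \<Longrightarrow> card (verts G) = card (verts H)"
  unfolding graph_iso_def using bij_betw_same_card by blast

lemma fan_not_iso:
  assumes "n \<noteq> 3" shows "\<not> graph_iso (fan n) cycle4" "\<not> graph_iso (fan n) K4_minus_edge"
  using assms graph_iso_card[of "fan n" cycle4] graph_iso_card[of "fan n" K4_minus_edge]
  by (auto simp: fan_verts cycle4_def K4_minus_edge_def)

lemma q_B_fan2: "3 \<le> q_B (fan 2)"
proof -
  have "edges (fan 2) = {{0, 1}, {0, 2}, {1, 2}}"
    unfolding fan_edges by (auto simp: atLeastAtMost_def atMost_def numeral_2_eq_2 less_Suc_eq_le)
  then have "{{0, 1}, {0, 2}, {1, 2}} \<subseteq> edges (fan 2)" by simp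
  then have "card {{0, 1}, {0, 2}, {1, 2 :: nat}} \<le> q_B (fan 2)"
  proof (rule q_B_ge_linked[OF fan_simple])
    show "linked (fan 2) e f" if "e \<in> {{0, 1}, {0, 2}, {1, 2}}" "f \<in> {{0, 1}, {0, 2}, {1, 2}}" for e f
      using that unfolding linked_def insert_iff empty_iff by (elim disjE) simp_all
  qed
  moreover have "card {{0, 1}, {0, 2}, {1, 2 :: nat}} = 3" by (simp add: doubleton_eq_iff)
  ultimately show ?thesis by simp
qed

text \<open>The four spokes are pairwise incident, and the middle edge \<open>{2, 3}\<close> of the path meets two of them and lies on a 4-cycle
  with each of the other two, so these five edges need five colours.\<close>

lemma q_B_fan4: "5 \<le> q_B (fan 4)"
proof -
  have e: "{0, 1} \<in> edges (fan 4)" "{0, 2} \<in> edges (fan 4)" "{0, 3} \<in> edges (fan 4)" "{0, 4} \<in> edges (fan 4)"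
    "{1, 2} \<in> edges (fan 4)" "{2, 3} \<in> edges (fan 4)" "{3, 4} \<in> edges (fan 4)"
    using spoke_edge[of 1 4] spoke_edge[of 2 4] spoke_edge[of 3 4] spoke_edge[of 4 4]
      rim_edge[of 1 4] rim_edge[of 2 4] rim_edge[of 3 4] by (simp_all add: numeral_eq_Suc)
  have C: "{{0, 1}, {1, 2}, {2, 3}, {3, 0}} \<in> four_cycles (fan 4)" "{{0, 2}, {2, 3}, {3, 4}, {4, 0}} \<in> four_cycles (fan 4)"
    using e by (intro four_cycleI; simp add: insert_commute)+
  let ?K = "{{0, 1}, {0, 2}, {0, 3}, {0, 4}, {2, 3 :: nat}}"
  have r: "linked (fan 4) {2, 3} f \<and> linked (fan 4) f {2, 3}" if h: "f \<in> ?K" for f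
  proof -
    from h have "f = {0, 1} \<or> f = {0, 4} \<or> f \<inter> {2, 3} \<noteq> {}"
      unfolding insert_iff empty_iff by (elim disjE) simp_all
    moreover have "{0, 4} = {4, 0 :: nat}" by auto
    moreover have "linked (fan 4) {2, 3} {0, 1}" "linked (fan 4) {0, 1} {2, 3}"
      by (rule linkedI[OF C(1)]; simp)+
    moreover have "linked (fan 4) {2, 3} {4, 0}" "linked (fan 4) {4, 0} {2, 3}"
      by (rule linkedI[OF C(2)]; simp)+
    moreover have "linked (fan 4) {2, 3} f \<and> linked (fan 4) f {2, 3}" if "f \<inter> {2, 3} \<noteq> {}"
      using that unfolding linked_def by blast
    ultimately show ?thesis by metis
  qed
  have "card ?K \<le> q_B (fan 4)"
  proof (rule q_B_ge_linked[OF fan_simple])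
    show "?K \<subseteq> edges (fan 4)" using e by simp
    show "linked (fan 4) f g" if "f \<in> ?K" "g \<in> ?K" "f \<noteq> g" for f g
    proof (cases "f = {2, 3} \<or> g = {2, 3}")
      case False
      then have "0 \<in> f \<inter> g" using that by auto
      then show ?thesis unfolding linked_def by blast
    qed (use r that in blast)
  qed
  moreover have "card ?K = 5" by (simp add: doubleton_eq_iff)
  ultimately show ?thesis by simp
qed

lemma clique_number_fan: "n \<le> clique_number (ext_line_graph (fan n))"
proof -
  let ?K = "(\<lambda>k. {0, k}) ` {1..n}"
  have "card ?K \<le> clique_number (ext_line_graph (fan n))"
  proof (rule clique_number_ge_linked[OF fan_simple])
    show "?K \<subseteq> edges (fan n)" unfolding fan_edges by blast
    show "linked (fan n) e f" if "e \<in> ?K" "f \<in> ?K" for e f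
    proof -
      have "0 \<in> e \<inter> f" using that by auto
      then show ?thesis unfolding linked_def by blast
    qed
  qed
  moreover have "card ?K = n" by (subst card_image) (auto simp: inj_on_def doubleton_eq_iff)
  ultimately show ?thesis by simp
qed

theorem q_B_outerplanar:
  assumes "simple_graph G" "two_connected G" "outerplanar G" "max_degree G \<le> \<Delta>"
    "\<not> graph_iso G cycle4" "\<not> graph_iso G K4_minus_edge"
  shows "q_B G \<le> \<Delta> + 1"
proof -
  obtain p \<gamma> F xs where "hamiltonian_outerplane_graph G p \<gamma> F xs"
    using assms(1-3) by (rule outerplanar_hamiltonian)
  then show ?thesis using assms(4-6) by (rule hamiltonian_outerplane_graph.q_B_bound)
qed

theorem clique_number_outerplanar:
  assumes "5 \<le> \<Delta>" "simple_graph G" "two_connected G" "outerplanar G" "max_degree G \<le> \<Delta>"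
  shows "clique_number (ext_line_graph G) \<le> \<Delta>"
proof -
  obtain p \<gamma> F xs where "hamiltonian_outerplane_graph G p \<gamma> F xs"
    using assms(2-4) by (rule outerplanar_hamiltonian)
  then show ?thesis using assms(5,1) by (rule hamiltonian_outerplane_graph.clique_number_bound)
qed

theorem theorem1p6:
  shows
    "q_B cycle4 = 4 \<and> q_B K4_minus_edge = 5 \<and>
     (\<forall>(G :: 'a sgraph) (\<Delta> :: nat).
        simple_graph G \<and> two_connected G \<and> outerplanar G \<and> max_degree G \<le> \<Delta> \<and>
        \<not> graph_iso G cycle4 \<and> \<not> graph_iso G K4_minus_edge \<longrightarrow> q_B G \<le> \<Delta> + 1) \<and>
     (\<forall>\<Delta> \<in> {2, 4 :: nat}. \<exists>G :: nat sgraph.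
        simple_graph G \<and> two_connected G \<and> outerplanar G \<and> max_degree G \<le> \<Delta> \<and>
        \<not> graph_iso G cycle4 \<and> \<not> graph_iso G K4_minus_edge \<and> q_B G = \<Delta> + 1) \<and>
     (\<forall>(G :: 'a sgraph) (\<Delta> :: nat).
        5 \<le> \<Delta> \<and> simple_graph G \<and> two_connected G \<and> outerplanar G \<and> max_degree G \<le> \<Delta> \<longrightarrow>
        clique_number (ext_line_graph G) \<le> \<Delta>) \<and>
     (\<forall>\<Delta> :: nat. 5 \<le> \<Delta> \<longrightarrow> (\<exists>G :: nat sgraph.
        simple_graph G \<and> two_connected G \<and> outerplanar G \<and> max_degree G \<le> \<Delta> \<and>
        clique_number (ext_line_graph G) = \<Delta>))"
proof (intro conjI allI ballI impI)
  show "q_B cycle4 = 4" by (rule q_B_cycle4)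
  show "q_B K4_minus_edge = 5" by (rule q_B_K4_minus_edge)
next
  fix G :: "'a sgraph" and \<Delta> :: nat
  assume "simple_graph G \<and> two_connected G \<and> outerplanar G \<and> max_degree G \<le> \<Delta> \<and>
    \<not> graph_iso G cycle4 \<and> \<not> graph_iso G K4_minus_edge"
  then show "q_B G \<le> \<Delta> + 1" by (intro q_B_outerplanar) simp_all
next
  fix \<Delta> :: nat assume \<Delta>: "\<Delta> \<in> {2, 4}"
  have G: "simple_graph (fan \<Delta>)" "two_connected (fan \<Delta>)" "outerplanar (fan \<Delta>)" "max_degree (fan \<Delta>) \<le> \<Delta>"
    "\<not> graph_iso (fan \<Delta>) cycle4" "\<not> graph_iso (fan \<Delta>) K4_minus_edge"
    using \<Delta> fan_simple fan_two_connected fan_outerplanar fan_max_degree fan_not_iso by auto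
  have "\<Delta> + 1 \<le> q_B (fan \<Delta>)" using \<Delta> q_B_fan2 q_B_fan4 by auto
  then have "q_B (fan \<Delta>) = \<Delta> + 1" using q_B_outerplanar[OF G] by simp
  then show "\<exists>G :: nat sgraph. simple_graph G \<and> two_connected G \<and> outerplanar G \<and> max_degree G \<le> \<Delta> \<and>
        \<not> graph_iso G cycle4 \<and> \<not> graph_iso G K4_minus_edge \<and> q_B G = \<Delta> + 1"
    using G by blast
next
  fix G :: "'a sgraph" and \<Delta> :: nat
  assume "5 \<le> \<Delta> \<and> simple_graph G \<and> two_connected G \<and> outerplanar G \<and> max_degree G \<le> \<Delta>"
  then show "clique_number (ext_line_graph G) \<le> \<Delta>" by (intro clique_number_outerplanar) simp_all
next
  fix \<Delta> :: nat assume \<Delta>: "5 \<le> \<Delta>"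
  have G: "simple_graph (fan \<Delta>)" "two_connected (fan \<Delta>)" "outerplanar (fan \<Delta>)" "max_degree (fan \<Delta>) \<le> \<Delta>"
    using \<Delta> fan_simple fan_two_connected fan_outerplanar fan_max_degree by auto
  have "clique_number (ext_line_graph (fan \<Delta>)) = \<Delta>"
    using clique_number_outerplanar[OF \<Delta> G] clique_number_fan by (rule antisym)
  then show "\<exists>G :: nat sgraph. simple_graph G \<and> two_connected G \<and> outerplanar G \<and> max_degree G \<le> \<Delta> \<and>
        clique_number (ext_line_graph G) = \<Delta>"
    using G by blast
qed

end
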